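(* Let $r\ge 2$ and let $F_1,\ldots,F_r$ be $k$-uniform hypergraphs such that $F_2$ has at least three edges, $m_k(F_1)\ge m_k(F_2)\ge\cdots\ge m_k(F_r)$, and: (i) $F_1$ and $F_2$ are strictly $k$-balanced and $m_k(F_2)\ge 1$; (ii) $F_1$ is strictly balanced with respect to $m_k(\cdot,F_2)$; (iii) $\mathcal F^*(F_1,F_2)$ is asymmetric-balanced; (iv) for every $k$-uniform hypergraph $G$ with $m(G)\le m_k(F_1,F_2)$ we have $G\nrightarrow (F_1,F_2)$. Then there exists a constant $c>0$ such that for $p\le c n^{-1/m_k(F_1,F_2)}$, $$\lim_{n\to\infty}\Pr[H^k(n,p)\rightarrow(F_1,\ldots,F_r)]=0.$$
   Context: $H^k(n,p)$: random $k$-uniform hypergraph on $n$ vertices, each $k$-set an edge independently with probability $p$. $G\rightarrow(F_1,\ldots,F_r)$: every $r$-colouring of $E(G)$ has, for some $i$, a copy of $F_i$ entirely in colour $i$; $G\nrightarrow$ is its negation. $d_k(G)=0$ if $e(G)=0$, $=1/k$ if $e(G)=1,v(G)=k$, and $=\frac{e(G)-1}{v(G)-k}$ otherwise; $m_k(G)=\max_{H\subseteq G}d_k(H)$; $G$ is strictly $k$-balanced if every proper subhypergraph $H\subsetneq G$ has $d_k(H)<d_k(G)=m_k(G)$. $m(G)=\max_{H\subseteq G, v(H)\ge 1} e(H)/v(H)$. For $m_k(F_1)\ge m_k(F_2)$: $m_k(F_1,F_2)=\max\{\frac{e(F_1')}{v(F_1')-k+1/m_k(F_2)}: F_1'\subseteq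 F_1, e(F_1')\ge1\}$, and $F_1$ is strictly balanced with respect to $m_k(\cdot,F_2)$ if no proper $F_1'\subsetneq F_1$ with $e(F_1')\ge1$ attains the maximum. $\mathcal F^*(F_1,F_2)$ is the family of hypergraphs $F^*$ for which there exist $F_2^*\cong F_2$, an edge $e_0\in E(F_2^* )$, and for each $e\in E(F_2^* )\setminus\{e_0\}$ a hypergraph $F_1^e\cong F_1$ with $e\in E(F_1^e)$ (the $F_1^e$ need not be distinct), such that $F^*=F_2^*\cup\bigcup_{e\in E(F_2^* )\setminus\{e_0\}}F_1^e$; such an $e_0$ is called an attachment edge of $F^*$. $F^*$ is generic if each $F_1^e$ meets $F_2^*$ in exactly the $k$ vertices of $e$ and the other vertices of $F_1^e$ are disjoint from those of every other $F_1^{e'}$. $\mathcal F^*(F_1,F_2)$ is asymmetric-balanced if for all $F^*\in\mathcal F^*(F_1,F_2)$ and all $H\subsetneq F^*$ with $V(H)\subsetneq V(F^* )$ containing an attachment edge of $F^*$: (1) $\frac{e(F^* )-e(H)}{v(F^* )-v(H)}\ge m_k(F_1,F_2)$, and (2) if equality holds then $H$ consists of exactly an attachment edge and $F^*$ is generic.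
   Formalization: Every F_i is additionally assumed to have at least one edge; this matters only for i ≥ 3, where an edgeless F_i would trivially have a copy in colour i and make the claim false. *)

theory Defs
  imports "HOL-Probability.Probability" "HOL-Probability.Product_PMF"
begin

text \<open>A hypergraph is a pair of a vertex set and an edge set. Isolated vertices are allowed.\<close>

type_synonym 'a hgraph = "'a set \<times> 'a set set"

abbreviation verts :: "'a hgraph \<Rightarrow> 'a set" where "verts \<equiv> fst"
abbreviation edges :: "'a hgraph \<Rightarrow> 'a set set" where "edges \<equiv> snd"
abbreviation nv :: "'a hgraph \<Rightarrow> real" where "nv H \<equiv> real (card (verts H))"
abbreviation ne :: "'a hgraph \<Rightarrow> real" where "ne H \<equiv> real (card (edges H))"

definition uniform_hgraph :: "nat \<Rightarrow> 'a hgraph \<Rightarrow> bool" where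
  "uniform_hgraph k H \<longleftrightarrow> finite (verts H) \<and> (\<forall>e\<in>edges H. e \<subseteq> verts H \<and> card e = k)"

definition subhgraph :: "'a hgraph \<Rightarrow> 'a hgraph \<Rightarrow> bool" where
  "subhgraph H G \<longleftrightarrow> verts H \<subseteq> verts G \<and> edges H \<subseteq> edges G \<and> (\<forall>e\<in>edges H. e \<subseteq> verts H)"

definition proper_subhgraph :: "'a hgraph \<Rightarrow> 'a hgraph \<Rightarrow> bool" where
  "proper_subhgraph H G \<longleftrightarrow> subhgraph H G \<and> H \<noteq> G"

definition hgraph_iso :: "'a hgraph \<Rightarrow> 'b hgraph \<Rightarrow> bool" where
  "hgraph_iso G H \<longleftrightarrow> (\<exists>f. bij_betw f (verts G) (verts H) \<and> (\<lambda>e. f ` e) ` edges G = edges H)"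

definition arrows :: "'b hgraph \<Rightarrow> nat \<Rightarrow> (nat \<Rightarrow> 'a hgraph) \<Rightarrow> bool" where
  "arrows G r F \<longleftrightarrow>
     (\<forall>col. (\<forall>e\<in>edges G. col e \<in> {1..r}) \<longrightarrow>
        (\<exists>i\<in>{1..r}. \<exists>C. subhgraph C G \<and> hgraph_iso (F i) C \<and> (\<forall>e\<in>edges C. col e = i)))"

definition d_k :: "nat \<Rightarrow> 'a hgraph \<Rightarrow> real" where
  "d_k k G =
     (if card (edges G) = 0 then 0
      else if card (edges G) = 1 \<and> card (verts G) = k then 1 / real k
      else (ne G - 1) / (nv G - real k))"

definition m_k :: "nat \<Rightarrow> 'a hgraph \<Rightarrow> real" where
  "m_k k G = Max {d_k k H |H. subhgraph H G}"

definition strictly_k_balanced :: "nat \<Rightarrow> 'a hgraph \<Rightarrow> bool" where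
  "strictly_k_balanced k G \<longleftrightarrow>
     d_k k G = m_k k G \<and> (\<forall>H. proper_subhgraph H G \<longrightarrow> d_k k H < d_k k G)"

text \<open>The maximum density of the hypergraph without vertices, where the maximum would range
  over the empty set, is set to 0.\<close>

definition max_density :: "'a hgraph \<Rightarrow> real" where
  "max_density G =
     (if verts G = {} then 0 else Max {ne H / nv H |H. subhgraph H G \<and> card (verts H) \<ge> 1})"

definition d_k2 :: "nat \<Rightarrow> 'a hgraph \<Rightarrow> 'b hgraph \<Rightarrow> real" where
  "d_k2 k H F2 = ne H / (nv H - real k + 1 / m_k k F2)"

definition m_k2 :: "nat \<Rightarrow> 'a hgraph \<Rightarrow> 'b hgraph \<Rightarrow> real" where
  "m_k2 k F1 F2 = Max {d_k2 k H F2 |H. subhgraph H F1 \<and> card (edges H) \<ge> 1}"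

definition strictly_balanced_wrt :: "nat \<Rightarrow> 'a hgraph \<Rightarrow> 'b hgraph \<Rightarrow> bool" where
  "strictly_balanced_wrt k F1 F2 \<longleftrightarrow>
     \<not> (\<exists>H. proper_subhgraph H F1 \<and> card (edges H) \<ge> 1 \<and> d_k2 k H F2 = m_k2 k F1 F2)"

text \<open>A representation of \<open>Fs\<close> as a member of the family \<open>\<F>\<^sup>*(F1, F2)\<close>: the copy \<open>F2s\<close> of \<open>F2\<close>,
  the attachment edge \<open>e0\<close>, and the copy \<open>C e\<close> of \<open>F1\<close> for every other edge \<open>e\<close> of \<open>F2s\<close>.
  All copies live on the natural numbers, which contain every finite hypergraph up to
  isomorphism.\<close>

definition fstar_rep ::
  "'a hgraph \<Rightarrow> 'b hgraph \<Rightarrow> nat hgraph \<Rightarrow> nat hgraph \<Rightarrow> nat set \<Rightarrow> (nat set \<Rightarrow> nat hgraph) \<Rightarrow> bool"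
where
  "fstar_rep F1 F2 Fs F2s e0 C \<longleftrightarrow>
     hgraph_iso F2 F2s \<and> e0 \<in> edges F2s \<and>
     (\<forall>e\<in>edges F2s - {e0}. hgraph_iso F1 (C e) \<and> e \<in> edges (C e)) \<and>
     verts Fs = verts F2s \<union> (\<Union>e\<in>edges F2s - {e0}. verts (C e)) \<and>
     edges Fs = edges F2s \<union> (\<Union>e\<in>edges F2s - {e0}. edges (C e))"

definition fstar :: "'a hgraph \<Rightarrow> 'b hgraph \<Rightarrow> nat hgraph set" where
  "fstar F1 F2 = {Fs. \<exists>F2s e0 C. fstar_rep F1 F2 Fs F2s e0 C}"

definition attachment_edge :: "'a hgraph \<Rightarrow> 'b hgraph \<Rightarrow> nat hgraph \<Rightarrow> nat set \<Rightarrow> bool" where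
  "attachment_edge F1 F2 Fs e0 \<longleftrightarrow> (\<exists>F2s C. fstar_rep F1 F2 Fs F2s e0 C)"

text \<open>For uniform \<open>F1\<close> and \<open>F2\<close>, being generic does not depend on the representation chosen:
  the generic representations are those in which the number of vertices of \<open>Fs\<close> is as large as
  possible.\<close>

definition generic :: "'a hgraph \<Rightarrow> 'b hgraph \<Rightarrow> nat hgraph \<Rightarrow> bool" where
  "generic F1 F2 Fs \<longleftrightarrow>
     (\<exists>F2s e0 C. fstar_rep F1 F2 Fs F2s e0 C \<and>
        (\<forall>e\<in>edges F2s - {e0}. verts (C e) \<inter> verts F2s = e) \<and>
        (\<forall>e\<in>edges F2s - {e0}. \<forall>e'\<in>edges F2s - {e0}. e \<noteq> e' \<longrightarrow>
           (verts (C e) - e) \<inter> (verts (C e') - e') = {}))"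

definition asymmetric_balanced :: "nat \<Rightarrow> 'a hgraph \<Rightarrow> 'b hgraph \<Rightarrow> bool" where
  "asymmetric_balanced k F1 F2 \<longleftrightarrow>
     (\<forall>Fs\<in>fstar F1 F2. \<forall>H.
        proper_subhgraph H Fs \<and> verts H \<subset> verts Fs \<and>
        (\<exists>e0. attachment_edge F1 F2 Fs e0 \<and> e0 \<in> edges H) \<longrightarrow>
          (ne Fs - ne H) / (nv Fs - nv H) \<ge> m_k2 k F1 F2 \<and>
          ((ne Fs - ne H) / (nv Fs - nv H) = m_k2 k F1 F2 \<longrightarrow>
             (\<exists>e0. attachment_edge F1 F2 Fs e0 \<and> H = (e0, {e0})) \<and> generic F1 F2 Fs))"

definition random_hgraph :: "nat \<Rightarrow> nat \<Rightarrow> real \<Rightarrow> nat hgraph pmf" where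
  "random_hgraph k n p =
     map_pmf (\<lambda>b. ({1..n}, {e. e \<subseteq> {1..n} \<and> card e = k \<and> b e}))
       (Pi_pmf {e. e \<subseteq> {1..n} \<and> card e = k} False (\<lambda>_. bernoulli_pmf p))"

end

theory Submission
  imports Defs "HOL-Real_Asymp.Real_Asymp"
begin

text \<open>
  If \<open>G\<close> arrows \<open>(F\<^sub>1, F\<^sub>2)\<close>, take an edge-minimal arrowing \<open>E \<subseteq> G\<close>. Colourings of proper subsets of \<open>E\<close>
  with as many red edges as possible show that every edge of \<open>E\<close> is the attachment edge of a member of
  \<open>\<F>\<^sup>*\<close> inside \<open>E\<close>, and that from every nonempty proper \<open>S \<subset> E\<close> one can leave \<open>S\<close> along a copy of
  \<open>F\<^sub>1\<close> or a member of \<open>\<F>\<^sup>*\<close>. So \<open>E\<close> can be explored from a single edge. Each extension either is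
  dense, gaining a factor \<open>n\<^sup>-\<^sup>\<epsilon>\<close> in the expected number of occurrences, or attaches a generic member of
  \<open>\<F>\<^sup>*\<close> at one edge, costing a small constant factor.

  A generic extension creates at least two petals, that is, copies of \<open>F\<^sub>1\<close> hanging on the explored set
  by one edge, and destroys at most one, while a dense extension destroys boundedly many. By strict
  balancedness an edge of a petal is never the attachment edge of a member of \<open>\<F>\<^sup>*\<close> inside the explored
  set; hence there are no petals once all of \<open>E\<close> is explored. With high probability there are
  neither \<open>D\<close> dense extensions nor logarithmically many extensions, so \<open>E\<close> has
  bounded size. Then hypothesis (iv) provides a fixed-size subhypergraph of density greater than
  \<open>m\<^sub>k(F\<^sub>1, F\<^sub>2)\<close>, which with high probability does not occur.
\<close>

section \<open>Balanced families and petals\<close>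

text \<open>The obstacle is the number of places where a generic extension can be attached. At one
  fixed edge the expected number of such extensions is a constant times \<open>c\<close>, but the
  explored set may have of the order of log n vertices, and a free choice among its edges would cost
  a factor that no constant \<open>c\<close> absorbs. Petals remove this factor: their edges have to
  be attachment edges inside \<open>E\<close> but are not yet so inside the explored set, so the
  next extension can be demanded at one prescribed edge. In the absence of petals the bookkeeping
  bounds the number of steps made so far in terms of \<open>D\<close>, and all edges may be allowed.
  Dense extensions need no such care, since n powr (-\<epsilon>) beats every power of log n. The
  constants are not circular: \<epsilon> depends on \<open>F 1\<close> and \<open>F 2\<close> only,
  \<open>D\<close> on \<epsilon> and \<open>k\<close>, and \<open>c\<close> is chosen after
  \<open>D\<close>.\<close>

lemma card_ge_2_other:
  assumes "card A \<ge> 2"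
  obtains x where "x \<in> A" "x \<noteq> a"
proof -
  have "\<not> A \<subseteq> {a}" using assms card_mono[of "{a}" A] by auto
  then show ?thesis using that by blast
qed

text \<open>A copy is represented by its edge set alone, with the union as vertex set; strictly
  balanced hypergraphs with at least two edges and \<open>d \<ge> 1\<close> have no isolated
  vertices. The density conditions are multiplied out, so sets \<open>W\<close> of size
  \<open>k\<close> cause no division by zero. Vertices of \<open>W\<close> outside
  \<open>\<Union>A\<close> are allowed because copies get cut along vertex sets.\<close>

locale balanced_family =
  fixes k ev vv :: nat and d :: real and cop :: "nat set set set"
  assumes k_pos: "k \<ge> 1"
    and d_ge_1: "d \<ge> 1"
    and cop_card_edge: "\<And>P e. P \<in> cop \<Longrightarrow> e \<in> P \<Longrightarrow> card e = k"
    and cop_finite: "\<And>P. P \<in> cop \<Longrightarrow> finite P"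
    and cop_card: "\<And>P. P \<in> cop \<Longrightarrow> card P = ev"
    and cop_card_verts: "\<And>P. P \<in> cop \<Longrightarrow> card (\<Union>P) = vv"
    and cop_density: "real ev - 1 = d * (real vv - real k)"
    and cop_density_le: "\<And>P A W. P \<in> cop \<Longrightarrow> A \<subseteq> P \<Longrightarrow> A \<noteq> {} \<Longrightarrow> \<Union>A \<subseteq> W \<Longrightarrow> W \<subseteq> \<Union>P \<Longrightarrow>
      real (card A) - 1 \<le> d * (real (card W) - real k)"
    and cop_density_less: "\<And>P A W. P \<in> cop \<Longrightarrow> A \<subset> P \<Longrightarrow> A \<noteq> {} \<Longrightarrow> \<Union>A \<subseteq> W \<Longrightarrow> W \<subseteq> \<Union>P \<Longrightarrow>
      card W > k \<Longrightarrow> real (card A) - 1 < d * (real (card W) - real k)"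
begin

lemma cop_finite_edge: "P \<in> cop \<Longrightarrow> e \<in> P \<Longrightarrow> finite e"
  using cop_card_edge[of P e] k_pos by (intro card_ge_0_finite) auto

lemma cop_finite_verts: "P \<in> cop \<Longrightarrow> finite (\<Union>P)"
  using cop_finite cop_finite_edge by auto

lemma card_verts_gt:
  assumes "P \<in> cop" "g \<in> P" "f \<noteq> g" "card f = k" "f \<union> g \<subseteq> W" "finite W"
  shows "card W > k"
proof (rule ccontr)
  assume "\<not> card W > k"
  moreover have "card f \<le> card W" "card g \<le> card W" using assms by (auto intro: card_mono)
  moreover have "card g = k" using assms cop_card_edge by auto
  ultimately have "card f = card W" "card g = card W" using assms by auto
  then have "f = W" "g = W" using assms card_subset_eq[of W f] card_subset_eq[of W g] by simp_all
  then show False using assms by auto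
qed

text \<open>A copy that uses an edge of \<open>P\<close> other than \<open>f\<close> cannot leave \<open>P\<close> through \<open>f\<close>: otherwise
  the parts inside and outside \<open>P\<close>, each of density at most \<open>d\<close> and at least one of them strictly
  sparser, would overlap in too few vertices and edges to build a copy of density \<open>d\<close>.\<close>

lemma copy_not_crossing_edge:
  assumes Q: "Q \<in> cop" and P: "P \<in> cop" and f: "f \<in> P"
    and sub: "Q \<subseteq> P \<union> R" and R: "\<And>g. g \<in> R \<Longrightarrow> g \<inter> \<Union>P \<subseteq> f"
    and h: "h \<in> Q" "h \<in> P" "h \<noteq> f" and ev3: "ev \<ge> 3"
  shows "Q = P"
proof -
  have "Q \<subseteq> P"
  proof (rule ccontr)
    assume "\<not> Q \<subseteq> P"
    \<comment> \<open>The edge \<open>f\<close> is kept out of both parts, while \<open>VA\<close>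
      and \<open>VB\<close> overlap exactly in the vertices of \<open>f\<close> that lie in
      \<open>Q\<close>. Three cases arise: \<open>f\<close> is an edge of \<open>Q\<close>,
      \<open>f\<close> is merely covered by the vertices of \<open>Q\<close>, or \<open>Q\<close>
      misses a vertex of \<open>f\<close>.\<close>
    define A B where "A = Q \<inter> P - {f}" and "B = Q - P"
    define VA VB where "VA = \<Union>Q \<inter> \<Union>P" and "VB = \<Union>Q \<inter> (\<Union>R \<union> f)"
    have ne: "A \<noteq> {}" "B \<noteq> {}" using \<open>\<not> Q \<subseteq> P\<close> h by (auto simp: A_def B_def)
    have BR: "B \<subseteq> R" using sub by (auto simp: B_def)
    have fin: "finite Q" "finite P" "finite (\<Union>Q)" "finite (\<Union>P)" "finite A" "finite B"
      using Q P cop_finite cop_finite_verts by (auto simp: A_def B_def)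
    have finV: "finite VA" "finite VB" using fin unfolding VA_def VB_def by blast+
    have cf: "card f = k" using cop_card_edge P f by auto
    have un: "VA \<union> VB = \<Union>Q" using sub unfolding VA_def VB_def by blast
    have int: "VA \<inter> VB = f \<inter> \<Union>Q" using R f unfolding VA_def VB_def by blast
    define s where "s = card (f \<inter> \<Union>Q)"
    have vsum: "real (card VA) + real (card VB) = real vv + real s"
      using card_Un_Int[OF finV] un int cop_card_verts[OF Q] by (simp add: s_def)
    have AVA: "\<Union>A \<subseteq> VA" "VA \<subseteq> \<Union>Q" "VA \<subseteq> \<Union>P" unfolding A_def VA_def by blast+
    have BVB: "\<Union>B \<subseteq> VB" "VB \<subseteq> \<Union>Q" using BR unfolding B_def VB_def by blast+
    have AQ: "A \<subset> Q" "B \<subset> Q" using ne by (auto simp: A_def B_def)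
    obtain a b where ab: "a \<in> A" "b \<in> B" using ne by auto
    have abQ: "a \<in> Q" "f \<noteq> a" "b \<in> Q" "f \<noteq> b" using ab f by (auto simp: A_def B_def)
    have abV: "a \<subseteq> VA" "b \<subseteq> VB" using ab AVA(1) BVB(1) by blast+
    show False
    proof (cases "f \<in> Q")
      case True
      have Q_eq: "Q = insert f (A \<union> B)" using True f by (auto simp: A_def B_def)
      have nf: "f \<notin> A" "f \<notin> B" "A \<inter> B = {}" using f by (auto simp: A_def B_def)
      have cQ: "card Q = Suc (card A + card B)"
        unfolding Q_eq using nf fin by (simp add: card_Un_disjoint)
      have sk: "s = k" using True cf by (simp add: s_def Int_absorb2 Sup_upper)
      have VfA: "f \<subseteq> VA" "f \<subseteq> VB" using True f unfolding VA_def VB_def by blast+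
      have "real (card (insert f A)) - 1 < d * (real (card VA) - real k)"
      proof (rule cop_density_less[OF Q])
        show "insert f A \<subset> Q" using True AQ ab nf ne Q_eq by auto
        show "k < card VA"
          by (rule card_verts_gt[OF Q abQ(1,2) cf]) (use VfA abV finV in auto)
      qed (use VfA AVA in auto)
      moreover have "real (card (insert f B)) - 1 < d * (real (card VB) - real k)"
      proof (rule cop_density_less[OF Q])
        show "insert f B \<subset> Q" using True AQ ab nf ne Q_eq by auto
        show "k < card VB"
          by (rule card_verts_gt[OF Q abQ(3,4) cf]) (use VfA abV finV in auto)
      qed (use VfA BVB in auto)
      ultimately have "real (card A) + real (card B) < d * (real (card VA) + real (card VB) - 2 * real k)"
        using nf fin by (simp add: algebra_simps)
      also have "\<dots> = real ev - 1" using vsum cop_density sk by (simp add: algebra_simps)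
      finally show False using cQ cop_card[OF Q] by simp
    next
      case fQ: False
      have Q_eq: "Q = A \<union> B" using fQ f by (auto simp: A_def B_def)
      have nf: "A \<inter> B = {}" using f by (auto simp: A_def B_def)
      have cQ: "card Q = card A + card B"
        unfolding Q_eq using nf fin by (simp add: card_Un_disjoint)
      show False
      proof (cases "f \<subseteq> \<Union>Q")
        case True
        have sk: "s = k" using True cf by (simp add: s_def Int_absorb2)
        have VfA: "f \<subseteq> VA" "f \<subseteq> VB" using True f unfolding VA_def VB_def by blast+
        \<comment> \<open>As \<open>f\<close> is not in \<open>Q\<close>, it is added to
          \<open>A\<close> inside \<open>P\<close> instead. This bound need not be strict, since
          \<open>insert f A\<close> may be all of \<open>P\<close>; strictness comes from
          \<open>B\<close>.\<close>
        have "real (card (insert f A)) - 1 \<le> d * (real (card VA) - real k)"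
          by (rule cop_density_le[OF P]) (use f VfA AVA in \<open>auto simp: A_def\<close>)
        moreover have "f \<notin> A" by (auto simp: A_def)
        moreover have "real (card B) - 1 < d * (real (card VB) - real k)"
        proof (rule cop_density_less[OF Q AQ(2) ne(2) BVB])
          show "k < card VB"
            by (rule card_verts_gt[OF Q abQ(3,4) cf]) (use VfA abV finV in auto)
        qed
        ultimately have "real (card A) + real (card B) - 1 < d * (real (card VA) + real (card VB) - 2 * real k)"
          using fin by (simp add: algebra_simps)
        also have "\<dots> = real ev - 1" using vsum cop_density sk by (simp add: algebra_simps)
        finally show False using cQ cop_card[OF Q] by simp
      next
        case False
        have finf: "finite f" using cop_finite_edge[OF P f] .
        have "s < k" unfolding s_def cf[symmetric]
          by (rule psubset_card_mono[OF finf]) (use False in blast)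
        then have sk: "real s \<le> real k - 1" by linarith
        have leA: "real (card A) - 1 \<le> d * (real (card VA) - real k)"
          using cop_density_le[OF Q _ ne(1) AVA(1,2)] AQ by auto
        have leB: "real (card B) - 1 \<le> d * (real (card VB) - real k)"
          using cop_density_le[OF Q _ ne(2) BVB] AQ by auto
        \<comment> \<open>The missing vertex of \<open>f\<close> lowers the overlap by at least one,
          worth \<open>d \<ge> 1\<close>, which pays for the second \<open>- 1\<close> with nothing
          to spare. So one of the two bounds has to be strict, and a part with two edges provides
          this.\<close>
        have "card A \<ge> 2 \<or> card B \<ge> 2" using cQ cop_card[OF Q] ev3 by linarith
        then have "real (card A) - 1 + (real (card B) - 1)
            < d * (real (card VA) - real k) + d * (real (card VB) - real k)"
        proof
          assume "card A \<ge> 2"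
          then obtain a' where a': "a' \<in> A" "a' \<noteq> a" by (rule card_ge_2_other)
          have "card VA > k"
          proof (rule card_verts_gt[OF Q abQ(1)])
            have "a' \<in> Q" using a' AQ by blast
            then show "card a' = k" by (rule cop_card_edge[OF Q])
            show "a' \<union> a \<subseteq> VA" using a' ab AVA(1) by blast
          qed (use a' finV in auto)
          then have "real (card A) - 1 < d * (real (card VA) - real k)"
            by (rule cop_density_less[OF Q AQ(1) ne(1) AVA(1,2)])
          then show ?thesis using leB by simp
        next
          assume "card B \<ge> 2"
          then obtain b' where b': "b' \<in> B" "b' \<noteq> b" by (rule card_ge_2_other)
          have "card VB > k"
          proof (rule card_verts_gt[OF Q abQ(3)])
            have "b' \<in> Q" using b' AQ by blast
            then show "card b' = k" by (rule cop_card_edge[OF Q])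
            show "b' \<union> b \<subseteq> VB" using b' ab BVB(1) by blast
          qed (use b' finV in auto)
          then have "real (card B) - 1 < d * (real (card VB) - real k)"
            by (rule cop_density_less[OF Q AQ(2) ne(2) BVB])
          then show ?thesis using leA by simp
        qed
        also have "\<dots> = d * (real vv - real k) + d * (real s - real k)"
        proof -
          have "real (card VB) = real vv + real s - real (card VA)" using vsum by linarith
          then show ?thesis by (simp only:) (simp add: algebra_simps)
        qed
        also have "\<dots> \<le> d * (real vv - real k) - 1"
        proof -
          have "d * (real s - real k) \<le> d * (-1)" by (rule mult_left_mono) (use sk d_ge_1 in auto)
          then show ?thesis using d_ge_1 by simp
        qed
        finally show False using cQ cop_card[OF Q] cop_density by simp
      qed
    qed
  qed
  then show ?thesis using cop_card[OF Q] cop_card[OF P] cop_finite[OF P] by (simp add: card_subset_eq)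
qed

text \<open>Some vertex of \<open>e\<close> outside \<open>f\<close> lies in no other edge of
  \<open>Q\<close>. Deleting it together with \<open>e\<close> removes one vertex and one edge,
  which by \<open>d \<ge> 1\<close> does not lower the density, against strict balancedness. With
  \<open>ev \<ge> 3\<close> two edges remain, so more than \<open>k\<close> vertices remain and the
  strict bound applies.\<close>

lemma no_pendant_edge:
  assumes Q: "Q \<in> cop" and e: "e \<in> Q" and f: "card f = k" "f \<noteq> e"
    and others: "\<And>g. g \<in> Q - {e} \<Longrightarrow> g \<inter> e \<subseteq> f" and ev3: "ev \<ge> 3"
  shows False
proof -
  have fin: "finite e" "finite Q" using cop_finite_edge Q e cop_finite by auto
  have "\<not> e \<subseteq> f"
  proof
    assume "e \<subseteq> f"
    then have "e = f" using card_subset_eq[of f e] f cop_card_edge[OF Q e] k_pos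
      by (metis card.infinite not_one_le_zero)
    then show False using f by simp
  qed
  then obtain x where x: "x \<in> e" "x \<notin> f" by auto
  define B where "B = Q - {e}"
  have xB: "x \<notin> \<Union>B" using x others by (auto simp: B_def)
  have cB: "card B = ev - 1" using cop_card[OF Q] e fin by (simp add: B_def)
  have finV: "finite (\<Union>Q)" by (rule cop_finite_verts[OF Q])
  have VB: "\<Union>B \<subseteq> \<Union>Q - {x}" using xB by (auto simp: B_def)
  have "card B \<ge> 2" using cB ev3 by simp
  then obtain a b where ab: "a \<in> B" "b \<in> B" "a \<noteq> b"
    by (metis card_ge_2_other)
  have xQ: "x \<in> \<Union>Q" using x e by blast
  then have "card (\<Union>Q) \<ge> 1" using finV by (metis One_nat_def Suc_leI card_gt_0_iff empty_iff)
  then have cV: "card (\<Union>Q - {x}) = vv - 1" "vv \<ge> 1"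
    using cop_card_verts[OF Q] xQ by (simp_all add: card_Diff_singleton)
  have "card (\<Union>Q - {x}) > k"
    by (rule card_verts_gt[of Q a b]) (use Q ab VB finV cop_card_edge in \<open>auto simp: B_def\<close>)
  then have "real (card B) - 1 < d * (real (card (\<Union>Q - {x})) - real k)"
    by (intro cop_density_less[OF Q _ _ VB]) (use ab e in \<open>auto simp: B_def\<close>)
  also have "\<dots> = d * (real vv - real k) - d" using cV by (simp add: of_nat_diff algebra_simps)
  finally show False using cB ev3 cop_density d_ge_1 by (simp add: of_nat_diff)
qed

end

section \<open>Petals and the petal number\<close>

locale copy_families =
  F1: balanced_family k e1 v1 d1 cop1 + F2: balanced_family k e2 v2 d2 cop2
  for k e1 v1 d1 cop1 e2 v2 d2 cop2 +
  assumes e2_ge_3: "e2 \<ge> 3" and e1_ge_2: "e1 \<ge> 2"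
begin

text \<open>\<open>star E Q e0\<close> says that \<open>E\<close> contains a member of the family \<open>\<F>\<^sup>*\<close> with attachment edge
  \<open>e0\<close>, built on the copy \<open>Q\<close> of the second hypergraph.\<close>

definition star :: "nat set set \<Rightarrow> nat set set \<Rightarrow> nat set \<Rightarrow> bool" where
  "star E Q e0 \<longleftrightarrow> Q \<in> cop2 \<and> Q \<subseteq> E \<and> e0 \<in> Q \<and>
     (\<forall>h\<in>Q - {e0}. \<exists>P\<in>cop1. P \<subseteq> E \<and> P \<inter> Q = {h})"

definition petal :: "nat set set \<Rightarrow> nat set set \<times> nat set \<Rightarrow> bool" where
  "petal S = (\<lambda>(P, f). P \<in> cop1 \<and> P \<subseteq> S \<and> f \<in> P \<and> (\<forall>g\<in>S - P. g \<inter> \<Union>P \<subseteq> f))"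

text \<open>If \<open>Q\<close> has an edge \<open>h\<close> of \<open>P\<close> besides
  \<open>e\<close> and \<open>f\<close>, the copy \<open>T\<close> attached at \<open>h\<close>
  equals \<open>P\<close> by \<open>copy_not_crossing_edge\<close>; but \<open>T\<close> meets
  \<open>Q\<close> in \<open>h\<close> only, while \<open>P\<close> also contains \<open>e\<close>.
  Otherwise all other edges of \<open>Q\<close> meet \<open>e\<close> inside \<open>f\<close>, which
  \<open>no_pendant_edge\<close> forbids.\<close>

lemma petal_no_star:
  assumes pet: "petal S (P, f)" and e: "e \<in> P - {f}"
  shows "\<not> star S Q e"
proof
  assume st: "star S Q e"
  have P: "P \<in> cop1" "P \<subseteq> S" "f \<in> P" and R: "\<And>g. g \<in> S - P \<Longrightarrow> g \<inter> \<Union>P \<subseteq> f"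
    using pet by (auto simp: petal_def)
  have Q: "Q \<in> cop2" "Q \<subseteq> S" "e \<in> Q" using st by (auto simp: star_def)
  show False
  proof (cases "\<exists>h\<in>Q \<inter> P. h \<noteq> e \<and> h \<noteq> f")
    case True
    then obtain h where h: "h \<in> Q" "h \<in> P" "h \<noteq> e" "h \<noteq> f" by auto
    have "h \<in> Q - {e}" using h by simp
    then obtain T where T: "T \<in> cop1" "T \<subseteq> S" "T \<inter> Q = {h}"
      using st unfolding star_def by blast
    \<comment> \<open>The locale only provides \<open>e1 \<ge> 2\<close>; the three edges at hand
      yield the bound that \<open>copy_not_crossing_edge\<close> requires.\<close>
    have "{f, e, h} \<subseteq> P" using h e P by auto
    then have "card {f, e, h} \<le> card P" using F1.cop_finite P by (intro card_mono) auto
    moreover have "f \<noteq> e" "f \<noteq> h" "e \<noteq> h" using h e by blast+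
    then have "card {f, e, h} = 3" by simp
    ultimately have "e1 \<ge> 3" using F1.cop_card[OF P(1)] by simp
    then have "T = P"
      by (intro F1.copy_not_crossing_edge[of T P f "S - P" h]) (use T P R h in auto)
    then show False using T Q e h by auto
  next
    case False
    have "g \<inter> e \<subseteq> f" if "g \<in> Q - {e}" for g
    proof (cases "g = f")
      case False
      then have "g \<in> S - P" using that \<open>\<not> (\<exists>h\<in>Q \<inter> P. h \<noteq> e \<and> h \<noteq> f)\<close> Q by auto
      then show ?thesis using R e by blast
    qed auto
    then show False
      using F2.no_pendant_edge[of Q e f] Q e P F1.cop_card_edge e2_ge_3 by auto
  qed
qed

text \<open>Attachment edges are exempt from disjointness because several petals may hang on the
  same edge. Disjointness limits the damage done by an extension: an old edge lies in the proper
  part of at most one member.\<close>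

definition petal_family :: "nat set set \<Rightarrow> (nat set set \<times> nat set) set \<Rightarrow> bool" where
  "petal_family S U \<longleftrightarrow> (\<forall>u\<in>U. petal S u) \<and>
     (\<forall>u\<in>U. \<forall>u'\<in>U. u \<noteq> u' \<longrightarrow> (fst u - {snd u}) \<inter> (fst u' - {snd u'}) = {})"

lemma petal_familyD: "petal_family S U \<Longrightarrow> u \<in> U \<Longrightarrow> petal S u"
  by (simp add: petal_family_def)

lemma petal_family_disjoint:
  assumes "petal_family S U" "(P, f) \<in> U" "(P', f') \<in> U" "(P, f) \<noteq> (P', f')"
  shows "(P - {f}) \<inter> (P' - {f'}) = {}"
proof -
  have "\<forall>u\<in>U. \<forall>u'\<in>U. u \<noteq> u' \<longrightarrow> (fst u - {snd u}) \<inter> (fst u' - {snd u'}) = {}"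
    using assms(1) unfolding petal_family_def by (rule conjunct2)
  from this[rule_format, OF assms(2-4)] show ?thesis by simp
qed

definition petal_number :: "nat set set \<Rightarrow> nat" where
  "petal_number S = Max (card ` {U. petal_family S U})"

lemma finite_petal_families:
  assumes "finite S"
  shows "finite {U. petal_family S U}"
proof (rule finite_subset)
  show "{U. petal_family S U} \<subseteq> Pow (Pow S \<times> S)"
    by (fastforce simp: petal_family_def petal_def)
qed (use assms in auto)

lemma petal_number_ge: "finite S \<Longrightarrow> petal_family S U \<Longrightarrow> card U \<le> petal_number S"
  unfolding petal_number_def using finite_petal_families by (intro Max_ge) auto

lemma petal_number_witness:
  assumes "finite S"
  obtains U where "petal_family S U" "card U = petal_number S" "finite U"
proof -
  have "petal_family S {}" by (auto simp: petal_family_def)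
  then have "petal_number S \<in> card ` {U. petal_family S U}"
    unfolding petal_number_def using finite_petal_families[OF assms] by (intro Max_in) auto
  then obtain U where U: "petal_family S U" "card U = petal_number S" by auto
  moreover have "U \<subseteq> Pow S \<times> S" using U by (fastforce simp: petal_family_def petal_def)
  then have "finite U" using assms by (auto intro: finite_subset)
  ultimately show ?thesis using that by auto
qed

lemma petal_new_part_nonempty:
  assumes "petal S (P, f)"
  shows "P - {f} \<noteq> {}"
proof
  assume "P - {f} = {}"
  then have "P \<subseteq> {f}" by auto
  then have "card P \<le> 1" using card_mono[of "{f}" P] by simp
  then show False using assms F1.cop_card e1_ge_2 by (auto simp: petal_def)
qed

text \<open>A common vertex outside both attachment edges lies in an edge \<open>g\<close> of
  \<open>P'\<close> other than \<open>f'\<close>. Disjointness keeps \<open>g\<close> out of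
  \<open>P\<close>, so \<open>g\<close> meets the vertices of \<open>P\<close> inside
  \<open>f\<close> only.\<close>

lemma petals_disjoint_verts:
  assumes U: "petal_family S U" and u: "(P, f) \<in> U" "(P', f') \<in> U" "(P, f) \<noteq> (P', f')"
  shows "(\<Union>P - f) \<inter> (\<Union>P' - f') = {}"
proof (rule ccontr)
  assume "\<not> ?thesis"
  then obtain x g where x: "x \<in> \<Union>P" "x \<notin> f" "x \<in> g" "g \<in> P'" "x \<notin> f'" by auto
  then have "g \<in> P' - {f'}" by auto
  moreover have "(P - {f}) \<inter> (P' - {f'}) = {}" by (rule petal_family_disjoint[OF U u])
  ultimately have "g \<notin> P" using x by auto
  moreover have "g \<in> S" using petal_familyD[OF U u(2)] x by (auto simp: petal_def)
  ultimately have "g \<inter> \<Union>P \<subseteq> f" using petal_familyD[OF U u(1)] by (simp add: petal_def)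
  then show False using x by auto
qed

text \<open>Adding \<open>Y\<close> can spoil a petal \<open>(P, f)\<close> only through a vertex of
  \<open>P\<close> outside \<open>f\<close>. Within a family these vertex sets are disjoint, so
  choosing one such vertex for every spoilt petal is an injection into
  \<open>\<Union>Y\<close>.\<close>

lemma petal_number_Un:
  assumes S: "finite S" and Y: "finite Y" "finite (\<Union>Y)" "card (\<Union>Y) \<le> M"
  shows "petal_number S \<le> petal_number (S \<union> Y) + M"
proof -
  obtain U where U: "petal_family S U" "card U = petal_number S" "finite U"
    using petal_number_witness[OF S] .
  define T where "T = {(P, f) \<in> U. \<Union>Y \<inter> (\<Union>P - f) \<noteq> {}}"
  have TU: "T \<subseteq> U" "finite T" using U by (auto simp: T_def intro: finite_subset)
  have "petal (S \<union> Y) (P, f)" if "(P, f) \<in> U - T" for P f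
  proof -
    have "petal S (P, f)" using that U by (auto simp: petal_family_def)
    moreover have "\<Union>Y \<inter> (\<Union>P - f) = {}" using that by (auto simp: T_def)
    ultimately show ?thesis unfolding petal_def by blast
  qed
  then have "petal_family (S \<union> Y) (U - T)"
    using U(1) unfolding petal_family_def by (auto simp del: Diff_eq_empty_iff split_paired_All)
  then have "card (U - T) \<le> petal_number (S \<union> Y)" using S Y by (intro petal_number_ge) auto
  moreover have "card T \<le> card (\<Union>Y)"
  proof -
    define w where "w = (\<lambda>(P :: nat set set, f). SOME x. x \<in> \<Union>Y \<inter> (\<Union>P - f))"
    have w: "w (P, f) \<in> \<Union>Y \<inter> (\<Union>P - f)" if "(P, f) \<in> T" for P f
    proof -
      have "\<exists>x. x \<in> \<Union>Y \<inter> (\<Union>P - f)" using that unfolding T_def by blast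
      then show ?thesis unfolding w_def prod.case by (rule someI_ex)
    qed
    have "inj_on w T"
    proof (rule inj_onI, rule ccontr)
      fix u u' assume uu: "u \<in> T" "u' \<in> T" "w u = w u'" "u \<noteq> u'"
      obtain P f P' f' where eq: "u = (P, f)" "u' = (P', f')" by fastforce
      have "(\<Union>P - f) \<inter> (\<Union>P' - f') = {}"
        by (rule petals_disjoint_verts[OF U(1)]) (use uu eq TU in auto)
      then show False using w[of P f] w[of P' f'] uu eq by auto
    qed
    moreover have "w ` T \<subseteq> \<Union>Y" using w by fast
    ultimately show ?thesis using card_inj_on_le Y by blast
  qed
  moreover have "card U = card T + card (U - T)" using TU U
    by (metis card_Diff_subset card_mono le_add_diff_inverse)
  ultimately show ?thesis using U Y by linarith
qed

text \<open>The new petals are the \<open>e2 - 1 \<ge> 2\<close> pairs \<open>(C h, h)\<close>. An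
  old petal can be spoilt only through \<open>e0\<close>, the sole contact of \<open>X\<close> with
  \<open>S\<close>. If \<open>e0\<close> is \<open>f\<close> or no edge of \<open>P\<close>, its
  vertices in \<open>P\<close> belong to \<open>f\<close> and the petal survives. Hence only petals
  with \<open>e0\<close> in \<open>P - {f}\<close> are lost, and disjointness admits one of
  them.\<close>

lemma petal_number_generic_step:
  assumes S: "finite S"
    and Q: "Q \<in> cop2" "e0 \<in> Q"
    and C: "\<And>h. h \<in> Q - {e0} \<Longrightarrow> C h \<in> cop1" "\<And>h. h \<in> Q - {e0} \<Longrightarrow> h \<in> C h"
    and gen1: "\<And>h. h \<in> Q - {e0} \<Longrightarrow> \<Union>(C h) \<inter> \<Union>Q = h"
    and gen2: "\<And>h h'. h \<in> Q - {e0} \<Longrightarrow> h' \<in> Q - {e0} \<Longrightarrow> h \<noteq> h' \<Longrightarrow>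
      (\<Union>(C h) - h) \<inter> (\<Union>(C h') - h') = {}"
    and X: "X = Q \<union> (\<Union>h\<in>Q - {e0}. C h)"
    and XS: "X \<inter> S = {e0}" "\<Union>X \<inter> \<Union>S = e0"
  shows "petal_number S + 1 \<le> petal_number (S \<union> X)"
proof -
  obtain U where U: "petal_family S U" "card U = petal_number S" "finite U"
    using petal_number_witness[OF S] .
  define T where "T = {(P, f) \<in> U. e0 \<in> P - {f}}"
  define N where "N = (\<lambda>h. (C h, h)) ` (Q - {e0})"
  have finQ: "finite Q" using F2.cop_finite Q by auto
  have finX: "finite X" unfolding X using finQ C F1.cop_finite by auto
  have TU: "T \<subseteq> U" "finite T" using U by (auto simp: T_def intro: finite_subset)
  have cT: "card T \<le> 1"
  proof -
    have "u = u'" if "u \<in> T" "u' \<in> T" for u u'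
    proof (rule ccontr)
      assume ne: "u \<noteq> u'"
      obtain P f P' f' where eq: "u = (P, f)" "u' = (P', f')" by fastforce
      have "(P - {f}) \<inter> (P' - {f'}) = {}"
        by (rule petal_family_disjoint[OF U(1)]) (use that TU ne eq in auto)
      moreover have "e0 \<in> P - {f}" "e0 \<in> P' - {f'}" using that by (simp_all add: T_def eq)
      ultimately show False by blast
    qed
    then show ?thesis using card_le_Suc0_iff_eq[OF TU(2)] by (metis One_nat_def)
  qed
  have cN: "card N = e2 - 1"
  proof -
    have "inj_on (\<lambda>h. (C h, h)) (Q - {e0})" by (auto simp: inj_on_def)
    then show ?thesis using Q finQ F2.cop_card by (simp add: N_def card_image)
  qed
  have edge_k: "card g = k" if "g \<in> X" for g
  proof (cases "g \<in> Q")
    case True then show ?thesis by (rule F2.cop_card_edge[OF Q(1)])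
  next
    case False
    then obtain h where h: "h \<in> Q - {e0}" "g \<in> C h" using \<open>g \<in> X\<close> unfolding X by blast
    then show ?thesis using F1.cop_card_edge[OF C(1)[OF h(1)]] by simp
  qed
  have fin_edge: "finite g" if "g \<in> X" for g
    using edge_k[OF that] F1.k_pos by (intro card_ge_0_finite) auto
  have sub_eq: "g = h" if "g \<in> X" "h \<in> X" "g \<subseteq> h" for g h
    using card_subset_eq[OF fin_edge[OF that(2)] that(3)] edge_k that by simp
  have CX: "C h \<subseteq> X" if "h \<in> Q - {e0}" for h using that unfolding X by blast
  have CC: "\<Union>(C h) \<inter> \<Union>(C h') \<subseteq> h" if "h \<in> Q - {e0}" "h' \<in> Q - {e0}" "h \<noteq> h'" for h h'
    using gen1[OF that(1)] gen1[OF that(2)] gen2[OF that] that by blast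
  have new_disj: "(C h - {h}) \<inter> (C h' - {h'}) = {}" if "h \<in> Q - {e0}" "h' \<in> Q - {e0}" "h \<noteq> h'" for h h'
  proof (rule ccontr)
    assume "\<not> ?thesis"
    then obtain g where g: "g \<in> C h" "g \<noteq> h" "g \<in> C h'" by auto
    then have "g \<subseteq> h" using CC[OF that] by blast
    then have "g = h" using sub_eq[of g h] g CX[OF that(1)] that unfolding X by auto
    then show False using g by auto
  qed
  have new_old: "(C h - {h}) \<inter> S = {}" if h: "h \<in> Q - {e0}" for h
  proof (rule ccontr)
    assume "\<not> ?thesis"
    then obtain g where g: "g \<in> C h" "g \<noteq> h" "g \<in> S" by auto
    then have "g = e0" using XS CX[OF h] by auto
    then have "e0 \<subseteq> h" using gen1[OF h] g Q by blast
    then have "e0 = h" using sub_eq[of e0 h] Q h unfolding X by auto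
    then show False using h by auto
  qed
  have petN: "petal (S \<union> X) (C h, h)" if h: "h \<in> Q - {e0}" for h
  proof -
    have "g \<inter> \<Union>(C h) \<subseteq> h" if g: "g \<in> S \<union> X - C h" for g
    proof -
      consider "g \<in> S" | "g \<in> Q" | h' where "h' \<in> Q - {e0}" "g \<in> C h'" using g unfolding X by blast
      then show ?thesis
      proof cases
        case 1
        have "\<Union>(C h) \<subseteq> \<Union>X" using CX[OF h] by blast
        then have "g \<inter> \<Union>(C h) \<subseteq> e0 \<inter> \<Union>(C h)" using 1 XS(2) by blast
        also have "\<dots> \<subseteq> h" using gen1[OF h] Q by blast
        finally show ?thesis .
      next
        case 2 then show ?thesis using gen1[OF h] by blast
      next
        case 3
        then have "h' \<noteq> h" using g by auto
        then show ?thesis using CC[OF h 3(1)] 3 by blast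
      qed
    qed
    then show ?thesis using C[OF h] CX[OF h] by (auto simp: petal_def)
  qed
  have petU: "petal (S \<union> X) (P, f)" if u: "(P, f) \<in> U - T" for P f
  proof -
    have p: "petal S (P, f)" using u U by (auto simp: petal_family_def)
    have "g \<inter> \<Union>P \<subseteq> f" if g: "g \<in> S \<union> X - P" for g
    proof (cases "g \<in> S")
      case True then show ?thesis using p g by (auto simp: petal_def)
    next
      case False
      have PS: "\<Union>P \<subseteq> \<Union>S" using p by (auto simp: petal_def)
      have "g \<subseteq> \<Union>X" using False g by auto
      then have "g \<inter> \<Union>P \<subseteq> e0 \<inter> \<Union>P" using XS(2) PS by blast
      also have "\<dots> \<subseteq> f"
      proof (cases "e0 = f")
        case False
        then have "e0 \<notin> P" using u by (auto simp: T_def)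
        moreover have "e0 \<in> S" using XS(1) by blast
        ultimately show ?thesis using p by (simp add: petal_def)
      qed auto
      finally show ?thesis .
    qed
    then show ?thesis using p by (auto simp: petal_def)
  qed
  have "petal_family (S \<union> X) ((U - T) \<union> N)"
    unfolding petal_family_def
  proof (intro conjI ballI impI)
    fix u assume "u \<in> (U - T) \<union> N"
    then show "petal (S \<union> X) u" using petU petN by (cases u) (auto simp: N_def)
  next
    have UN: "(fst u - {snd u}) \<inter> (fst u' - {snd u'}) = {}" if uN: "u \<in> U" "u' \<in> N" for u u'
    proof -
      have "fst u \<subseteq> S" using U that by (cases u) (auto simp: petal_family_def petal_def)
      moreover obtain h where h: "h \<in> Q - {e0}" "u' = (C h, h)" using uN unfolding N_def by blast
      ultimately show ?thesis using new_old[OF h(1)] by (simp add: h(2)) blast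
    qed
    fix u u' assume uu: "u \<in> (U - T) \<union> N" "u' \<in> (U - T) \<union> N" "u \<noteq> u'"
    consider "u \<in> U" "u' \<in> U" | "u \<in> U" "u' \<in> N" | "u \<in> N" "u' \<in> U" | "u \<in> N" "u' \<in> N" using uu by blast
    then show "(fst u - {snd u}) \<inter> (fst u' - {snd u'}) = {}"
    proof cases
      case 1
      then show ?thesis using petal_family_disjoint[OF U(1), of "fst u" "snd u" "fst u'" "snd u'"] uu by simp
    next
      case 2 then show ?thesis using UN by blast
    next
      case 3 then show ?thesis using UN[of u' u] by blast
    next
      case 4
      then obtain h h' where h: "h \<in> Q - {e0}" "h' \<in> Q - {e0}" "u = (C h, h)" "u' = (C h', h')"
        unfolding N_def by blast
      then have "h \<noteq> h'" using uu by blast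
      then show ?thesis using new_disj[OF h(1,2)] h(3,4) by simp
    qed
  qed
  then have "card ((U - T) \<union> N) \<le> petal_number (S \<union> X)"
    using S finX by (intro petal_number_ge) auto
  moreover have "card ((U - T) \<union> N) = card (U - T) + card N"
  proof (rule card_Un_disjoint)
    show "finite N" using finQ by (auto simp: N_def)
    show "(U - T) \<inter> N = {}"
    proof (rule ccontr)
      assume "\<not> ?thesis"
      then obtain h where h: "h \<in> Q - {e0}" "(C h, h) \<in> U" by (auto simp: N_def)
      then have pet: "petal S (C h, h)" using petal_familyD[OF U(1)] by blast
      then have "C h \<subseteq> S" "C h - {h} \<noteq> {}"
        using petal_new_part_nonempty[OF pet] by (simp_all add: petal_def)
      then show False using new_old[OF h(1)] by blast
    qed
  qed (use U in auto)
  moreover have "card (U - T) = card U - card T" using TU by (simp add: card_Diff_subset)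
  ultimately show ?thesis using cT cN e2_ge_3 U by linarith
qed

end

section \<open>Exploring a minimal arrowing edge set\<close>

text \<open>This is the interface to the density hypotheses, with \<open>m\<close> for
  \<open>m_k2 k F1 F2\<close>. Hypothesis (ii) provides \<open>crossing_copy\<close> and hypothesis
  (iii) provides \<open>crossing_star\<close>, whose second alternative is the equality case. New
  vertices are those outside \<open>\<Union>S\<close>, so a vertex of \<open>S\<close> counts as old
  even if it lies in no common edge.\<close>

locale exploration = copy_families +
  fixes m :: real
  assumes m_pos: "m > 0"
    and crossing_copy: "\<And>P S. P \<in> cop1 \<Longrightarrow> finite S \<Longrightarrow> (\<And>g. g \<in> S \<Longrightarrow> card g = k) \<Longrightarrow>
      P \<inter> S \<noteq> {} \<Longrightarrow> \<not> P \<subseteq> S \<Longrightarrow> m * card (\<Union>P - \<Union>S) < card (P - S)"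
    and crossing_star: "\<And>Q e0 C S X. Q \<in> cop2 \<Longrightarrow> e0 \<in> Q \<Longrightarrow>
      (\<And>h. h \<in> Q - {e0} \<Longrightarrow> C h \<in> cop1) \<Longrightarrow> (\<And>h. h \<in> Q - {e0} \<Longrightarrow> h \<in> C h) \<Longrightarrow>
      finite S \<Longrightarrow> (\<And>g. g \<in> S \<Longrightarrow> card g = k) \<Longrightarrow> e0 \<in> S \<Longrightarrow>
      X = Q \<union> (\<Union>h\<in>Q - {e0}. C h) \<Longrightarrow> \<not> X \<subseteq> S \<Longrightarrow>
      m * card (\<Union>X - \<Union>S) < card (X - S) \<or>
      (m * card (\<Union>X - \<Union>S) \<le> card (X - S) \<and> X \<inter> S = {e0} \<and> \<Union>X \<inter> \<Union>S = e0 \<and>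
       (\<forall>h\<in>Q - {e0}. \<Union>(C h) \<inter> \<Union>Q = h) \<and>
       (\<forall>h\<in>Q - {e0}. \<forall>h'\<in>Q - {e0}. h \<noteq> h' \<longrightarrow> (\<Union>(C h) - h) \<inter> (\<Union>(C h') - h') = {}))"
begin

section \<open>Colourings with as many red edges as possible\<close>

definition arr :: "nat set set \<Rightarrow> bool" where
  "arr E \<longleftrightarrow> (\<forall>R\<subseteq>E. (\<exists>P\<in>cop1. P \<subseteq> R) \<or> (\<exists>Q\<in>cop2. Q \<subseteq> E - R))"

lemma not_arrE:
  assumes "\<not> arr E"
  obtains R where "R \<subseteq> E" "\<forall>P\<in>cop1. \<not> P \<subseteq> R" "\<forall>Q\<in>cop2. \<not> Q \<subseteq> E - R"
  using assms unfolding arr_def by meson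

definition minimal_arr :: "nat set set \<Rightarrow> bool" where
  "minimal_arr E \<longleftrightarrow> arr E \<and> finite E \<and> (\<forall>e\<in>E. card e = k) \<and> (\<forall>E'. E' \<subset> E \<longrightarrow> \<not> arr E')"

lemma minimal_arr_exists:
  assumes "arr E" "finite E" "\<And>e. e \<in> E \<Longrightarrow> card e = k"
  obtains E' where "E' \<subseteq> E" "minimal_arr E'"
proof -
  have "finite {E'. E' \<subseteq> E \<and> arr E'}" using assms by simp
  then obtain E' where E': "E' \<in> {E'. E' \<subseteq> E \<and> arr E'}"
    and min: "\<And>Z. Z \<in> {E'. E' \<subseteq> E \<and> arr E'} \<Longrightarrow> Z \<subseteq> E' \<Longrightarrow> E' = Z"
    using finite_has_minimal[of "{E'. E' \<subseteq> E \<and> arr E'}"] assms(1) by auto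
  have "minimal_arr E'"
    unfolding minimal_arr_def
  proof (intro conjI allI impI ballI)
    show "finite E'" using E' assms finite_subset by auto
    show "\<not> arr Z" if "Z \<subset> E'" for Z using min[of Z] E' that by auto
  qed (use E' assms in auto)
  then show ?thesis using that E' by auto
qed

text \<open>Colour all edges but \<open>e\<close> so that neither a red copy of the first nor a blue copy of the
  second hypergraph arises, with as many red edges as possible. Then every blue edge would close a
  red copy.\<close>

lemma minimal_arr_star:
  assumes E: "minimal_arr E" and e: "e \<in> E"
  obtains Q where "star E Q e"
proof -
  have arrE: "arr E" and fin: "finite E" using E by (auto simp: minimal_arr_def)
  have "E - {e} \<subset> E" using e by auto
  then have "\<not> arr (E - {e})" using E by (auto simp: minimal_arr_def)
  define G where "G = {R. R \<subseteq> E - {e} \<and> (\<forall>P\<in>cop1. \<not> P \<subseteq> R) \<and> (\<forall>Q\<in>cop2. \<not> Q \<subseteq> E - {e} - R)}"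
  obtain R0 where "R0 \<subseteq> E - {e}" "\<forall>P\<in>cop1. \<not> P \<subseteq> R0" "\<forall>Q\<in>cop2. \<not> Q \<subseteq> E - {e} - R0"
    using \<open>\<not> arr (E - {e})\<close> by (rule not_arrE)
  then have "R0 \<in> G" by (simp only: G_def mem_Collect_eq)
  then have "G \<noteq> {}" by blast
  moreover have "finite G"
    by (rule finite_subset[of _ "Pow E"]) (use fin in \<open>auto simp: G_def\<close>)
  ultimately obtain R where R: "R \<in> G" and max: "\<And>Z. Z \<in> G \<Longrightarrow> R \<subseteq> Z \<Longrightarrow> R = Z"
    using finite_has_maximal[of G] by auto
  have noP: "\<not> P \<subseteq> R" if "P \<in> cop1" for P using R that by (auto simp: G_def)
  have RE: "R \<subseteq> E - {e}" using R by (auto simp: G_def)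
  then have "R \<subseteq> E" by auto
  then obtain Q where Q: "Q \<in> cop2" "Q \<subseteq> E - R" using arrE noP unfolding arr_def by blast
  have eQ: "e \<in> Q"
  proof (rule ccontr)
    assume "e \<notin> Q"
    then have "Q \<subseteq> E - {e} - R" using Q by auto
    then show False using R Q by (auto simp: G_def)
  qed
  have "\<exists>P\<in>cop1. P \<subseteq> E \<and> P \<inter> Q = {h}" if h: "h \<in> Q - {e}" for h
  proof -
    have hE: "h \<in> E" "h \<notin> R" "h \<noteq> e" using h Q by auto
    then have "insert h R \<notin> G" using max[of "insert h R"] by auto
    moreover have "insert h R \<subseteq> E - {e}" using RE hE by auto
    moreover have "\<not> T \<subseteq> E - {e} - insert h R" if "T \<in> cop2" for T
    proof -
      have "\<not> T \<subseteq> E - {e} - R" using R that by (simp add: G_def)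
      then show ?thesis by blast
    qed
    ultimately obtain P where P: "P \<in> cop1" "P \<subseteq> insert h R" unfolding G_def by blast
    then have "h \<in> P" using noP[OF P(1)] by auto
    then have "P \<inter> Q = {h}" using P Q h by auto
    moreover have "P \<subseteq> E" using P \<open>R \<subseteq> E\<close> hE by auto
    ultimately show ?thesis using P by auto
  qed
  then show ?thesis using that[of Q] Q eQ unfolding star_def by auto
qed

text \<open>By minimality \<open>S\<close> and \<open>E - S\<close> can be coloured separately, and
  since no copy of the first hypergraph crosses, the union has no red copy either. The family
  \<open>G\<close> tolerates blue copies that cross. So the blue copy forced by \<open>arr E\<close>
  does cross, and by maximality each of its edges closes a red copy, which makes it a star at any of
  its edges in \<open>S\<close>.\<close>

lemma minimal_arr_crossing:
  assumes E: "minimal_arr E" and S: "S \<subset> E" "S \<noteq> {}"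
    and no_crossing: "\<And>P. P \<in> cop1 \<Longrightarrow> P \<subseteq> E \<Longrightarrow> P \<inter> S \<noteq> {} \<Longrightarrow> P \<subseteq> S"
  obtains Q e where "e \<in> S" "star E Q e" "\<not> Q \<subseteq> S"
proof -
  have arrE: "arr E" and fin: "finite E" using E by (auto simp: minimal_arr_def)
  define G where "G = {R. R \<subseteq> E \<and> (\<forall>P\<in>cop1. \<not> P \<subseteq> R) \<and> (\<forall>Q\<in>cop2. \<not> Q \<subseteq> S - R) \<and>
    (\<forall>Q\<in>cop2. \<not> Q \<subseteq> E - S - R)}"
  have "G \<noteq> {}"
  proof -
    have "E - S \<subset> E" using S by auto
    then have "\<not> arr S" "\<not> arr (E - S)" using E S by (auto simp: minimal_arr_def)
    obtain R1 where R1: "R1 \<subseteq> S" "\<forall>P\<in>cop1. \<not> P \<subseteq> R1" "\<forall>Q\<in>cop2. \<not> Q \<subseteq> S - R1"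
      using \<open>\<not> arr S\<close> by (rule not_arrE)
    obtain R2 where R2: "R2 \<subseteq> E - S" "\<forall>P\<in>cop1. \<not> P \<subseteq> R2" "\<forall>Q\<in>cop2. \<not> Q \<subseteq> E - S - R2"
      using \<open>\<not> arr (E - S)\<close> by (rule not_arrE)
    have "\<not> P \<subseteq> R1 \<union> R2" if P: "P \<in> cop1" for P
    proof
      assume sub: "P \<subseteq> R1 \<union> R2"
      show False
      proof (cases "P \<inter> S = {}")
        case True
        then have "P \<subseteq> R2" using sub R1 by auto
        then show False using R2 P by auto
      next
        case False
        then have "P \<subseteq> S" using no_crossing[OF P] sub R1(1) R2(1) S by blast
        then have "P \<subseteq> R1" using sub R2 by auto
        then show False using R1 P by auto
      qed
    qed
    moreover have "S - (R1 \<union> R2) = S - R1" "E - S - (R1 \<union> R2) = E - S - R2" using R1 R2 by auto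
    ultimately have "R1 \<union> R2 \<in> G" using R1 R2 S unfolding G_def by auto
    then show ?thesis by auto
  qed
  moreover have "finite G"
    by (rule finite_subset[of _ "Pow E"]) (use fin in \<open>auto simp: G_def\<close>)
  ultimately obtain R where R: "R \<in> G" and max: "\<And>Z. Z \<in> G \<Longrightarrow> R \<subseteq> Z \<Longrightarrow> R = Z"
    using finite_has_maximal[of G] by auto
  have noP: "\<not> P \<subseteq> R" if "P \<in> cop1" for P using R that by (auto simp: G_def)
  have RE: "R \<subseteq> E" using R by (auto simp: G_def)
  then obtain Q where Q: "Q \<in> cop2" "Q \<subseteq> E - R" using arrE noP unfolding arr_def by blast
  have "\<not> Q \<subseteq> S"
  proof
    assume "Q \<subseteq> S"
    then have "Q \<subseteq> S - R" using Q by auto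
    then show False using R Q by (auto simp: G_def)
  qed
  moreover have "Q \<inter> S \<noteq> {}"
  proof
    assume "Q \<inter> S = {}"
    then have "Q \<subseteq> E - S - R" using Q by auto
    then show False using R Q by (auto simp: G_def)
  qed
  then obtain e where e: "e \<in> Q" "e \<in> S" by auto
  moreover have "\<exists>P\<in>cop1. P \<subseteq> E \<and> P \<inter> Q = {h}" if h: "h \<in> Q" for h
  proof -
    have hE: "h \<in> E" "h \<notin> R" using h Q by auto
    then have "insert h R \<notin> G" using max[of "insert h R"] by auto
    moreover have "insert h R \<subseteq> E" using RE hE by auto
    moreover have "\<not> T \<subseteq> S - insert h R" "\<not> T \<subseteq> E - S - insert h R" if "T \<in> cop2" for T
    proof -
      have "\<not> T \<subseteq> S - R" "\<not> T \<subseteq> E - S - R" using R that by (simp_all add: G_def)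
      then show "\<not> T \<subseteq> S - insert h R" "\<not> T \<subseteq> E - S - insert h R" by blast+
    qed
    ultimately obtain P where P: "P \<in> cop1" "P \<subseteq> insert h R" unfolding G_def by blast
    then have "h \<in> P" using noP[OF P(1)] by auto
    then have "P \<inter> Q = {h}" using P Q h by auto
    moreover have "P \<subseteq> E" using P RE hE by auto
    ultimately show ?thesis using P by auto
  qed
  then have "star E Q e" using Q e unfolding star_def by auto
  ultimately show ?thesis using that e by blast
qed

lemma minimal_arr_no_petal:
  assumes "minimal_arr E"
  shows "petal_number E = 0"
proof (rule ccontr)
  assume "petal_number E \<noteq> 0"
  moreover have "finite E" using assms by (auto simp: minimal_arr_def)
  then obtain U where "petal_family E U" "card U = petal_number E" by (rule petal_number_witness)
  ultimately have "U \<noteq> {}" "petal_family E U" by auto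
  then obtain P f where pet: "petal E (P, f)" using petal_familyD by (metis ex_in_conv surj_pair)
  obtain e where e: "e \<in> P - {f}" using petal_new_part_nonempty[OF pet] by blast
  then have "e \<in> E" using pet by (auto simp: petal_def)
  then obtain Q where "star E Q e" using minimal_arr_star[OF assms] by blast
  then show False using petal_no_star[OF pet e] by blast
qed

section \<open>Extensions, reachable states and the exploration\<close>

definition max_verts :: nat where
  "max_verts = v2 + e2 * v1"

text \<open>While there are petals, the next extension is attached at one prescribed edge; when there is
  none, the explored set has bounded size, so that it does not matter that every edge is allowed.\<close>

definition attach :: "nat set set \<Rightarrow> nat set set" where
  "attach S = (if petal_number S = 0 then S else {SOME e. \<exists>P f. petal S (P, f) \<and> e \<in> P - {f}})"

text \<open>Neither kind of extension records that \<open>Y\<close> comes from a copy or a member of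
  \<open>\<F>\<^sup>*\<close>. Only what is used later is kept: the size and the balance of new
  edges against new vertices for the expectation, and for tree extensions also the place of
  attachment and the gain in petals.\<close>

definition dense_ext :: "nat set set \<Rightarrow> nat set set \<Rightarrow> bool" where
  "dense_ext S Y \<longleftrightarrow> card (\<Union>Y) \<le> max_verts \<and> m * card (\<Union>Y - \<Union>S) < card (Y - S)"

definition tree_ext :: "nat set set \<Rightarrow> nat set set \<Rightarrow> bool" where
  "tree_ext S Y \<longleftrightarrow> card (\<Union>Y) \<le> max_verts \<and> Y - S \<noteq> {} \<and> m * card (\<Union>Y - \<Union>S) \<le> card (Y - S) \<and>
     (\<exists>e\<in>attach S. \<Union>Y \<inter> \<Union>S \<subseteq> e) \<and> petal_number S + 1 \<le> petal_number (S \<union> Y)"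

lemma attach_petal:
  assumes "finite S" "petal_number S \<noteq> 0"
  obtains P f e where "petal S (P, f)" "e \<in> P - {f}" "attach S = {e}"
proof -
  obtain U where U: "petal_family S U" "card U = petal_number S"
    using petal_number_witness[OF assms(1)] .
  then have "U \<noteq> {}" using assms by auto
  then obtain P f where pet: "petal S (P, f)" using petal_familyD[OF U(1)] by (metis ex_in_conv surj_pair)
  obtain e where "e \<in> P - {f}" using petal_new_part_nonempty[OF pet] by blast
  then have "\<exists>e P f. petal S (P, f) \<and> e \<in> P - {f}" using pet by blast
  from someI_ex[OF this] show ?thesis using that assms unfolding attach_def by auto
qed

lemma card_verts_copy_union:
  assumes Q: "Q \<in> cop2" and C: "\<And>h. h \<in> Q - {e0} \<Longrightarrow> C h \<in> cop1"
  shows "card (\<Union>(Q \<union> (\<Union>h\<in>Q - {e0}. C h))) \<le> max_verts"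
proof -
  have finQ: "finite Q" using F2.cop_finite Q by auto
  have "\<Union>(Q \<union> (\<Union>h\<in>Q - {e0}. C h)) = \<Union>Q \<union> (\<Union>h\<in>Q - {e0}. \<Union>(C h))" by blast
  also have "card \<dots> \<le> card (\<Union>Q) + card (\<Union>h\<in>Q - {e0}. \<Union>(C h))" by (rule card_Un_le)
  also have "card (\<Union>h\<in>Q - {e0}. \<Union>(C h)) \<le> (\<Sum>h\<in>Q - {e0}. card (\<Union>(C h)))"
    using finQ by (intro card_UN_le) auto
  also have "(\<Sum>h\<in>Q - {e0}. card (\<Union>(C h))) = (\<Sum>h\<in>Q - {e0}. v1)"
    by (intro sum.cong refl) (use C F1.cop_card_verts in blast)
  also have "\<dots> = card (Q - {e0}) * v1" by simp
  also have "\<dots> \<le> e2 * v1"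
    using F2.cop_card[OF Q] card_mono[OF finQ, of "Q - {e0}"] by (intro mult_right_mono) auto
  finally show ?thesis using F2.cop_card_verts[OF Q] by (simp add: max_verts_def)
qed

text \<open>\<open>Q\<close> and the copies attached to it cannot all lie in \<open>S\<close>, or
  there would be a star at \<open>e\<close> inside \<open>S\<close>. So their union leaves
  \<open>S\<close> and \<open>crossing_star\<close> applies: its first alternative is a dense
  extension, and in the second the gain in petals makes it a tree extension.\<close>

lemma star_extension:
  assumes S: "finite S" "\<And>g. g \<in> S \<Longrightarrow> card g = k" and e: "e \<in> S" "e \<in> attach S"
    and st: "star E Q e" and nst: "\<not> star S Q e"
  obtains Y where "Y \<subseteq> E" "dense_ext S Y \<or> tree_ext S Y"
proof -
  have Q: "Q \<in> cop2" "Q \<subseteq> E" "e \<in> Q" using st by (auto simp: star_def)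
  have "\<forall>h\<in>Q - {e}. \<exists>P. P \<in> cop1 \<and> P \<subseteq> E \<and> P \<inter> Q = {h}" using st unfolding star_def by blast
  then obtain C where C: "\<forall>h\<in>Q - {e}. C h \<in> cop1 \<and> C h \<subseteq> E \<and> C h \<inter> Q = {h}"
    by (rule bchoice[THEN exE])
  define X where "X = Q \<union> (\<Union>h\<in>Q - {e}. C h)"
  have XE: "X \<subseteq> E" using Q C unfolding X_def by blast
  have nX: "\<not> X \<subseteq> S"
  proof
    assume "X \<subseteq> S"
    then have "Q \<subseteq> S" "\<forall>h\<in>Q - {e}. C h \<subseteq> S" unfolding X_def by blast+
    then have "star S Q e" using Q C unfolding star_def by (metis (no_types, lifting))
    then show False using nst by simp
  qed
  have C1: "\<And>h. h \<in> Q - {e} \<Longrightarrow> C h \<in> cop1" and C2: "\<And>h. h \<in> Q - {e} \<Longrightarrow> h \<in> C h" using C by auto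
  have cX: "card (\<Union>X) \<le> max_verts"
    unfolding X_def by (rule card_verts_copy_union[OF Q(1)]) (use C in auto)
  from crossing_star[OF Q(1) Q(3) C1 C2 S(1) S(2) e(1) X_def nX]
  show ?thesis
  proof
    assume "m * card (\<Union>X - \<Union>S) < card (X - S)"
    then show ?thesis using that[of X] XE cX by (simp add: dense_ext_def)
  next
    assume a: "m * card (\<Union>X - \<Union>S) \<le> card (X - S) \<and> X \<inter> S = {e} \<and> \<Union>X \<inter> \<Union>S = e \<and>
       (\<forall>h\<in>Q - {e}. \<Union>(C h) \<inter> \<Union>Q = h) \<and>
       (\<forall>h\<in>Q - {e}. \<forall>h'\<in>Q - {e}. h \<noteq> h' \<longrightarrow> (\<Union>(C h) - h) \<inter> (\<Union>(C h') - h') = {})"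
    have "petal_number S + 1 \<le> petal_number (S \<union> X)"
      by (rule petal_number_generic_step[OF S(1) Q(1) Q(3) C1 C2 _ _ X_def]) (use a in \<open>simp_all only: simp_thms\<close>)
    then have "tree_ext S X" using a cX nX e by (auto simp: tree_ext_def)
    then show ?thesis using that[of X] XE by simp
  qed
qed

text \<open>If there are petals, the prescribed edge carries a star in \<open>E\<close> but none in
  \<open>S\<close>. If there are none, a crossing copy of the first hypergraph is itself dense;
  failing that, \<open>minimal_arr_crossing\<close> provides a star at an edge of \<open>S\<close>
  over which there is no control, and this is why \<open>attach S\<close> is then all of
  \<open>S\<close>.\<close>

lemma extension_exists:
  assumes E: "minimal_arr E" and S: "S \<subset> E" "S \<noteq> {}"
  obtains Y where "Y \<subseteq> E" "dense_ext S Y \<or> tree_ext S Y"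
proof -
  have finS: "finite S" and unif: "\<And>g. g \<in> S \<Longrightarrow> card g = k"
    using E S by (auto simp: minimal_arr_def intro: finite_subset)
  show ?thesis
  proof (cases "petal_number S = 0")
    case False
    then obtain P f e where e: "petal S (P, f)" "e \<in> P - {f}" "attach S = {e}"
      using attach_petal[OF finS] by blast
    have eS: "e \<in> S" "e \<in> attach S" using e by (auto simp: petal_def)
    then obtain Q where Q: "star E Q e" using minimal_arr_star[OF E] S by blast
    show ?thesis
      using star_extension[OF finS unif eS Q petal_no_star[OF e(1,2)]] that by blast
  next
    case True
    show ?thesis
    proof (cases "\<exists>P\<in>cop1. P \<subseteq> E \<and> P \<inter> S \<noteq> {} \<and> \<not> P \<subseteq> S")
      case True
      then obtain P where P: "P \<in> cop1" "P \<subseteq> E" "P \<inter> S \<noteq> {}" "\<not> P \<subseteq> S" by blast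
      have "card (\<Union>P) \<le> max_verts"
        using F1.cop_card_verts[OF P(1)] e2_ge_3 by (simp add: max_verts_def trans_le_add2)
      then have "dense_ext S P"
        using crossing_copy[OF P(1) finS unif P(3,4)] by (simp add: dense_ext_def)
      then show ?thesis using that P by blast
    next
      case False
      then have "P \<subseteq> S" if "P \<in> cop1" "P \<subseteq> E" "P \<inter> S \<noteq> {}" for P using that by metis
      then obtain Q e where Q: "e \<in> S" "star E Q e" "\<not> Q \<subseteq> S"
        using minimal_arr_crossing[OF E S] by metis
      have "e \<in> attach S" using True Q by (simp add: attach_def)
      moreover have "\<not> star S Q e" using Q by (simp add: star_def)
      ultimately show ?thesis
        using star_extension[OF finS unif Q(1) _ Q(2)] that by blast
    qed
  qed
qed

text \<open>A state \<open>(S, d)\<close> records the explored edge set and the number of dense extensions made so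
  far; the exploration stops after \<open>D\<close> of them.\<close>

primrec reach :: "nat set set \<Rightarrow> nat \<Rightarrow> nat \<Rightarrow> (nat set set \<times> nat) set" where
  "reach K D 0 = (\<lambda>e. ({e}, 0)) ` K"
| "reach K D (Suc t) = (\<Union>(S, d)\<in>{s \<in> reach K D t. snd s < D}.
     (\<lambda>Y. (S \<union> Y, Suc d)) ` {Y. Y \<subseteq> K \<and> dense_ext S Y} \<union>
     (\<lambda>Y. (S \<union> Y, d)) ` {Y. Y \<subseteq> K \<and> tree_ext S Y})"

text \<open>The last bound is a potential argument. A tree extension adds one step and at least one
  petal; a dense one adds one step and destroys at most \<open>max_verts\<close> petals, whence the
  factor \<open>max_verts + 1\<close>. A state without petals has therefore made few steps.\<close>

lemma reach_invariant:
  assumes K: "finite K" "\<And>e. e \<in> K \<Longrightarrow> card e = k"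
  shows "(S, d) \<in> reach K D t \<Longrightarrow> S \<subseteq> K \<and> S \<noteq> {} \<and> d \<le> D \<and> card (\<Union>S) \<le> k + t * max_verts \<and>
    t \<le> petal_number S + (max_verts + 1) * d"
proof (induction t arbitrary: S d)
  case 0
  then show ?case using K by auto
next
  case (Suc t)
  then obtain S' d' Y where S': "(S', d') \<in> reach K D t" "d' < D" "Y \<subseteq> K" "S = S' \<union> Y"
    and c: "dense_ext S' Y \<and> d = Suc d' \<or> tree_ext S' Y \<and> d = d'"
    by auto
  have IH: "S' \<subseteq> K" "S' \<noteq> {}" "d' \<le> D" "card (\<Union>S') \<le> k + t * max_verts"
    "t \<le> petal_number S' + (max_verts + 1) * d'"
    using Suc.IH[OF S'(1)] by auto
  have cY: "card (\<Union>Y) \<le> max_verts" using c by (auto simp: dense_ext_def tree_ext_def)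
  have fin: "finite S'" "finite Y"
    using finite_subset[OF IH(1) K(1)] finite_subset[OF S'(3) K(1)] by auto
  have finY: "finite (\<Union>Y)"
  proof (rule finite_Union[OF fin(2)])
    fix e assume "e \<in> Y"
    then have "card e = k" using S' K by auto
    then show "finite e" using F1.k_pos by (intro card_ge_0_finite) auto
  qed
  have "\<Union>S = \<Union>S' \<union> \<Union>Y" using S' by auto
  then have "card (\<Union>S) \<le> card (\<Union>S') + card (\<Union>Y)" by (simp add: card_Un_le)
  then have "card (\<Union>S) \<le> k + Suc t * max_verts" using IH cY by simp
  moreover have "Suc t \<le> petal_number S + (max_verts + 1) * d"
    using c
  proof
    assume c: "dense_ext S' Y \<and> d = Suc d'"
    have "petal_number S' \<le> petal_number S + max_verts"
      unfolding S'(4) by (rule petal_number_Un[OF fin finY cY])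
    then show ?thesis using c IH by simp
  next
    assume "tree_ext S' Y \<and> d = d'"
    then show ?thesis using IH S' by (auto simp: tree_ext_def)
  qed
  ultimately show ?case using S' IH c by auto
qed

text \<open>The process runs inside a minimal arrowing subset \<open>E'\<close> and gets stuck only
  when \<open>E'\<close> is exhausted. Then there are no petals, so the invariant bounds the number
  of steps and with it the number of vertices, independently of \<open>T\<close>.\<close>

lemma explore:
  assumes K: "finite K" "\<And>e. e \<in> K \<Longrightarrow> card e = k" and E: "E \<subseteq> K" "arr E"
  shows "(\<exists>t\<le>T. \<exists>S. (S, D) \<in> reach K D t \<and> S \<subseteq> E) \<or>
    (\<exists>S d. (S, d) \<in> reach K D T \<and> S \<subseteq> E) \<or>
    (\<exists>Y\<subseteq>E. arr Y \<and> card (\<Union>Y) \<le> k + (max_verts + 1) * D * max_verts)"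
proof -
  have finE: "finite E" using E K finite_subset by auto
  obtain E' where E': "E' \<subseteq> E" "minimal_arr E'"
    using minimal_arr_exists[OF E(2) finE] K E by blast
  have arrE': "arr E'" using E' by (simp add: minimal_arr_def)
  have "E' \<noteq> {}"
  proof
    assume "E' = {}"
    then have "{} \<in> cop1 \<or> {} \<in> cop2" using arrE' unfolding arr_def by auto
    then show False using F1.cop_card[of "{}"] F2.cop_card[of "{}"] e1_ge_2 e2_ge_3 by auto
  qed
  then obtain e where e: "e \<in> E'" by auto
  have "(\<exists>t\<le>T. \<exists>S. (S, D) \<in> reach K D t \<and> S \<subseteq> E') \<or>
    (\<exists>S d. (S, d) \<in> reach K D T \<and> S \<subseteq> E') \<or>
    card (\<Union>E') \<le> k + (max_verts + 1) * D * max_verts"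
  proof (induction T)
    case 0
    have "e \<in> K" using e E' E by blast
    then have "({e}, 0) \<in> reach K D 0" by simp
    moreover have "{e} \<subseteq> E'" using e by simp
    ultimately show ?case by blast
  next
    case (Suc T)
    consider "\<exists>t\<le>T. \<exists>S. (S, D) \<in> reach K D t \<and> S \<subseteq> E'" |
      S d where "(S, d) \<in> reach K D T" "S \<subseteq> E'" "d \<noteq> D" |
      "card (\<Union>E') \<le> k + (max_verts + 1) * D * max_verts"
      using Suc.IH by blast
    then show ?case
    proof cases
      case 1 then show ?thesis using le_SucI by blast
    next
      case 3 then show ?thesis by blast
    next
      case (2 S d)
      have inv: "S \<noteq> {}" "d \<le> D" "card (\<Union>S) \<le> k + T * max_verts"
        "T \<le> petal_number S + (max_verts + 1) * d"
        using reach_invariant[OF K 2(1)] by auto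
      show ?thesis
      proof (cases "S = E'")
        case True
        then have "petal_number S = 0" using minimal_arr_no_petal E' by simp
        then have "T \<le> (max_verts + 1) * D" using inv by (simp add: le_trans[OF inv(4)] mult_le_mono2 del: mult_Suc)
        then have "T * max_verts \<le> (max_verts + 1) * D * max_verts" by (rule mult_le_mono1)
        then have "k + T * max_verts \<le> k + (max_verts + 1) * D * max_verts" by simp
        then have "card (\<Union>E') \<le> k + (max_verts + 1) * D * max_verts"
          using inv(3) unfolding True by (rule order_trans[rotated])
        then show ?thesis by blast
      next
        case False
        then have "S \<subset> E'" using 2 by auto
        then obtain Y where Y: "Y \<subseteq> E'" "dense_ext S Y \<or> tree_ext S Y"
          using extension_exists[OF E'(2)] inv(1) by blast
        have "d < D" using inv 2 by simp
        have YK: "Y \<subseteq> K" using Y E' E by auto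
        have sub: "S \<union> Y \<subseteq> E'" using Y 2 by auto
        have "\<exists>d'. (S \<union> Y, d') \<in> reach K D (Suc T)"
          using Y(2)
        proof
          assume "dense_ext S Y"
          then have "(S \<union> Y, Suc d) \<in> reach K D (Suc T)" using 2(1) \<open>d < D\<close> YK by force
          then show ?thesis by blast
        next
          assume "tree_ext S Y"
          then have "(S \<union> Y, d) \<in> reach K D (Suc T)" using 2(1) \<open>d < D\<close> YK by force
          then show ?thesis by blast
        qed
        then show ?thesis using sub by blast
      qed
    qed
  qed
  then show ?thesis using E' arrE' by (meson order_trans)
qed

end

section \<open>First-moment estimates\<close>

lemma choose_le_power: "n choose j \<le> n ^ j"
  by (cases "j \<le> n") (auto simp: binomial_le_pow binomial_eq_0)

lemma sum_inverse_power_subsets: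
  assumes "n \<ge> 1"
  shows "(\<Sum>N | N \<subseteq> {1..n} \<and> card N \<le> M. 1 / real n ^ card N) \<le> real (M + 1)"
proof -
  let ?T = "{N. N \<subseteq> {1..n} \<and> card N \<le> M}"
  have "(\<Sum>N\<in>?T. 1 / real n ^ card N) = (\<Sum>j\<in>{..M}. \<Sum>N | N \<in> ?T \<and> card N = j. 1 / real n ^ card N)"
    by (rule sum.group[symmetric]) auto
  also have "\<dots> \<le> (\<Sum>j\<in>{..M}. 1)"
  proof (rule sum_mono)
    fix j assume "j \<in> {..M}"
    then have "{N. N \<in> ?T \<and> card N = j} = {N. N \<subseteq> {1..n} \<and> card N = j}" by auto
    then have "(\<Sum>N | N \<in> ?T \<and> card N = j. 1 / real n ^ card N) = real (n choose j) * (1 / real n ^ j)"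
      by (simp add: n_subsets)
    also have "\<dots> \<le> real n ^ j * (1 / real n ^ j)"
      using choose_le_power[of n j] by (intro mult_right_mono) (auto simp flip: of_nat_power)
    also have "\<dots> = 1" using assms by simp
    finally show "(\<Sum>N | N \<in> ?T \<and> card N = j. 1 / real n ^ card N) \<le> 1" .
  qed
  finally show ?thesis by simp
qed

lemma card_bounded_subsets:
  assumes "finite A"
  shows "card {W. W \<subseteq> A \<and> card W \<le> M} \<le> (M + 1) * (card A + 1) ^ M"
proof -
  have "{W. W \<subseteq> A \<and> card W \<le> M} = (\<Union>j\<in>{..M}. {W. W \<subseteq> A \<and> card W = j})" by auto
  also have "card \<dots> \<le> (\<Sum>j\<in>{..M}. card {W. W \<subseteq> A \<and> card W = j})" by (rule card_UN_le) simp
  also have "\<dots> \<le> (\<Sum>j\<in>{..M}. (card A + 1) ^ M)"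
  proof (rule sum_mono)
    fix j assume j: "j \<in> {..M}"
    have "card {W. W \<subseteq> A \<and> card W = j} = card A choose j" by (rule n_subsets[OF assms])
    also have "\<dots> \<le> card A ^ j" by (rule choose_le_power)
    also have "\<dots> \<le> (card A + 1) ^ j" by (rule power_mono) auto
    also have "\<dots> \<le> (card A + 1) ^ M" using j by (intro power_increasing) auto
    finally show "card {W. W \<subseteq> A \<and> card W = j} \<le> (card A + 1) ^ M" .
  qed
  finally show ?thesis by simp
qed

text \<open>Each \<open>Y\<close> is classified by its trace on \<open>V\<close> and its set
  \<open>N\<close> of new vertices; at most \<open>2 ^ (2 ^ M)\<close> edge sets fit given vertices.
  A term is at most \<open>b / n ^ card N\<close>, and summing over \<open>N\<close> cancels the
  powers of \<open>n\<close>. Thus the explored set enters only through the number of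
  traces.\<close>

lemma sum_extensions_le:
  fixes p b :: real
  assumes n: "n \<ge> 1" and p: "0 \<le> p" and b: "0 \<le> b"
    and fin: "finite \<Y>" "finite \<W>"
    and \<Y>: "\<And>Y. Y \<in> \<Y> \<Longrightarrow> \<Union>Y \<subseteq> {1..n} \<and> card (\<Union>Y) \<le> M \<and> \<Union>Y \<inter> V \<in> \<W> \<and>
      p ^ card (Y - S) * real n ^ card (\<Union>Y - V) \<le> b"
  shows "(\<Sum>Y\<in>\<Y>. p ^ card (Y - S)) \<le> real (card \<W>) * (real (M + 1) * 2 ^ (2 ^ M)) * b"
proof -
  let ?N = "{N. N \<subseteq> {1..n} \<and> card N \<le> M}"
  let ?g = "\<lambda>Y. (\<Union>Y \<inter> V, \<Union>Y - V)"
  have finN: "finite ?N" by (rule finite_subset[of _ "Pow {1..n}"]) auto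
  have img: "?g ` \<Y> \<subseteq> \<W> \<times> ?N"
  proof
    fix z assume "z \<in> ?g ` \<Y>"
    then obtain Y where Y: "Y \<in> \<Y>" "z = ?g Y" by auto
    have "\<Union>Y \<subseteq> {1..n}" "card (\<Union>Y) \<le> M" "\<Union>Y \<inter> V \<in> \<W>" using \<Y>[OF Y(1)] by auto
    moreover have "card (\<Union>Y - V) \<le> card (\<Union>Y)"
      using \<open>\<Union>Y \<subseteq> {1..n}\<close> by (intro card_mono) (auto intro: finite_subset)
    ultimately show "z \<in> \<W> \<times> ?N" using Y by auto
  qed
  have "(\<Sum>Y\<in>\<Y>. p ^ card (Y - S)) = (\<Sum>z\<in>\<W> \<times> ?N. \<Sum>Y | Y \<in> \<Y> \<and> ?g Y = z. p ^ card (Y - S))"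
    by (rule sum.group[symmetric]) (use fin finN img in auto)
  also have "\<dots> \<le> (\<Sum>z\<in>\<W> \<times> ?N. 2 ^ (2 ^ M) * b * (1 / real n ^ card (snd z)))"
  proof (rule sum_mono)
    fix z assume "z \<in> \<W> \<times> ?N"
    obtain W N where z: "z = (W, N)" by (cases z)
    let ?A = "{Y. Y \<in> \<Y> \<and> ?g Y = z}"
    have "card ?A \<le> 2 ^ (2 ^ M)"
    proof (cases "?A = {}")
      case False
      then obtain Y0 where Y0: "Y0 \<in> \<Y>" "?g Y0 = z" by auto
      have WN: "W \<union> N = \<Union>Y0" using Y0 z by auto
      have "finite (W \<union> N)" "card (W \<union> N) \<le> M"
        unfolding WN using \<Y>[OF Y0(1)] by (auto intro: finite_subset)
      have "?A \<subseteq> Pow (Pow (W \<union> N))" using z by auto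
      then have "card ?A \<le> card (Pow (Pow (W \<union> N)))"
        using \<open>finite (W \<union> N)\<close> by (intro card_mono) auto
      also have "\<dots> = 2 ^ (2 ^ card (W \<union> N))" using \<open>finite (W \<union> N)\<close> by (simp add: card_Pow)
      also have "\<dots> \<le> 2 ^ (2 ^ M)" using \<open>card (W \<union> N) \<le> M\<close> by simp
      finally show ?thesis .
    next
      case True
      show ?thesis unfolding True by simp
    qed
    from of_nat_mono[OF this, where 'a = real] have cA: "real (card ?A) \<le> 2 ^ (2 ^ M)" by simp
    have "(\<Sum>Y\<in>?A. p ^ card (Y - S)) \<le> (\<Sum>Y\<in>?A. b * (1 / real n ^ card N))"
    proof (rule sum_mono)
      fix Y assume "Y \<in> ?A"
      then have "Y \<in> \<Y>" and N: "\<Union>Y - V = N" using z by auto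
      have "p ^ card (Y - S) * real n ^ card N \<le> b" using \<Y>[OF \<open>Y \<in> \<Y>\<close>] unfolding N by blast
      then show "p ^ card (Y - S) \<le> b * (1 / real n ^ card N)" using n by (simp add: field_simps)
    qed
    also have "\<dots> = real (card ?A) * (b * (1 / real n ^ card N))" by simp
    also have "\<dots> \<le> 2 ^ (2 ^ M) * (b * (1 / real n ^ card N))"
      by (rule mult_right_mono[OF cA]) (use b in auto)
    finally show "(\<Sum>Y\<in>?A. p ^ card (Y - S)) \<le> 2 ^ (2 ^ M) * b * (1 / real n ^ card (snd z))"
      using z by (simp add: mult.assoc)
  qed
  also have "\<dots> = (\<Sum>W\<in>\<W>. \<Sum>N\<in>?N. 2 ^ (2 ^ M) * b * (1 / real n ^ card N))"
    unfolding sum.cartesian_product by (simp only: case_prod_unfold)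
  also have "\<dots> = real (card \<W>) * (2 ^ (2 ^ M) * b * (\<Sum>N\<in>?N. 1 / real n ^ card N))"
    by (simp add: sum_distrib_left)
  also have "\<dots> \<le> real (card \<W>) * (2 ^ (2 ^ M) * b * real (M + 1))"
    using b by (intro mult_left_mono sum_inverse_power_subsets[OF n]) auto
  finally show ?thesis by (simp add: mult_ac)
qed

text \<open>Only finitely many pairs \<open>(a, j)\<close> matter, so the least of their positive
  surpluses serves; the inserted 1 keeps the set nonempty. This converts a strict density inequality
  into a factor n powr (-\<epsilon>).\<close>

lemma positive_gap:
  fixes m :: real and A J :: nat
  assumes "m > 0"
  obtains \<epsilon> where "\<epsilon> > 0" "\<And>a j :: nat. a \<le> A \<Longrightarrow> j \<le> J \<Longrightarrow> m * j < a \<Longrightarrow> \<epsilon> \<le> a / m - j"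
proof -
  define X where "X = insert 1 ((\<lambda>(a, j). real a / m - real j) ` {(a, j). a \<le> A \<and> j \<le> J \<and> m * j < a})"
  have "finite ({..A} \<times> {..J})" by simp
  then have "finite {(a, j). a \<le> A \<and> j \<le> J \<and> m * real j < real a}"
    by (rule finite_subset[rotated]) auto
  then have fin: "finite X" by (simp add: X_def)
  have pos: "x > 0" if "x \<in> X" for x
    using that assms by (auto simp: X_def field_simps)
  have "Min X > 0" using fin pos by (subst Min_gr_iff) (auto simp: X_def)
  moreover have "Min X \<le> real a / m - real j" if "a \<le> A" "j \<le> J" "m * j < a" for a j
    by (rule Min_le[OF fin]) (use that in \<open>force simp: X_def\<close>)
  ultimately show ?thesis using that by blast
qed

text \<open>One of the \<open>a\<close> factors \<open>c\<close> is kept, as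
  \<open>a \<ge> 1\<close> and \<open>c \<le> 1\<close> allow. If the density is exactly
  \<open>m\<close>, the power of \<open>n\<close> is trivial and this \<open>c\<close> is the only
  gain left.\<close>

lemma power_density_bound:
  fixes p c m :: real
  assumes n: "n \<ge> 1" and p: "0 \<le> p" "p \<le> c * real n powr (- 1 / m)" and c: "0 < c" "c \<le> 1"
    and a: "a \<ge> 1" and m: "m > 0"
  shows "p ^ a * real n ^ j \<le> c * real n powr (real j - real a / m)"
proof -
  have "p ^ a \<le> (c * real n powr (- 1 / m)) ^ a" using p by (intro power_mono) auto
  also have "\<dots> = c ^ a * real n powr (- (a / m))"
    using n by (simp add: power_mult_distrib powr_powr flip: powr_realpow)
  also have "\<dots> \<le> c * real n powr (- (a / m))"
    using power_decreasing[of 1 a c] c a by (intro mult_right_mono) auto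
  finally have "p ^ a * real n ^ j \<le> c * real n powr (- (a / m)) * real n ^ j"
    by (intro mult_right_mono) auto
  also have "\<dots> = c * real n powr (real j - real a / m)"
    using n by (simp add: powr_realpow[symmetric] powr_add[symmetric] powr_diff field_simps powr_minus)
  finally show ?thesis .
qed

lemma sum_UN_le_sum:
  fixes f :: "'b \<Rightarrow> real"
  assumes "finite I" "\<And>i. i \<in> I \<Longrightarrow> finite (A i)" "\<And>x. f x \<ge> 0"
  shows "sum f (\<Union>i\<in>I. A i) \<le> (\<Sum>i\<in>I. sum f (A i))"
  using assms(1,2)
proof (induction I)
  case (insert i I)
  have "sum f (\<Union>j\<in>insert i I. A j) = sum f (A i \<union> (\<Union>j\<in>I. A j))" by simp
  also have "\<dots> \<le> sum f (A i) + sum f (\<Union>j\<in>I. A j)"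
    using insert by (subst sum.union_inter[symmetric]) (auto intro: sum_nonneg assms(3))
  finally show ?case using insert by fastforce
qed simp

section \<open>Edge sets contained in the random hypergraph\<close>

definition complete_edges :: "nat \<Rightarrow> nat \<Rightarrow> nat set set" where
  "complete_edges k n = {e. e \<subseteq> {1..n} \<and> card e = k}"

lemma finite_complete_edges: "finite (complete_edges k n)"
  unfolding complete_edges_def by (rule finite_subset[of _ "Pow {1..n}"]) auto

lemma card_complete_edges: "card (complete_edges k n) = n choose k"
  unfolding complete_edges_def by (simp add: n_subsets)

lemma prob_contains:
  assumes S: "S \<subseteq> complete_edges k n" and p: "0 \<le> p" "p \<le> 1"
  shows "measure_pmf.prob (random_hgraph k n p) {G. S \<subseteq> edges G} = p ^ card S"
proof -
  let ?K = "complete_edges k n"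
  let ?P = "Pi_pmf ?K False (\<lambda>_. bernoulli_pmf p)"
  have "measure_pmf.prob (random_hgraph k n p) {G. S \<subseteq> edges G} =
    measure_pmf.prob ?P (Pi ?K (\<lambda>e. if e \<in> S then {True} else UNIV))"
    unfolding random_hgraph_def complete_edges_def[symmetric] measure_map_pmf
    using S by (intro arg_cong[where f = "measure_pmf.prob ?P"])
      (auto simp: complete_edges_def Pi_def split: if_splits)
  also have "\<dots> = (\<Prod>e\<in>?K. measure_pmf.prob (bernoulli_pmf p) (if e \<in> S then {True} else UNIV))"
    by (rule measure_Pi_pmf_Pi[OF finite_complete_edges])
  also have "\<dots> = (\<Prod>e\<in>?K. if e \<in> S then p else 1)"
    using p by (intro prod.cong) (auto simp: measure_pmf_single)
  also have "\<dots> = (\<Prod>e\<in>?K \<inter> S. p)"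
    by (rule prod.inter_restrict[OF finite_complete_edges, symmetric])
  also have "\<dots> = p ^ card S" using S by (simp add: Int_absorb1)
  finally show ?thesis .
qed

lemma prob_contains_some:
  assumes I: "finite I" "\<And>i. i \<in> I \<Longrightarrow> S i \<subseteq> complete_edges k n" and p: "0 \<le> p" "p \<le> 1"
  shows "measure_pmf.prob (random_hgraph k n p) {G. \<exists>i\<in>I. S i \<subseteq> edges G} \<le> (\<Sum>i\<in>I. p ^ card (S i))"
proof -
  have "{G. \<exists>i\<in>I. S i \<subseteq> edges G} = (\<Union>i\<in>I. {G :: nat hgraph. S i \<subseteq> edges G})" by auto
  also have "measure_pmf.prob (random_hgraph k n p) \<dots> \<le>
      (\<Sum>i\<in>I. measure_pmf.prob (random_hgraph k n p) {G. S i \<subseteq> edges G})"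
    by (rule measure_UNION_le) (use I in auto)
  also have "\<dots> = (\<Sum>i\<in>I. p ^ card (S i))"
    by (intro sum.cong refl prob_contains I p)
  finally show ?thesis .
qed

lemma set_pmf_random_hgraph: "G \<in> set_pmf (random_hgraph k n p) \<Longrightarrow> edges G \<subseteq> complete_edges k n"
  by (fastforce simp: random_hgraph_def complete_edges_def)

lemma card_edges_le:
  assumes "finite (\<Union>Y)"
  shows "card Y \<le> 2 ^ card (\<Union>Y)"
proof -
  have "Y \<subseteq> Pow (\<Union>Y)" by auto
  then show ?thesis using card_mono[of "Pow (\<Union>Y)" Y] assms by (simp add: card_Pow)
qed

lemma finite_subset_bounded: "\<Union>Y \<subseteq> {1..n::nat} \<Longrightarrow> finite (\<Union>Y)"
  by (rule finite_subset) auto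

section \<open>Expected numbers of dense and of tree extensions\<close>

context exploration
begin

lemma attach_subset:
  assumes "finite S"
  shows "attach S \<subseteq> S"
proof (cases "petal_number S = 0")
  case False
  obtain P f e where e: "petal S (P, f)" "e \<in> P - {f}" "attach S = {e}"
    by (rule attach_petal[OF assms False])
  then have "e \<in> S" unfolding petal_def by blast
  then show ?thesis using e by simp
qed (simp add: attach_def)

lemma finite_reach:
  assumes "finite K"
  shows "finite (reach K D t)"
proof (induction t)
  case (Suc t)
  have "finite {Y. Y \<subseteq> K \<and> P Y}" for P
    by (rule finite_subset[of _ "Pow K"]) (use assms in auto)
  then show ?case using Suc by auto
qed (use assms in simp)

text \<open>Every state carries its expected number of occurrences, with a reward \<open>b\<close> for each dense
  extension; the total weight then halves in every step.\<close>

lemma weight_step: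
  fixes p b :: real
  assumes K: "finite K" "\<And>e. e \<in> K \<Longrightarrow> card e = k" and p: "0 \<le> p" and b: "0 \<le> b"
    and bound: "\<And>S d. (S, d) \<in> reach K D t \<Longrightarrow> d < D \<Longrightarrow>
      b * (\<Sum>Y | Y \<subseteq> K \<and> dense_ext S Y. p ^ card (Y - S)) +
      (\<Sum>Y | Y \<subseteq> K \<and> tree_ext S Y. p ^ card (Y - S)) \<le> 1 / 2"
  shows "(\<Sum>(S, d)\<in>reach K D (Suc t). p ^ card S * b ^ d) \<le> 1 / 2 * (\<Sum>(S, d)\<in>reach K D t. p ^ card S * b ^ d)"
proof -
  let ?w = "\<lambda>(S :: nat set set, d :: nat). p ^ card S * b ^ d"
  let ?R = "{s \<in> reach K D t. snd s < D}"
  let ?A = "\<lambda>(S, d :: nat). (\<lambda>Y. (S \<union> Y, Suc d)) ` {Y. Y \<subseteq> K \<and> dense_ext S Y}"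
  let ?B = "\<lambda>(S, d :: nat). (\<lambda>Y. (S \<union> Y, d)) ` {Y. Y \<subseteq> K \<and> tree_ext S Y}"
  have finY: "finite {Y. Y \<subseteq> K \<and> P Y}" for P
    by (rule finite_subset[of _ "Pow K"]) (use K in auto)
  have finR: "finite (reach K D t)" using finite_reach K by blast
  have w0: "?w s \<ge> 0" for s using p b by (cases s) auto
  have eq: "reach K D (Suc t) = (\<Union>s\<in>?R. ?A s \<union> ?B s)" by (auto simp: case_prod_unfold)
  have card_eq: "card (S \<union> Y) = card S + card (Y - S)" if "finite S" "finite Y" for S Y :: "nat set set"
    using that card_Un_disjoint[of S "Y - S"] by simp
  have step: "sum ?w (?A s \<union> ?B s) \<le> ?w s * (1 / 2)" if s: "s \<in> ?R" for s
  proof -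
    obtain S d where sd: "s = (S, d)" by (cases s)
    have S: "finite S" using reach_invariant[OF K, of S d D t] s sd K finite_subset by auto
    have "sum ?w (?A s \<union> ?B s) \<le> sum ?w (?A s) + sum ?w (?B s)"
      using finY sd by (subst sum.union_inter[symmetric]) (auto intro!: sum_nonneg w0)
    also have "sum ?w (?A s) \<le> (\<Sum>Y | Y \<subseteq> K \<and> dense_ext S Y. ?w (S \<union> Y, Suc d))"
    proof -
      have "sum ?w ((\<lambda>Y. (S \<union> Y, Suc d)) ` {Y. Y \<subseteq> K \<and> dense_ext S Y}) \<le>
          sum (?w \<circ> (\<lambda>Y. (S \<union> Y, Suc d))) {Y. Y \<subseteq> K \<and> dense_ext S Y}"
        by (rule sum_image_le[OF finY]) (rule w0)
      then show ?thesis unfolding sd prod.case comp_def .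
    qed
    also have "\<dots> = (\<Sum>Y | Y \<subseteq> K \<and> dense_ext S Y. p ^ card S * b ^ d * (b * p ^ card (Y - S)))"
    proof (rule sum.cong[OF refl])
      fix Y assume "Y \<in> {Y. Y \<subseteq> K \<and> dense_ext S Y}"
      then have "finite Y" using K finite_subset by auto
      then show "?w (S \<union> Y, Suc d) = p ^ card S * b ^ d * (b * p ^ card (Y - S))"
        using card_eq[OF S] by (simp add: power_add mult_ac)
    qed
    also have "sum ?w (?B s) \<le> (\<Sum>Y | Y \<subseteq> K \<and> tree_ext S Y. ?w (S \<union> Y, d))"
    proof -
      have "sum ?w ((\<lambda>Y. (S \<union> Y, d)) ` {Y. Y \<subseteq> K \<and> tree_ext S Y}) \<le>
          sum (?w \<circ> (\<lambda>Y. (S \<union> Y, d))) {Y. Y \<subseteq> K \<and> tree_ext S Y}"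
        by (rule sum_image_le[OF finY]) (rule w0)
      then show ?thesis unfolding sd prod.case comp_def .
    qed
    also have "\<dots> = (\<Sum>Y | Y \<subseteq> K \<and> tree_ext S Y. p ^ card S * b ^ d * p ^ card (Y - S))"
    proof (rule sum.cong[OF refl])
      fix Y assume "Y \<in> {Y. Y \<subseteq> K \<and> tree_ext S Y}"
      then have "finite Y" using K finite_subset by auto
      then show "?w (S \<union> Y, d) = p ^ card S * b ^ d * p ^ card (Y - S)"
        using card_eq[OF S] by (simp add: power_add mult_ac)
    qed
    finally have "sum ?w (?A s \<union> ?B s) \<le> p ^ card S * b ^ d *
      (b * (\<Sum>Y | Y \<subseteq> K \<and> dense_ext S Y. p ^ card (Y - S)) +
      (\<Sum>Y | Y \<subseteq> K \<and> tree_ext S Y. p ^ card (Y - S)))"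
      by (simp add: sum_distrib_left distrib_left)
    also have "\<dots> \<le> p ^ card S * b ^ d * (1 / 2)"
      by (rule mult_left_mono[OF bound]) (use s sd p b in auto)
    finally show ?thesis using sd by simp
  qed
  \<comment> \<open>Different states may lead to the same new state; as weights are nonnegative,
    counting it repeatedly only enlarges the sum.\<close>
  have "sum ?w (reach K D (Suc t)) \<le> (\<Sum>s\<in>?R. sum ?w (?A s \<union> ?B s))"
    unfolding eq using finR finY w0 by (intro sum_UN_le_sum) auto
  also have "\<dots> \<le> (\<Sum>s\<in>?R. ?w s * (1 / 2))" by (rule sum_mono[OF step])
  also have "\<dots> \<le> (\<Sum>s\<in>reach K D t. ?w s * (1 / 2))"
  proof (rule sum_mono2[OF finR])
    fix s show "0 \<le> ?w s * (1 / 2)" using w0[of s] by linarith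
  qed auto
  also have "\<dots> = 1 / 2 * sum ?w (reach K D t)" by (simp add: sum_distrib_left mult.commute)
  finally show ?thesis .
qed

text \<open>The extension may touch the explored set anywhere, so all vertex sets of size at most
  \<open>M\<close> occur as traces. For \<open>L\<close> logarithmic in \<open>n\<close> their
  number is polylogarithmic, which the surplus of a dense extension outweighs.\<close>

lemma sum_dense_ext_le:
  fixes p c \<epsilon> :: real and n L :: nat
  defines "K \<equiv> complete_edges k n" and "M \<equiv> max_verts"
  assumes n: "n \<ge> 1" and p: "0 \<le> p" "p \<le> c * real n powr (- 1 / m)" and c: "0 < c" "c \<le> 1"
    and gap: "\<And>(a :: nat) (j :: nat). a \<le> (2 :: nat) ^ M \<Longrightarrow> j \<le> M \<Longrightarrow> m * j < a \<Longrightarrow> \<epsilon> \<le> a / m - j"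
    and S: "S \<subseteq> K" "card (\<Union>S) \<le> L"
  shows "(\<Sum>Y | Y \<subseteq> K \<and> dense_ext S Y. p ^ card (Y - S)) \<le>
    real ((M + 1) * (L + 1) ^ M) * (real (M + 1) * 2 ^ (2 ^ M)) * real n powr (- \<epsilon>)"
proof -
  let ?W = "{W. W \<subseteq> \<Union>S \<and> card W \<le> M}"
  have finK: "finite K" unfolding K_def by (rule finite_complete_edges)
  have UK: "\<Union>Y \<subseteq> {1..n}" if "Y \<subseteq> K" for Y using that unfolding K_def complete_edges_def by blast
  have finS: "finite (\<Union>S)" using UK[OF S(1)] by (rule finite_subset_bounded)
  have "(\<Sum>Y | Y \<subseteq> K \<and> dense_ext S Y. p ^ card (Y - S)) \<le>
    real (card ?W) * (real (M + 1) * 2 ^ (2 ^ M)) * real n powr (- \<epsilon>)"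
  proof (rule sum_extensions_le[OF n p(1)])
    fix Y assume "Y \<in> {Y. Y \<subseteq> K \<and> dense_ext S Y}"
    then have Y: "Y \<subseteq> K" and d: "card (\<Union>Y) \<le> M" "m * card (\<Union>Y - \<Union>S) < card (Y - S)"
      by (auto simp: dense_ext_def M_def)
    have UY: "\<Union>Y \<subseteq> {1..n}" by (rule UK[OF Y])
    have finY: "finite (\<Union>Y)" by (rule finite_subset_bounded[OF UY])
    have finY': "finite Y" using Y finK finite_subset by auto
    have "card (Y - S) \<le> card Y" using finY' by (intro card_mono) auto
    also have "\<dots> \<le> 2 ^ card (\<Union>Y)" by (rule card_edges_le[OF finY])
    also have "\<dots> \<le> 2 ^ M" using d by simp
    finally have a: "card (Y - S) \<le> 2 ^ M" .
    have "card (\<Union>Y - \<Union>S) \<le> card (\<Union>Y)" using finY by (intro card_mono) auto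
    then have j: "card (\<Union>Y - \<Union>S) \<le> M" using d by simp
    have "real (card (Y - S)) > 0" using d(2) m_pos by (smt (verit) mult_nonneg_nonneg of_nat_0_le_iff)
    then have a1: "card (Y - S) \<ge> 1" by simp
    have "p ^ card (Y - S) * real n ^ card (\<Union>Y - \<Union>S) \<le>
        c * real n powr (real (card (\<Union>Y - \<Union>S)) - real (card (Y - S)) / m)"
      by (rule power_density_bound[OF n p c a1 m_pos])
    also have "\<dots> \<le> 1 * real n powr (- \<epsilon>)"
      using gap[OF a j d(2)] n c by (intro mult_mono powr_mono) auto
    finally have "p ^ card (Y - S) * real n ^ card (\<Union>Y - \<Union>S) \<le> real n powr (- \<epsilon>)" by simp
    moreover have "card (\<Union>Y \<inter> \<Union>S) \<le> card (\<Union>Y)" using finY by (intro card_mono) auto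
    then have "\<Union>Y \<inter> \<Union>S \<in> ?W" using d by simp
    ultimately show "\<Union>Y \<subseteq> {1..n} \<and> card (\<Union>Y) \<le> M \<and> \<Union>Y \<inter> \<Union>S \<in> ?W \<and>
      p ^ card (Y - S) * real n ^ card (\<Union>Y - \<Union>S) \<le> real n powr (- \<epsilon>)"
      using UY d by blast
  next
    show "finite ?W" by (rule finite_subset[of _ "Pow (\<Union>S)"]) (use finS in auto)
    show "finite {Y. Y \<subseteq> K \<and> dense_ext S Y}"
      by (rule finite_subset[of _ "Pow K"]) (use finK in auto)
  qed simp
  also have "\<dots> \<le> real ((M + 1) * (L + 1) ^ M) * (real (M + 1) * 2 ^ (2 ^ M)) * real n powr (- \<epsilon>)"
  proof (intro mult_right_mono)
    have "card ?W \<le> (M + 1) * (card (\<Union>S) + 1) ^ M" by (rule card_bounded_subsets[OF finS])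
    also have "\<dots> \<le> (M + 1) * (L + 1) ^ M" using S by (intro mult_left_mono power_mono) auto
    finally show "real (card ?W) \<le> real ((M + 1) * (L + 1) ^ M)" by (rule of_nat_mono)
  qed auto
  finally show ?thesis .
qed

text \<open>The trace lies inside an edge of \<open>attach S\<close>, so at most
  \<open>A * 2 ^ k\<close> traces occur however large \<open>S\<close> is. Since the density may be
  exactly \<open>m\<close>, only the factor \<open>c\<close> makes the sum small.\<close>

lemma sum_tree_ext_le:
  fixes p c :: real and n A :: nat
  defines "K \<equiv> complete_edges k n" and "M \<equiv> max_verts"
  assumes n: "n \<ge> 1" and p: "0 \<le> p" "p \<le> c * real n powr (- 1 / m)" and c: "0 < c" "c \<le> 1"
    and S: "S \<subseteq> K" "card (attach S) \<le> A"
  shows "(\<Sum>Y | Y \<subseteq> K \<and> tree_ext S Y. p ^ card (Y - S)) \<le>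
    real (A * 2 ^ k) * (real (M + 1) * 2 ^ (2 ^ M)) * c"
proof -
  let ?W = "\<Union>e\<in>attach S. Pow e"
  have finK: "finite K" unfolding K_def by (rule finite_complete_edges)
  have UK: "\<Union>Y \<subseteq> {1..n}" if "Y \<subseteq> K" for Y using that unfolding K_def complete_edges_def by blast
  have finS: "finite S" using S finK finite_subset by auto
  have att: "attach S \<subseteq> K" "finite (attach S)"
    using attach_subset[OF finS] S finS finite_subset by auto
  have edge: "card e = k" "finite e" if "e \<in> attach S" for e
  proof -
    have "e \<subseteq> {1..n} \<and> card e = k" using that att unfolding K_def complete_edges_def by blast
    then show "card e = k" "finite e" by (auto intro: finite_subset)
  qed
  have "(\<Sum>Y | Y \<subseteq> K \<and> tree_ext S Y. p ^ card (Y - S)) \<le>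
    real (card ?W) * (real (M + 1) * 2 ^ (2 ^ M)) * c"
  proof (rule sum_extensions_le[OF n p(1)])
    fix Y assume "Y \<in> {Y. Y \<subseteq> K \<and> tree_ext S Y}"
    then have Y: "Y \<subseteq> K" and d: "card (\<Union>Y) \<le> M" "m * card (\<Union>Y - \<Union>S) \<le> card (Y - S)" "Y - S \<noteq> {}"
      and e: "\<exists>e\<in>attach S. \<Union>Y \<inter> \<Union>S \<subseteq> e"
      unfolding tree_ext_def M_def by blast+
    have UY: "\<Union>Y \<subseteq> {1..n}" by (rule UK[OF Y])
    have finY': "finite Y" using Y finK finite_subset by auto
    have a1: "card (Y - S) \<ge> 1" using d(3) finY' by (simp add: Suc_le_eq card_gt_0_iff)
    have "p ^ card (Y - S) * real n ^ card (\<Union>Y - \<Union>S) \<le>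
        c * real n powr (real (card (\<Union>Y - \<Union>S)) - real (card (Y - S)) / m)"
      by (rule power_density_bound[OF n p c a1 m_pos])
    also have "\<dots> \<le> c * real n powr 0"
      using d(2) n c m_pos by (intro mult_left_mono powr_mono) (auto simp: field_simps)
    finally have "p ^ card (Y - S) * real n ^ card (\<Union>Y - \<Union>S) \<le> c" using n by simp
    moreover have "\<Union>Y \<inter> \<Union>S \<in> ?W" using e by blast
    ultimately show "\<Union>Y \<subseteq> {1..n} \<and> card (\<Union>Y) \<le> M \<and> \<Union>Y \<inter> \<Union>S \<in> ?W \<and>
      p ^ card (Y - S) * real n ^ card (\<Union>Y - \<Union>S) \<le> c"
      using UY d by blast
  next
    show "finite ?W" using att edge by blast
    show "finite {Y. Y \<subseteq> K \<and> tree_ext S Y}"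
      by (rule finite_subset[of _ "Pow K"]) (use finK in auto)
  qed (use c in simp)
  also have "\<dots> \<le> real (A * 2 ^ k) * (real (M + 1) * 2 ^ (2 ^ M)) * c"
  proof (intro mult_right_mono)
    have "card ?W \<le> (\<Sum>e\<in>attach S. card (Pow e))" by (rule card_UN_le[OF att(2)])
    also have "\<dots> = (\<Sum>e\<in>attach S. 2 ^ k)" by (intro sum.cong refl) (simp add: edge card_Pow)
    also have "\<dots> = card (attach S) * 2 ^ k" by simp
    also have "\<dots> \<le> A * 2 ^ k" using S by (intro mult_right_mono) auto
    finally show "real (card ?W) \<le> real (A * 2 ^ k)" by (rule of_nat_mono)
  qed (use c in auto)
  finally show ?thesis .
qed

text \<open>The bound involves neither \<open>t\<close> nor \<open>n\<close>, so one
  \<open>c\<close> serves all steps: either a single edge is prescribed, or the invariant without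
  petals gives \<open>t \<le> (max_verts + 1) * D\<close>.\<close>

lemma card_attach_le:
  assumes S: "(S, d) \<in> reach (complete_edges k n) D t"
  shows "card (attach S) \<le> 2 ^ (k + (max_verts + 1) * D * max_verts)"
proof -
  let ?K = "complete_edges k n"
  have K: "finite ?K" "\<And>e. e \<in> ?K \<Longrightarrow> card e = k"
    by (rule finite_complete_edges) (simp add: complete_edges_def)
  have inv: "S \<subseteq> ?K" "d \<le> D" "card (\<Union>S) \<le> k + t * max_verts" "t \<le> petal_number S + (max_verts + 1) * d"
    using reach_invariant[OF K S] by auto
  have finS: "finite S" using inv(1) K finite_subset by auto
  show ?thesis
  proof (cases "petal_number S = 0")
    case False
    then obtain e where "attach S = {e}" using attach_petal[OF finS] by metis
    then show ?thesis by simp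
  next
    case True
    have "t \<le> (max_verts + 1) * d" using inv(4) True by simp
    also have "\<dots> \<le> (max_verts + 1) * D" using inv(2) by (rule mult_le_mono2)
    finally have "t * max_verts \<le> (max_verts + 1) * D * max_verts" by (rule mult_le_mono1)
    then have "card (\<Union>S) \<le> k + (max_verts + 1) * D * max_verts" using inv(3) by (meson add_le_mono le_refl order_trans)
    moreover have "\<Union>S \<subseteq> {1..n}" using inv(1) unfolding complete_edges_def by blast
    then have "card S \<le> 2 ^ card (\<Union>S)" by (intro card_edges_le finite_subset_bounded)
    ultimately have "card S \<le> 2 ^ (k + (max_verts + 1) * D * max_verts)"
      by (meson le_trans one_le_numeral power_increasing)
    then show ?thesis using True by (simp add: attach_def)
  qed
qed

end

section \<open>The union bound and the choice of the constants\<close>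

lemma polylog_times_powr_tendsto_0:
  fixes a b C e :: real and M :: nat
  assumes e: "e > 0" and a: "a > 0"
  shows "(\<lambda>n. C * (a * log 2 (real n) + b) ^ M * real n powr (- e)) \<longlonglongrightarrow> 0"
proof -
  \<comment> \<open>The exponent \<open>e\<close> is split into \<open>M + 1\<close> equal shares,
    one for each of the \<open>M\<close> logarithmic factors and one for \<open>C\<close>.\<close>
  define d where "d = e / (real M + 1)"
  have d: "d > 0" using e by (simp add: d_def)
  have "(\<lambda>n. (a * log 2 (real n) + b) * real n powr (- d)) \<longlonglongrightarrow> 0"
    unfolding log_def using d a by real_asymp
  then have "(\<lambda>n. ((a * log 2 (real n) + b) * real n powr (- d)) ^ M * (C * real n powr (- d)))
      \<longlonglongrightarrow> 0 ^ M * 0"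
  proof (intro tendsto_mult tendsto_power)
    show "(\<lambda>n. C * real n powr (- d)) \<longlonglongrightarrow> 0" using d by real_asymp
  qed
  moreover have "\<forall>\<^sub>F n in sequentially. ((a * log 2 (real n) + b) * real n powr (- d)) ^ M * (C * real n powr (- d))
      = C * (a * log 2 (real n) + b) ^ M * real n powr (- e)"
    using eventually_gt_at_top[of 0]
  proof eventually_elim
    case (elim n)
    have "(real n powr (- d)) ^ M * real n powr (- d) = (real n powr (- d)) ^ Suc M" by simp
    also have "\<dots> = (real n powr (- d)) powr real (Suc M)" using elim by (subst powr_realpow) auto
    also have "\<dots> = real n powr (- d * real (Suc M))" by (rule powr_powr)
    also have "- d * real (Suc M) = - e" by (simp add: d_def field_simps)
    finally show ?case by (simp add: power_mult_distrib mult_ac)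
  qed
  ultimately show ?thesis by (simp add: tendsto_cong)
qed

context exploration
begin

text \<open>The initial weight is at most the number of possible edges. The reward n powr
  (\<epsilon> / 2) spends half of what a dense extension gains, and the other half has to outweigh
  the number of traces, as \<open>dense\<close> demands. Dense and tree extensions then contribute
  at most 1/4 each, so every step halves the weight.\<close>

lemma reach_weight_le:
  fixes p c \<epsilon> :: real and n D T :: nat
  defines "K \<equiv> complete_edges k n" and "M \<equiv> max_verts"
  assumes n: "n \<ge> 1" and p: "0 \<le> p" "p \<le> 1" "p \<le> c * real n powr (- 1 / m)" and c: "0 < c" "c \<le> 1"
    and gap: "\<And>(a :: nat) (j :: nat). a \<le> (2 :: nat) ^ M \<Longrightarrow> j \<le> M \<Longrightarrow> m * j < a \<Longrightarrow> \<epsilon> \<le> a / m - j"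
    and dense: "real n powr (\<epsilon> / 2) * (real ((M + 1) * (k + T * M + 1) ^ M) *
      (real (M + 1) * 2 ^ (2 ^ M)) * real n powr (- \<epsilon>)) \<le> 1 / 4"
    and tree: "real (2 ^ (k + (M + 1) * D * M) * 2 ^ k) * (real (M + 1) * 2 ^ (2 ^ M)) * c \<le> 1 / 4"
    and t: "t \<le> T"
  shows "(\<Sum>(S, d)\<in>reach K D t. p ^ card S * (real n powr (\<epsilon> / 2)) ^ d) \<le> (1 / 2) ^ t * real n ^ k"
  using t
proof (induction t)
  case 0
  have "(\<Sum>(S, d)\<in>reach K D 0. p ^ card S * (real n powr (\<epsilon> / 2)) ^ d) = (\<Sum>e\<in>K. p)"
    by (simp add: sum.reindex inj_on_def)
  also have "\<dots> \<le> (\<Sum>e\<in>K. 1)" using p by (intro sum_mono) auto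
  also have "\<dots> = real (n choose k)" by (simp add: K_def card_complete_edges)
  also have "\<dots> \<le> real (n ^ k)" by (rule of_nat_mono[OF choose_le_power])
  finally show ?case by simp
next
  case (Suc t)
  have K: "finite K" "\<And>e. e \<in> K \<Longrightarrow> card e = k"
    unfolding K_def by (rule finite_complete_edges) (simp add: complete_edges_def)
  have "(\<Sum>(S, d)\<in>reach K D (Suc t). p ^ card S * (real n powr (\<epsilon> / 2)) ^ d) \<le>
    1 / 2 * (\<Sum>(S, d)\<in>reach K D t. p ^ card S * (real n powr (\<epsilon> / 2)) ^ d)"
  proof (rule weight_step[OF K p(1)])
    fix S d assume S: "(S, d) \<in> reach K D t" "d < D"
    have inv: "S \<subseteq> K" "card (\<Union>S) \<le> k + t * M"
      using reach_invariant[OF K S(1)] by (auto simp: M_def)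
    have "t * M \<le> T * M" using Suc.prems by (intro mult_right_mono) auto
    then have L: "card (\<Union>S) \<le> k + T * M" using inv(2) by (meson add_le_mono le_refl order_trans)
    have "(\<Sum>Y | Y \<subseteq> K \<and> dense_ext S Y. p ^ card (Y - S)) \<le>
      real ((M + 1) * (k + T * M + 1) ^ M) * (real (M + 1) * 2 ^ (2 ^ M)) * real n powr (- \<epsilon>)"
      using sum_dense_ext_le[OF n p(1,3) c gap[unfolded M_def] inv(1)[unfolded K_def] L]
      unfolding K_def M_def by blast
    then have "real n powr (\<epsilon> / 2) * (\<Sum>Y | Y \<subseteq> K \<and> dense_ext S Y. p ^ card (Y - S)) \<le>
      real n powr (\<epsilon> / 2) * (real ((M + 1) * (k + T * M + 1) ^ M) *
      (real (M + 1) * 2 ^ (2 ^ M)) * real n powr (- \<epsilon>))"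
      by (intro mult_left_mono) auto
    then have 1: "real n powr (\<epsilon> / 2) * (\<Sum>Y | Y \<subseteq> K \<and> dense_ext S Y. p ^ card (Y - S)) \<le> 1 / 4"
      using dense by linarith
    have "(\<Sum>Y | Y \<subseteq> K \<and> tree_ext S Y. p ^ card (Y - S)) \<le>
      real (2 ^ (k + (M + 1) * D * M) * 2 ^ k) * (real (M + 1) * 2 ^ (2 ^ M)) * c"
      using sum_tree_ext_le[OF n p(1,3) c inv(1)[unfolded K_def] card_attach_le[OF S(1)[unfolded K_def]]]
      unfolding K_def M_def .
    then show "real n powr (\<epsilon> / 2) * (\<Sum>Y | Y \<subseteq> K \<and> dense_ext S Y. p ^ card (Y - S)) +
      (\<Sum>Y | Y \<subseteq> K \<and> tree_ext S Y. p ^ card (Y - S)) \<le> 1 / 2"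
      using 1 tree by linarith
  qed auto
  also have "\<dots> \<le> 1 / 2 * ((1 / 2) ^ t * real n ^ k)"
    using Suc by (intro mult_left_mono) auto
  finally show ?case by simp
qed

text \<open>A bounded arrowing set is not unlikely by mere boundedness; \<open>dense\<close>, the
  form in which hypothesis (iv) enters, replaces it by a bounded set of density greater than
  \<open>m\<close>.\<close>

lemma arr_cases:
  fixes n D T :: nat
  defines "K \<equiv> complete_edges k n" and "M' \<equiv> k + (max_verts + 1) * D * max_verts"
  assumes dense: "\<And>E. finite E \<Longrightarrow> (\<And>e. e \<in> E \<Longrightarrow> card e = k) \<Longrightarrow> arr E \<Longrightarrow> \<exists>Y\<subseteq>E. m * card (\<Union>Y) < card Y"
    and E: "E \<subseteq> K" "arr E"
  shows "(\<exists>(t, s)\<in>(SIGMA t:{..T}. {s \<in> reach K D t. snd s = D}). fst s \<subseteq> E) \<or>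
    (\<exists>s\<in>reach K D T. fst s \<subseteq> E) \<or>
    (\<exists>Y\<in>{Y. Y \<subseteq> K \<and> card (\<Union>Y) \<le> M' \<and> m * card (\<Union>Y) < card Y}. Y \<subseteq> E)"
proof -
  have K: "finite K" "\<And>e. e \<in> K \<Longrightarrow> card e = k"
    unfolding K_def by (rule finite_complete_edges) (simp add: complete_edges_def)
  consider t S where "t \<le> T" "(S, D) \<in> reach K D t" "S \<subseteq> E" |
    S d where "(S, d) \<in> reach K D T" "S \<subseteq> E" |
    Z where "Z \<subseteq> E" "arr Z" "card (\<Union>Z) \<le> M'"
    using explore[OF K E, of T D] unfolding M'_def by blast
  then show ?thesis
  proof cases
    case 1
    then have "(t, (S, D)) \<in> (SIGMA t:{..T}. {s \<in> reach K D t. snd s = D})" by simp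
    then show ?thesis using 1 by force
  next
    case 2
    then show ?thesis by force
  next
    case 3
    have ZK: "Z \<subseteq> K" using 3 E by blast
    have finZ: "finite Z" using ZK K finite_subset by auto
    obtain Y where Y: "Y \<subseteq> Z" "m * card (\<Union>Y) < card Y"
      using dense[OF finZ _ 3(2)] ZK K by blast
    have "\<Union>Z \<subseteq> {1..n}" using ZK unfolding K_def complete_edges_def by blast
    then have "card (\<Union>Y) \<le> card (\<Union>Z)"
      using Y by (intro card_mono finite_subset_bounded[of Z n]) auto
    then show ?thesis using Y 3 ZK by fastforce
  qed
qed

text \<open>The three outcomes of the exploration are bounded separately. States with
  \<open>D\<close> dense extensions carry a reward of at least \<open>n ^ (k + 1)\<close>, which
  against the initial weight \<open>n ^ k\<close> and the geometric series over the steps leaves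
  \<open>2 / n\<close>. After \<open>T\<close> steps the whole weight is at most
  \<open>1 / n\<close>. The last term belongs to the bounded sets of density above
  \<open>m\<close>.\<close>

lemma prob_arr_le:
  fixes p c \<epsilon> \<epsilon>' :: real and n D T :: nat
  defines "K \<equiv> complete_edges k n" and "M \<equiv> max_verts" and "M' \<equiv> k + (max_verts + 1) * D * max_verts"
  assumes densE: "\<And>E. finite E \<Longrightarrow> (\<And>e. e \<in> E \<Longrightarrow> card e = k) \<Longrightarrow> arr E \<Longrightarrow> \<exists>Y\<subseteq>E. m * card (\<Union>Y) < card Y"
    and n: "n \<ge> 1" and p: "0 \<le> p" "p \<le> 1" "p \<le> c * real n powr (- 1 / m)" and c: "0 < c" "c \<le> 1"
    and gap: "\<And>(a :: nat) (j :: nat). a \<le> (2 :: nat) ^ M \<Longrightarrow> j \<le> M \<Longrightarrow> m * j < a \<Longrightarrow> \<epsilon> \<le> a / m - j"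
    and gap': "\<And>(a :: nat) (j :: nat). a \<le> (2 :: nat) ^ M' \<Longrightarrow> j \<le> M' \<Longrightarrow> m * j < a \<Longrightarrow> \<epsilon>' \<le> a / m - j"
    and dense: "real n powr (\<epsilon> / 2) * (real ((M + 1) * (k + T * M + 1) ^ M) *
      (real (M + 1) * 2 ^ (2 ^ M)) * real n powr (- \<epsilon>)) \<le> 1 / 4"
    and tree: "real (2 ^ (k + (M + 1) * D * M) * 2 ^ k) * (real (M + 1) * 2 ^ (2 ^ M)) * c \<le> 1 / 4"
    and D: "real (k + 1) \<le> \<epsilon> / 2 * real D" and T: "n ^ (k + 1) \<le> 2 ^ T" and \<epsilon>: "\<epsilon> > 0"
  shows "measure_pmf.prob (random_hgraph k n p) {G. arr (edges G)} \<le>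
    3 / real n + real (M' + 1) * 2 ^ (2 ^ M') * real n powr (- \<epsilon>')"
proof -
  let ?P = "measure_pmf.prob (random_hgraph k n p)"
  let ?b = "real n powr (\<epsilon> / 2)"
  let ?w = "\<lambda>(S :: nat set set, d :: nat). p ^ card S * ?b ^ d"
  define I1 where "I1 = (SIGMA t:{..T}. {s \<in> reach K D t. snd s = D})"
  define I3 where "I3 = {Y. Y \<subseteq> K \<and> card (\<Union>Y) \<le> M' \<and> m * card (\<Union>Y) < card Y}"
  have K: "finite K" "\<And>e. e \<in> K \<Longrightarrow> card e = k"
    unfolding K_def by (rule finite_complete_edges) (simp add: complete_edges_def)
  have weight: "sum ?w (reach K D t) \<le> (1 / 2) ^ t * real n ^ k" if "t \<le> T" for t
    using reach_weight_le[OF n p c gap[unfolded M_def] dense[unfolded M_def] tree[unfolded M_def] that]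
    unfolding K_def by blast
  have w0: "?w s \<ge> 0" for s using p by (cases s) auto
  have b1: "?b \<ge> 1" using n \<epsilon> by (intro ge_one_powr_ge_zero) auto
  have finR: "finite (reach K D t)" for t by (rule finite_reach[OF K(1)])
  have RK: "fst s \<subseteq> K" if "s \<in> reach K D t" for s t
    using reach_invariant[OF K, of "fst s" "snd s" D t] that by simp
  have bD: "?b ^ D \<ge> real n ^ (k + 1)"
  proof -
    have "real n ^ (k + 1) = real n powr real (k + 1)" using n by (subst powr_realpow) auto
    also have "\<dots> \<le> real n powr (\<epsilon> / 2 * real D)" using n D by (intro powr_mono) auto
    also have "\<dots> = ?b ^ D" using n by (simp add: powr_powr flip: powr_realpow)
    finally show ?thesis .
  qed
  have "?P {G. arr (edges G)} \<le> ?P ({G. \<exists>i\<in>I1. fst (snd i) \<subseteq> edges G} \<union>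
      {G. \<exists>s\<in>reach K D T. fst s \<subseteq> edges G} \<union> {G. \<exists>Y\<in>I3. Y \<subseteq> edges G})"
  proof (rule measure_pmf.finite_measure_mono_AE)
    show "AE G in measure_pmf (random_hgraph k n p). G \<in> {G. arr (edges G)} \<longrightarrow>
        G \<in> {G. \<exists>i\<in>I1. fst (snd i) \<subseteq> edges G} \<union> {G. \<exists>s\<in>reach K D T. fst s \<subseteq> edges G} \<union>
          {G. \<exists>Y\<in>I3. Y \<subseteq> edges G}"
      unfolding AE_measure_pmf_iff
    proof (intro ballI impI)
      fix G assume G: "G \<in> set_pmf (random_hgraph k n p)" "G \<in> {G. arr (edges G)}"
      have "edges G \<subseteq> complete_edges k n" "arr (edges G)" using set_pmf_random_hgraph[OF G(1)] G(2) by auto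
      from arr_cases[OF densE this, of T D]
      show "G \<in> {G. \<exists>i\<in>I1. fst (snd i) \<subseteq> edges G} \<union> {G. \<exists>s\<in>reach K D T. fst s \<subseteq> edges G} \<union>
          {G. \<exists>Y\<in>I3. Y \<subseteq> edges G}"
        unfolding K_def[symmetric] M'_def[symmetric] I1_def[symmetric] I3_def[symmetric]
        by (simp add: case_prod_unfold disj_assoc)
    qed
  qed simp
  also have "\<dots> \<le> ?P {G. \<exists>i\<in>I1. fst (snd i) \<subseteq> edges G} + ?P {G. \<exists>s\<in>reach K D T. fst s \<subseteq> edges G} +
      ?P {G. \<exists>Y\<in>I3. Y \<subseteq> edges G}"
    by (intro order_trans[OF measure_Un_le] add_mono measure_Un_le) auto
  also have "\<dots> \<le> 2 / real n + 1 / real n + real (M' + 1) * 2 ^ (2 ^ M') * real n powr (- \<epsilon>')"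
  proof (intro add_mono)
    have "?P {G. \<exists>i\<in>I1. fst (snd i) \<subseteq> edges G} \<le> (\<Sum>i\<in>I1. p ^ card (fst (snd i)))"
    proof (rule prob_contains_some[OF _ _ p(1,2)])
      show "finite I1" using finR by (auto simp: I1_def)
      show "fst (snd i) \<subseteq> complete_edges k n" if "i \<in> I1" for i
        using that RK[of "snd i" "fst i"] unfolding K_def[symmetric] by (auto simp: I1_def)
    qed
    also have "\<dots> \<le> (\<Sum>i\<in>I1. ?w (snd i) / real n ^ (k + 1))"
    proof (rule sum_mono)
      fix i assume "i \<in> I1"
      then obtain t S where i: "i = (t, (S, D))" by (auto simp: I1_def)
      have "p ^ card S * real n ^ (k + 1) \<le> p ^ card S * ?b ^ D"
        using bD p by (intro mult_left_mono) auto
      then show "p ^ card (fst (snd i)) \<le> ?w (snd i) / real n ^ (k + 1)"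
        using n by (simp add: i pos_le_divide_eq)
    qed
    also have "\<dots> = (\<Sum>t\<le>T. \<Sum>s\<in>{s \<in> reach K D t. snd s = D}. ?w s / real n ^ (k + 1))"
      unfolding I1_def by (subst sum.Sigma) (use finR in \<open>auto simp: case_prod_unfold\<close>)
    also have "\<dots> \<le> (\<Sum>t\<le>T. (1 / 2) ^ t * (1 / real n))"
    proof (rule sum_mono)
      fix t assume t: "t \<in> {..T}"
      have "(\<Sum>s\<in>{s \<in> reach K D t. snd s = D}. ?w s / real n ^ (k + 1)) \<le>
          (\<Sum>s\<in>reach K D t. ?w s / real n ^ (k + 1))"
        using finR w0 by (intro sum_mono2 divide_nonneg_nonneg) auto
      also have "\<dots> = sum ?w (reach K D t) / real n ^ (k + 1)" by (simp add: sum_divide_distrib)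
      also have "\<dots> \<le> (1 / 2) ^ t * real n ^ k / real n ^ (k + 1)"
        using weight[of t] t by (intro divide_right_mono) auto
      also have "\<dots> = (1 / 2) ^ t * (1 / real n)" using n by (simp add: field_simps)
      finally show "(\<Sum>s\<in>{s \<in> reach K D t. snd s = D}. ?w s / real n ^ (k + 1)) \<le> (1 / 2) ^ t * (1 / real n)" .
    qed
    also have "\<dots> = (\<Sum>t\<le>T. (1 / 2) ^ t) * (1 / real n)" by (simp only: sum_distrib_right)
    also have "\<dots> \<le> 2 * (1 / real n)"
    proof (rule mult_right_mono)
      have "(\<Sum>t\<le>T. (1 / 2 :: real) ^ t) = 2 - (1 / 2) ^ T"
        by (induction T) auto
      then show "(\<Sum>t\<le>T. (1 / 2 :: real) ^ t) \<le> 2" by simp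
    qed simp
    finally show "?P {G. \<exists>i\<in>I1. fst (snd i) \<subseteq> edges G} \<le> 2 / real n" by simp
  next
    have "?P {G. \<exists>s\<in>reach K D T. fst s \<subseteq> edges G} \<le> (\<Sum>s\<in>reach K D T. p ^ card (fst s))"
      by (rule prob_contains_some) (use finR RK p in \<open>auto simp: K_def\<close>)
    also have "\<dots> \<le> sum ?w (reach K D T)"
    proof (rule sum_mono)
      fix s :: "nat set set \<times> nat"
      have "p ^ card (fst s) * 1 \<le> p ^ card (fst s) * ?b ^ snd s"
        using p b1 by (intro mult_left_mono one_le_power) auto
      then show "p ^ card (fst s) \<le> ?w s" by (simp add: case_prod_unfold)
    qed
    also have "\<dots> \<le> (1 / 2) ^ T * real n ^ k" by (rule weight) simp
    also have "\<dots> \<le> 1 / real n"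
    proof -
      have "real n ^ (k + 1) \<le> 2 ^ T" using of_nat_mono[OF T, where 'a = real] by simp
      then show ?thesis using n by (simp add: field_simps)
    qed
    finally show "?P {G. \<exists>s\<in>reach K D T. fst s \<subseteq> edges G} \<le> 1 / real n" .
  next
    have finI3: "finite I3"
      by (rule finite_subset[of _ "Pow K"]) (use K in \<open>auto simp: I3_def\<close>)
    have "?P {G. \<exists>Y\<in>I3. Y \<subseteq> edges G} \<le> (\<Sum>Y\<in>I3. p ^ card Y)"
      by (rule prob_contains_some) (use finI3 p in \<open>auto simp: I3_def K_def\<close>)
    also have "\<dots> = (\<Sum>Y\<in>I3. p ^ card (Y - {}))" by simp
    \<comment> \<open>Nothing is explored here: with \<open>S\<close> and \<open>V\<close> empty all
      vertices are new, and the empty set is the only trace.\<close>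
    also have "\<dots> \<le> real (card {{} :: nat set}) * (real (M' + 1) * 2 ^ (2 ^ M')) * real n powr (- \<epsilon>')"
    proof (rule sum_extensions_le[OF n p(1) _ finI3, where V = "{}"])
      fix Y assume "Y \<in> I3"
      then have Y: "Y \<subseteq> K" "card (\<Union>Y) \<le> M'" "m * card (\<Union>Y) < card Y" by (auto simp: I3_def)
      have UY: "\<Union>Y \<subseteq> {1..n}" using Y(1) unfolding K_def complete_edges_def by blast
      have "card Y \<le> 2 ^ card (\<Union>Y)" by (rule card_edges_le[OF finite_subset_bounded[OF UY]])
      also have "\<dots> \<le> 2 ^ M'" using Y by simp
      finally have a: "card Y \<le> 2 ^ M'" .
      have "real (card Y) > 0" using Y(3) m_pos by (smt (verit) mult_nonneg_nonneg of_nat_0_le_iff)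
      then have a1: "card Y \<ge> 1" by simp
      have "p ^ card Y * real n ^ card (\<Union>Y) \<le> c * real n powr (real (card (\<Union>Y)) - real (card Y) / m)"
        by (rule power_density_bound[OF n p(1,3) c a1 m_pos])
      also have "\<dots> \<le> 1 * real n powr (- \<epsilon>')"
        using gap'[OF a Y(2,3)] n c by (intro mult_mono powr_mono) auto
      finally show "\<Union>Y \<subseteq> {1..n} \<and> card (\<Union>Y) \<le> M' \<and> \<Union>Y \<inter> {} \<in> {{}} \<and>
          p ^ card (Y - {}) * real n ^ card (\<Union>Y - {}) \<le> real n powr (- \<epsilon>')"
        using UY Y by simp
    qed auto
    finally show "?P {G. \<exists>Y\<in>I3. Y \<subseteq> edges G} \<le> real (M' + 1) * 2 ^ (2 ^ M') * real n powr (- \<epsilon>')" by simp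
  qed
  finally show ?thesis by simp
qed

lemma prob_arr_tendsto_0:
  assumes densE: "\<And>E. finite E \<Longrightarrow> (\<And>e. e \<in> E \<Longrightarrow> card e = k) \<Longrightarrow> arr E \<Longrightarrow> \<exists>Y\<subseteq>E. m * card (\<Union>Y) < card Y"
  shows "\<exists>c>0. \<forall>p :: nat \<Rightarrow> real.
    (\<forall>n\<ge>1. 0 \<le> p n \<and> p n \<le> 1 \<and> p n \<le> c * real n powr (- 1 / m)) \<longrightarrow>
    (\<lambda>n. measure_pmf.prob (random_hgraph k n (p n)) {G. arr (edges G)}) \<longlonglongrightarrow> 0"
proof -
  define M where "M = max_verts"
  obtain \<epsilon> where \<epsilon>: "\<epsilon> > 0"
    and gap: "\<And>(a :: nat) (j :: nat). a \<le> (2 :: nat) ^ M \<Longrightarrow> j \<le> M \<Longrightarrow> m * j < a \<Longrightarrow> \<epsilon> \<le> a / m - j"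
    using positive_gap[OF m_pos, of "2 ^ M" M] by blast
  \<comment> \<open>With this \<open>D\<close>, the collected rewards amount to at least
    \<open>n ^ (k + 1)\<close>, one factor \<open>n\<close> more than the initial weight.\<close>
  obtain D :: nat where "real (k + 1) * (2 / \<epsilon>) \<le> real D" using real_arch_simple by blast
  then have D: "real (k + 1) \<le> \<epsilon> / 2 * real D" using \<epsilon> by (simp add: field_simps)
  define M' where "M' = k + (M + 1) * D * M"
  obtain \<epsilon>' where \<epsilon>': "\<epsilon>' > 0"
    and gap': "\<And>(a :: nat) (j :: nat). a \<le> (2 :: nat) ^ M' \<Longrightarrow> j \<le> M' \<Longrightarrow> m * j < a \<Longrightarrow> \<epsilon>' \<le> a / m - j"
    using positive_gap[OF m_pos, of "2 ^ M'" M'] by blast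
  define G :: real where "G = real (M + 1) * 2 ^ (2 ^ M)"
  have G: "G > 0" by (simp add: G_def)
  define A :: real where "A = 2 ^ M' * 2 ^ k * G"
  have A1: "A \<ge> 1"
    unfolding A_def G_def by (intro mult_ge1_I one_le_power) auto
  \<comment> \<open>This brings the tree contribution to 1/4. \<open>A\<close> depends on
    \<open>D\<close> through \<open>M'\<close>, but not on \<open>n\<close> or the number of
    steps.\<close>
  define c where "c = 1 / (4 * A)"
  have c: "0 < c" "c \<le> 1" using A1 by (auto simp: c_def field_simps)
  have tree: "real (2 ^ (k + (M + 1) * D * M) * 2 ^ k) * (real (M + 1) * 2 ^ (2 ^ M)) * c \<le> 1 / 4"
  proof -
    have "real (2 ^ (k + (M + 1) * D * M) * 2 ^ k) * (real (M + 1) * 2 ^ (2 ^ M)) = A"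
      unfolding A_def G_def M'_def by (simp only: of_nat_mult of_nat_power of_nat_numeral)
    then show ?thesis using A1 by (simp add: c_def)
  qed
  \<comment> \<open>This many halvings bring \<open>n ^ k\<close> below \<open>1 / n\<close>, while
    logarithmic growth keeps the explored sets small enough for the bound on dense
    extensions.\<close>
  define T where "T = (\<lambda>n. nat \<lceil>(real k + 1) * log 2 (real n)\<rceil>)"
  have T: "n ^ (k + 1) \<le> 2 ^ T n" if "n \<ge> 1" for n
  proof -
    have "real (n ^ (k + 1)) = real n powr real (k + 1)" using that by (subst powr_realpow) auto
    also have "\<dots> = 2 powr (real (k + 1) * log 2 (real n))"
    proof -
      have "real n powr real (k + 1) = (2 powr log 2 (real n)) powr real (k + 1)" using that by simp
      then show ?thesis by (simp only: powr_powr mult.commute)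
    qed
    also have "\<dots> \<le> 2 powr real (T n)"
      unfolding T_def by (intro powr_mono) (auto intro: real_nat_ceiling_ge simp: add.commute)
    also have "\<dots> = real (2 ^ T n)" by (simp add: powr_realpow)
    finally show ?thesis by (simp only: of_nat_le_iff)
  qed
  \<comment> \<open>\<open>b\<close> absorbs the rounding in \<open>T\<close>, and the summand 1 in
    \<open>a\<close> ensures \<open>a > 0\<close>.\<close>
  define a b where "a = (real k + 1) * real M + 1" and "b = real k + real M + 1"
  have Tle: "real (k + T n * M + 1) \<le> a * log 2 (real n) + b" if n: "n \<ge> 1" for n
  proof -
    have l: "log 2 (real n) \<ge> 0" using n by simp
    then have "0 \<le> (real k + 1) * log 2 (real n)" by simp
    then have "0 \<le> \<lceil>(real k + 1) * log 2 (real n)\<rceil>" by linarith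
    then have "real (T n) \<le> (real k + 1) * log 2 (real n) + 1"
      unfolding T_def using of_int_ceiling_le_add_one[of "(real k + 1) * log 2 (real n)"] by simp
    then have "real (T n) * real M \<le> ((real k + 1) * log 2 (real n) + 1) * real M"
      by (rule mult_right_mono) simp
    then show ?thesis using l by (simp add: a_def b_def algebra_simps)
  qed
  have ev: "\<forall>\<^sub>F n in sequentially. real n powr (\<epsilon> / 2) * (real ((M + 1) * (k + T n * M + 1) ^ M) *
      (real (M + 1) * 2 ^ (2 ^ M)) * real n powr (- \<epsilon>)) \<le> 1 / 4"
  proof -
    have "(\<lambda>n. (real (M + 1) * G) * (a * log 2 (real n) + b) ^ M * real n powr (- (\<epsilon> / 2))) \<longlonglongrightarrow> 0"
      by (rule polylog_times_powr_tendsto_0) (use \<epsilon> in \<open>auto simp: a_def add_nonneg_pos\<close>)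
    then have "\<forall>\<^sub>F n in sequentially. (real (M + 1) * G) * (a * log 2 (real n) + b) ^ M * real n powr (- (\<epsilon> / 2)) < 1 / 4"
      by (rule order_tendstoD) simp
    then show ?thesis
      using eventually_ge_at_top[of 1]
    proof eventually_elim
      case (elim n)
      have "real n powr (\<epsilon> / 2) * (real ((M + 1) * (k + T n * M + 1) ^ M) *
        (real (M + 1) * 2 ^ (2 ^ M)) * real n powr (- \<epsilon>)) =
        (real (M + 1) * G) * real (k + T n * M + 1) ^ M * (real n powr (\<epsilon> / 2) * real n powr (- \<epsilon>))"
        unfolding G_def of_nat_mult of_nat_power by (simp only: mult_ac)
      also have "real n powr (\<epsilon> / 2) * real n powr (- \<epsilon>) = real n powr (- (\<epsilon> / 2))"
        by (simp flip: powr_add)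
      also have "(real (M + 1) * G) * real (k + T n * M + 1) ^ M * real n powr (- (\<epsilon> / 2)) \<le>
        (real (M + 1) * G) * (a * log 2 (real n) + b) ^ M * real n powr (- (\<epsilon> / 2))"
        using G Tle[OF elim(2)] by (intro mult_right_mono mult_left_mono power_mono) auto
      finally show ?case using elim by linarith
    qed
  qed
  show ?thesis
  proof (intro exI[of _ c] conjI allI impI)
    fix p :: "nat \<Rightarrow> real"
    assume p: "\<forall>n\<ge>1. 0 \<le> p n \<and> p n \<le> 1 \<and> p n \<le> c * real n powr (- 1 / m)"
    show "(\<lambda>n. measure_pmf.prob (random_hgraph k n (p n)) {G. arr (edges G)}) \<longlonglongrightarrow> 0"
    proof (rule tendsto_sandwich[OF _ _ tendsto_const])
      show "\<forall>\<^sub>F n in sequentially. measure_pmf.prob (random_hgraph k n (p n)) {G. arr (edges G)} \<le>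
        3 / real n + real (M' + 1) * 2 ^ (2 ^ M') * real n powr (- \<epsilon>')"
        using ev eventually_ge_at_top[of 1]
      proof eventually_elim
        case (elim n)
        have pn: "0 \<le> p n" "p n \<le> 1" "p n \<le> c * real n powr (- 1 / m)" using p elim(2) by auto
        show ?case
          unfolding M'_def M_def
          by (rule prob_arr_le[OF densE elim(2) pn c gap[unfolded M_def] gap'[unfolded M'_def M_def]
              elim(1)[unfolded M_def] tree[unfolded M_def] D T[OF elim(2)] \<epsilon>])
      qed
      show "(\<lambda>n. 3 / real n + real (M' + 1) * 2 ^ (2 ^ M') * real n powr (- \<epsilon>')) \<longlonglongrightarrow> 0"
      proof -
        have "(\<lambda>n. 3 / real n) \<longlonglongrightarrow> 0" by real_asymp
        moreover have "(\<lambda>n. real n powr (- \<epsilon>')) \<longlonglongrightarrow> 0" using \<epsilon>' by real_asymp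
        then have "(\<lambda>n. real (M' + 1) * 2 ^ (2 ^ M') * real n powr (- \<epsilon>')) \<longlonglongrightarrow> 0"
          by (rule tendsto_mult_right_zero)
        ultimately show ?thesis using tendsto_add by fastforce
      qed
    qed simp
  qed (rule c)
qed

end

section \<open>Copies of strictly balanced hypergraphs\<close>

lemma uniform_edges_subset: "uniform_hgraph k F \<Longrightarrow> edges F \<subseteq> Pow (verts F)"
  by (auto simp: uniform_hgraph_def)

lemma uniform_finite_verts: "uniform_hgraph k F \<Longrightarrow> finite (verts F)"
  by (simp add: uniform_hgraph_def)

lemma uniform_finite_edges: "uniform_hgraph k F \<Longrightarrow> finite (edges F)"
  using finite_subset[OF uniform_edges_subset] uniform_finite_verts by blast

lemma finite_subhgraphs:
  assumes "finite (verts F)" "finite (edges F)"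
  shows "finite {H. subhgraph H F}"
  by (rule finite_subset[of _ "Pow (verts F) \<times> Pow (edges F)"])
    (use assms in \<open>auto simp: subhgraph_def\<close>)

text \<open>The density hypotheses speak of subhypergraphs of \<open>F\<close>; pulling back along
  the isomorphism makes them available for copies. By the last conclusion proper subhypergraphs stay
  proper, so strict inequalities carry over.\<close>

lemma hgraph_iso_subhgraph:
  assumes iso: "hgraph_iso F C" and F: "edges F \<subseteq> Pow (verts F)" and H: "subhgraph H C"
  obtains H' where "subhgraph H' F" "card (verts H') = card (verts H)" "card (edges H') = card (edges H)"
    "H' = F \<Longrightarrow> H = C"
proof -
  obtain f where f: "bij_betw f (verts F) (verts C)" "(\<lambda>e. f ` e) ` edges F = edges C"
    using iso by (auto simp: hgraph_iso_def)
  define H' where "H' = ({x \<in> verts F. f x \<in> verts H}, {e \<in> edges F. f ` e \<in> edges H})"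
  have inj: "inj_on f (verts F)" using f by (auto simp: bij_betw_def)
  have imV: "f ` verts H' = verts H"
    using f H unfolding H'_def subhgraph_def bij_betw_def by (auto simp: image_iff)
  have imE: "(\<lambda>e. f ` e) ` edges H' = edges H"
  proof
    show "edges H \<subseteq> (\<lambda>e. f ` e) ` edges H'"
    proof
      fix e assume e: "e \<in> edges H"
      then have "e \<in> (\<lambda>e. f ` e) ` edges F" using f(2) H by (auto simp: subhgraph_def)
      then obtain e' where "e' \<in> edges F" "e = f ` e'" by auto
      then show "e \<in> (\<lambda>e. f ` e) ` edges H'" using e by (auto simp: H'_def)
    qed
  qed (auto simp: H'_def)
  have "inj_on (\<lambda>e. f ` e) (Pow (verts F))" using inj by (rule inj_on_image_Pow)
  then have injE: "inj_on (\<lambda>e. f ` e) (edges H')"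
    by (rule inj_on_subset) (use F in \<open>auto simp: H'_def\<close>)
  have "subhgraph H' F"
    unfolding subhgraph_def
  proof (intro conjI ballI)
    fix e assume "e \<in> edges H'"
    then have "e \<in> edges F" "f ` e \<in> edges H" by (auto simp: H'_def)
    then have "e \<subseteq> verts F" "f ` e \<subseteq> verts H" using F H by (auto simp: subhgraph_def)
    then show "e \<subseteq> verts H'" by (auto simp: H'_def)
  qed (auto simp: H'_def)
  moreover have "card (verts H') = card (verts H)"
    unfolding imV[symmetric] by (rule card_image[symmetric], rule inj_on_subset[OF inj]) (auto simp: H'_def)
  moreover have "card (edges H') = card (edges H)"
    unfolding imE[symmetric] by (rule card_image[symmetric, OF injE])
  moreover have "H = C" if "H' = F"
    using imV imE f that by (auto simp: bij_betw_def prod_eq_iff)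
  ultimately show ?thesis using that by blast
qed

lemma hgraph_iso_card:
  assumes "hgraph_iso F C" "edges F \<subseteq> Pow (verts F)"
  shows "card (verts C) = card (verts F)" "card (edges C) = card (edges F)"
proof -
  obtain f where f: "bij_betw f (verts F) (verts C)" "(\<lambda>e. f ` e) ` edges F = edges C"
    using assms by (auto simp: hgraph_iso_def)
  show "card (verts C) = card (verts F)" using f bij_betw_same_card by metis
  have "inj_on (\<lambda>e. f ` e) (Pow (verts F))" using f by (auto simp: bij_betw_def intro: inj_on_image_Pow)
  then have "inj_on (\<lambda>e. f ` e) (edges F)" by (rule inj_on_subset) (use assms in auto)
  then show "card (edges C) = card (edges F)" unfolding f(2)[symmetric] by (rule card_image)
qed

lemma hgraph_iso_uniform:
  assumes "hgraph_iso F C" "uniform_hgraph k F"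
  shows "uniform_hgraph k C"
proof -
  obtain f where f: "bij_betw f (verts F) (verts C)" "(\<lambda>e. f ` e) ` edges F = edges C"
    using assms by (auto simp: hgraph_iso_def)
  have fin: "finite (verts C)" using f(1) assms(2) bij_betw_finite by (auto simp: uniform_hgraph_def)
  have "e \<subseteq> verts C \<and> card e = k" if e: "e \<in> edges C" for e
  proof -
    obtain e' where e': "e' \<in> edges F" "e = f ` e'" using e f(2) by blast
    have s: "e' \<subseteq> verts F" "card e' = k" using e' assms(2) by (auto simp: uniform_hgraph_def)
    have "inj_on f e'" using f(1) s by (auto simp: bij_betw_def intro: inj_on_subset)
    then have "card e = k" using e' s by (simp add: card_image)
    moreover have "e \<subseteq> verts C" using e' s f(1) by (auto simp: bij_betw_def)
    ultimately show ?thesis by simp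
  qed
  then show ?thesis using fin by (auto simp: uniform_hgraph_def)
qed

lemma hgraph_iso_verts_eq_Union:
  assumes "hgraph_iso F C" "verts F = \<Union>(edges F)"
  shows "verts C = \<Union>(edges C)"
proof -
  obtain f where f: "bij_betw f (verts F) (verts C)" "(\<lambda>e. f ` e) ` edges F = edges C"
    using assms by (auto simp: hgraph_iso_def)
  have "verts C = f ` verts F" using f(1) by (simp add: bij_betw_def)
  also have "\<dots> = \<Union>((\<lambda>e. f ` e) ` edges F)" unfolding assms(2) by (rule image_Union)
  finally show ?thesis unfolding f(2) .
qed

section \<open>Densities of subhypergraphs under strict balancedness\<close>

lemma subhgraph_density_le:
  assumes F: "uniform_hgraph k F" and bal: "strictly_k_balanced k F"
    and H: "subhgraph H F" "edges H \<noteq> {}"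
  shows "ne H - 1 \<le> m_k k F * (nv H - real k)"
    and "H \<noteq> F \<Longrightarrow> card (verts H) > k \<Longrightarrow> ne H - 1 < m_k k F * (nv H - real k)"
proof -
  have fin: "finite (verts H)" "finite (edges H)"
    using H(1) uniform_finite_verts[OF F] uniform_finite_edges[OF F]
    by (auto simp: subhgraph_def intro: finite_subset)
  have "finite {H. subhgraph H F}"
    by (rule finite_subhgraphs[OF uniform_finite_verts[OF F] uniform_finite_edges[OF F]])
  then have "finite (d_k k ` {H. subhgraph H F})" by (rule finite_imageI)
  then have "finite {d_k k H |H. subhgraph H F}" by (rule finite_subset[rotated]) blast
  then have le: "d_k k H \<le> m_k k F" unfolding m_k_def by (rule Max_ge) (use H in blast)
  have less: "d_k k H < m_k k F" if "H \<noteq> F"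
    using bal that H(1) unfolding strictly_k_balanced_def proper_subhgraph_def by metis
  have edge: "e \<subseteq> verts H" "card e = k" if "e \<in> edges H" for e
    using that H F by (auto simp: subhgraph_def uniform_hgraph_def)
  have e0: "card (edges H) \<noteq> 0" using H fin by simp
  obtain e where e: "e \<in> edges H" using H by auto
  have kle: "k \<le> card (verts H)" using card_mono[OF fin(1) edge(1)[OF e]] edge(2)[OF e] by simp
  have dk: "d_k k H = (ne H - 1) / (nv H - real k)" if "card (verts H) > k"
    using that e0 by (simp add: d_k_def)
  show "ne H - 1 \<le> m_k k F * (nv H - real k)"
  proof (cases "card (verts H) > k")
    case True
    then show ?thesis using le dk by (simp add: field_simps)
  next
    case False
    then have c: "card (verts H) = k" using kle by simp
    \<comment> \<open>On exactly \<open>k\<close> vertices the quotient degenerates. Only one edge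
      fits there, so the multiplied-out inequality reads 0 \<le> 0.\<close>
    have "edges H \<subseteq> {verts H}"
    proof
      fix e assume "e \<in> edges H"
      then show "e \<in> {verts H}" using edge[of e] card_subset_eq[OF fin(1), of e] c by simp
    qed
    then have "card (edges H) \<le> 1" using card_mono[of "{verts H}" "edges H"] by simp
    then show ?thesis using c by simp
  qed
  show "ne H - 1 < m_k k F * (nv H - real k)" if "H \<noteq> F" "card (verts H) > k"
    using less[OF that(1)] dk[OF that(2)] that(2) by (simp add: field_simps)
qed

lemma card_verts_gt_uniform:
  assumes F: "uniform_hgraph k F" and "card (edges F) \<ge> 2"
  shows "card (verts F) > k"
proof (rule ccontr)
  assume "\<not> card (verts F) > k"
  obtain e where "e \<in> edges F" using assms by fastforce
  have fin: "finite (verts F)" using F by (simp add: uniform_hgraph_def)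
  have edge: "e \<subseteq> verts F" "card e = k" if "e \<in> edges F" for e
    using that F by (auto simp: uniform_hgraph_def)
  have "edges F \<subseteq> {verts F}"
  proof
    fix e assume e: "e \<in> edges F"
    have "card e \<le> card (verts F)" using edge[OF e] fin card_mono by blast
    then have "card e = card (verts F)" using \<open>\<not> card (verts F) > k\<close> edge[OF e] by simp
    then show "e \<in> {verts F}" using edge[OF e] card_subset_eq[OF fin] by simp
  qed
  then show False using card_mono[of "{verts F}" "edges F"] assms by simp
qed

lemma strictly_balanced_density:
  assumes F: "uniform_hgraph k F" and bal: "strictly_k_balanced k F" and e: "card (edges F) \<ge> 2"
  shows "ne F - 1 = m_k k F * (nv F - real k)"
proof -
  have v: "card (verts F) > k" by (rule card_verts_gt_uniform[OF F e])
  have "m_k k F = d_k k F" using bal by (simp add: strictly_k_balanced_def)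
  also have "\<dots> = (ne F - 1) / (nv F - real k)" using e v by (simp add: d_k_def)
  finally show ?thesis using v by simp
qed

text \<open>Dropping isolated vertices would leave a proper subhypergraph with all the edges, hence
  at least as dense. This is what allows a copy to be described by its edge set.\<close>

lemma strictly_balanced_verts_eq_Union:
  assumes F: "uniform_hgraph k F" and bal: "strictly_k_balanced k F"
    and e: "card (edges F) \<ge> 2" and m1: "m_k k F \<ge> 1"
  shows "verts F = \<Union>(edges F)"
proof (rule ccontr)
  assume ne: "verts F \<noteq> \<Union>(edges F)"
  let ?H = "(\<Union>(edges F), edges F)"
  have sub: "\<Union>(edges F) \<subseteq> verts F" using F by (auto simp: uniform_hgraph_def)
  have fin: "finite (verts F)" using F by (simp add: uniform_hgraph_def)
  have H: "subhgraph ?H F" "?H \<noteq> F" "edges ?H \<noteq> {}" using sub ne e by (auto simp: subhgraph_def prod_eq_iff)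
  have "uniform_hgraph k ?H" using F sub fin by (auto simp: uniform_hgraph_def intro: finite_subset)
  then have "card (verts ?H) > k" by (rule card_verts_gt_uniform) (use e in simp)
  then have "ne ?H - 1 < m_k k F * (nv ?H - real k)"
    by (rule subhgraph_density_le(2)[OF F bal H(1,3,2)])
  also have "\<dots> \<le> m_k k F * (nv F - real k)"
    using card_mono[OF fin sub] m1 by (intro mult_left_mono) auto
  also have "\<dots> = ne F - 1" using strictly_balanced_density[OF F bal e] by simp
  finally show False by simp
qed

text \<open>For \<open>k = 0\<close> there is at most one edge. For \<open>k = 1\<close> the edges
  are distinct singletons, so \<open>d_k k F \<le> 1\<close>; but a single edge already has density
  1, against strictness.\<close>

lemma strictly_balanced_uniformity:
  assumes F: "uniform_hgraph k F" and bal: "strictly_k_balanced k F" and e: "card (edges F) \<ge> 3"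
  shows "k \<ge> 2"
proof (rule ccontr)
  assume "\<not> k \<ge> 2"
  have fin: "finite (verts F)" using F by (simp add: uniform_hgraph_def)
  have edge: "x \<subseteq> verts F" "card x = k" "finite x" if "x \<in> edges F" for x
    using that F by (auto simp: uniform_hgraph_def intro: finite_subset)
  have "k = 1"
  proof (rule ccontr)
    assume "k \<noteq> 1"
    then have "k = 0" using \<open>\<not> k \<ge> 2\<close> by simp
    then have "x = {}" if "x \<in> edges F" for x using edge(2,3)[OF that] by simp
    then have "edges F \<subseteq> {{}}" by blast
    then show False using card_mono[of "{{}}" "edges F"] e by simp
  qed
  have "edges F \<subseteq> (\<lambda>x. {x}) ` verts F"
  proof
    fix x assume x: "x \<in> edges F"
    then obtain y where "x = {y}" using edge(2)[OF x] \<open>k = 1\<close> card_1_singletonE by metis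
    then show "x \<in> (\<lambda>x. {x}) ` verts F" using edge(1)[OF x] by auto
  qed
  then have "card (edges F) \<le> card ((\<lambda>x. {x}) ` verts F)" using fin by (intro card_mono) auto
  also have "\<dots> \<le> card (verts F)" by (rule card_image_le[OF fin])
  finally have "d_k k F \<le> 1" using e \<open>k = 1\<close> by (simp add: d_k_def field_simps)
  moreover obtain x where x: "x \<in> edges F" using e by fastforce
  have "proper_subhgraph (x, {x}) F"
    using x edge(1)[OF x] e by (auto simp: proper_subhgraph_def subhgraph_def)
  then have "d_k k (x, {x}) < d_k k F" using bal unfolding strictly_k_balanced_def by blast
  moreover have "d_k k (x, {x}) = 1" using edge(2)[OF x] \<open>k = 1\<close> by (simp add: d_k_def)
  ultimately show False by simp
qed

definition copies :: "'a hgraph \<Rightarrow> nat set set set" where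
  "copies F = {P. hgraph_iso F (\<Union>P, P)}"

lemma copies_balanced_family:
  assumes F: "uniform_hgraph k F" and bal: "strictly_k_balanced k F" and k: "k \<ge> 1"
    and e: "card (edges F) \<ge> 2" and m1: "m_k k F \<ge> 1"
  shows "balanced_family k (card (edges F)) (card (verts F)) (m_k k F) (copies F)"
proof
  fix P assume "P \<in> copies F"
  then have iso: "hgraph_iso F (\<Union>P, P)" by (simp add: copies_def)
  have FP: "edges F \<subseteq> Pow (verts F)" by (rule uniform_edges_subset[OF F])
  have un: "uniform_hgraph k (\<Union>P, P)" by (rule hgraph_iso_uniform[OF iso F])
  show "card x = k" if "x \<in> P" for x using un that by (auto simp: uniform_hgraph_def)
  show "finite P" using uniform_finite_edges[OF un] by simp
  show "card P = card (edges F)" "card (\<Union>P) = card (verts F)" using hgraph_iso_card[OF iso FP] by auto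
  show "real (card A) - 1 \<le> m_k k F * (real (card W) - real k)"
    if "A \<subseteq> P" "A \<noteq> {}" "\<Union>A \<subseteq> W" "W \<subseteq> \<Union>P" for A W
  proof -
    have fin: "finite A" using that(1) \<open>finite P\<close> by (auto intro: finite_subset)
    have "subhgraph (W, A) (\<Union>P, P)" using that by (auto simp: subhgraph_def)
    then obtain H where H: "subhgraph H F" "card (verts H) = card W" "card (edges H) = card A"
      by (rule hgraph_iso_subhgraph[OF iso FP]) auto
    have "card (edges H) \<noteq> 0" using H(3) that fin by simp
    then have "edges H \<noteq> {}" by auto
    then show ?thesis using subhgraph_density_le(1)[OF F bal H(1)] H by simp
  qed
  show "real (card A) - 1 < m_k k F * (real (card W) - real k)"
    if "A \<subset> P" "A \<noteq> {}" "\<Union>A \<subseteq> W" "W \<subseteq> \<Union>P" "k < card W" for A W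
  proof -
    have fin: "finite A" using that(1) \<open>finite P\<close> by (auto intro: finite_subset)
    have "subhgraph (W, A) (\<Union>P, P)" using that by (auto simp: subhgraph_def)
    then obtain H where H: "subhgraph H F" "card (verts H) = card W" "card (edges H) = card A"
      "H = F \<Longrightarrow> (W, A) = (\<Union>P, P)"
      by (rule hgraph_iso_subhgraph[OF iso FP]) auto
    have "card (edges H) \<noteq> 0" using H(3) that fin by simp
    then have "edges H \<noteq> {}" by auto
    moreover have "H \<noteq> F" using H(4) that by auto
    ultimately show ?thesis using subhgraph_density_le(2)[OF F bal H(1)] H that by simp
  qed
next
  show "ne F - 1 = m_k k F * (nv F - real k)" by (rule strictly_balanced_density[OF F bal e])
qed (use k m1 in auto)

text \<open>Strictness leaves \<open>F1\<close> itself as the only maximiser. Multiplying out is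
  harmless, because a subhypergraph with an edge has at least \<open>k\<close> vertices and
  \<open>1 / m_k k F2\<close> keeps the denominator positive.\<close>

lemma strictly_balanced_wrt_density:
  assumes F1: "uniform_hgraph k F1" "edges F1 \<noteq> {}" and m2: "m_k k F2 > 0"
    and bal: "strictly_balanced_wrt k F1 F2"
  shows "m_k2 k F1 F2 > 0"
    and "ne F1 = m_k2 k F1 F2 * (nv F1 - real k + 1 / m_k k F2)"
    and "\<And>H. proper_subhgraph H F1 \<Longrightarrow> edges H \<noteq> {} \<Longrightarrow> ne H < m_k2 k F1 F2 * (nv H - real k + 1 / m_k k F2)"
proof -
  let ?D = "{d_k2 k H F2 |H. subhgraph H F1 \<and> card (edges H) \<ge> 1}"
  have "finite {H. subhgraph H F1}"
    by (rule finite_subhgraphs[OF uniform_finite_verts[OF F1(1)] uniform_finite_edges[OF F1(1)]])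
  then have "finite ((\<lambda>H. d_k2 k H F2) ` {H. subhgraph H F1})" by (rule finite_imageI)
  then have finD: "finite ?D" by (rule finite_subset[rotated]) blast
  have sF1: "subhgraph F1 F1" using F1 by (auto simp: subhgraph_def uniform_hgraph_def)
  have cF1: "card (edges F1) \<ge> 1"
    using F1 uniform_finite_edges[OF F1(1)] by (simp add: Suc_le_eq card_gt_0_iff)
  have "m_k2 k F1 F2 \<in> ?D" unfolding m_k2_def by (rule Max_in[OF finD]) (use sF1 cF1 in blast)
  then obtain H where H: "subhgraph H F1" "card (edges H) \<ge> 1" "d_k2 k H F2 = m_k2 k F1 F2" by auto
  then have "H = F1" using bal unfolding strictly_balanced_wrt_def proper_subhgraph_def by blast
  then have m: "m_k2 k F1 F2 = d_k2 k F1 F2" using H by simp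
  have den: "nv H - real k + 1 / m_k k F2 > 0" if H: "subhgraph H F1" "edges H \<noteq> {}" for H
  proof -
    obtain e where e: "e \<in> edges H" using H(2) by blast
    have "e \<subseteq> verts H" "card e = k" "finite (verts H)"
      using H(1) e F1 by (auto simp: subhgraph_def uniform_hgraph_def intro: finite_subset)
    then have "k \<le> card (verts H)" using card_mono by fastforce
    then show ?thesis using m2 by (simp add: add_nonneg_pos)
  qed
  have den1: "nv F1 - real k + 1 / m_k k F2 > 0" by (rule den[OF sF1 F1(2)])
  show "m_k2 k F1 F2 > 0" unfolding m d_k2_def using den1 cF1 by simp
  show "ne F1 = m_k2 k F1 F2 * (nv F1 - real k + 1 / m_k k F2)" unfolding m d_k2_def using den1 by simp
  fix H assume H: "proper_subhgraph H F1" "edges H \<noteq> {}"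
  have sH: "subhgraph H F1" using H by (simp add: proper_subhgraph_def)
  have "finite (edges H)" using sH uniform_finite_edges[OF F1(1)] by (auto simp: subhgraph_def intro: finite_subset)
  then have cH: "card (edges H) \<ge> 1" using H by (simp add: Suc_le_eq card_gt_0_iff)
  have "d_k2 k H F2 \<le> m_k2 k F1 F2" unfolding m_k2_def by (rule Max_ge[OF finD]) (use sH cH in blast)
  moreover have "d_k2 k H F2 \<noteq> m_k2 k F1 F2" using bal H cH unfolding strictly_balanced_wrt_def by blast
  ultimately have "d_k2 k H F2 < m_k2 k F1 F2" by simp
  then show "ne H < m_k2 k F1 F2 * (nv H - real k + 1 / m_k k F2)"
    unfolding d_k2_def using den[OF sH H(2)] by (simp add: pos_divide_less_eq)
qed

text \<open>The constant \<open>- k + 1 / m_k k F2\<close> occurs in the equality for the whole copy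
  and in the strict inequality for its old part, and cancels on subtraction, leaving new edges
  against new vertices. The old part receives all vertices in
  \<open>\<Union>P \<inter> \<Union>S\<close>, even those in no common edge.\<close>

lemma crossing_copy_density:
  assumes F1: "uniform_hgraph k F1" "edges F1 \<noteq> {}" and m2: "m_k k F2 > 0"
    and bal: "strictly_balanced_wrt k F1 F2"
    and P: "P \<in> copies F1" and S: "P \<inter> S \<noteq> {}" "\<not> P \<subseteq> S"
  shows "m_k2 k F1 F2 * card (\<Union>P - \<Union>S) < card (P - S)"
proof -
  let ?m = "m_k2 k F1 F2"
  have iso: "hgraph_iso F1 (\<Union>P, P)" using P by (simp add: copies_def)
  have FP: "edges F1 \<subseteq> Pow (verts F1)" by (rule uniform_edges_subset[OF F1(1)])
  have un: "uniform_hgraph k (\<Union>P, P)" by (rule hgraph_iso_uniform[OF iso F1(1)])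
  have fin: "finite P" "finite (\<Union>P)" using un uniform_finite_edges[OF un] by (auto simp: uniform_hgraph_def)
  let ?H = "(\<Union>P \<inter> \<Union>S, P \<inter> S)"
  have "subhgraph ?H (\<Union>P, P)" by (auto simp: subhgraph_def)
  then obtain H where H: "subhgraph H F1" "card (verts H) = card (\<Union>P \<inter> \<Union>S)" "card (edges H) = card (P \<inter> S)"
    "H = F1 \<Longrightarrow> ?H = (\<Union>P, P)"
    by (rule hgraph_iso_subhgraph[OF iso FP]) auto
  have "card (edges H) \<noteq> 0" using H(3) S fin by simp
  then have "edges H \<noteq> {}" by auto
  moreover have "proper_subhgraph H F1" using H(1,4) S by (auto simp: proper_subhgraph_def)
  ultimately have "real (card (P \<inter> S)) < ?m * (real (card (\<Union>P \<inter> \<Union>S)) - real k + 1 / m_k k F2)"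
    using strictly_balanced_wrt_density(3)[OF F1 m2 bal] H by metis
  moreover have "real (card P) = ?m * (real (card (\<Union>P)) - real k + 1 / m_k k F2)"
    using strictly_balanced_wrt_density(2)[OF F1 m2 bal] hgraph_iso_card[OF iso FP] by simp
  moreover have "real (card P) = real (card (P \<inter> S)) + real (card (P - S))"
    using card_Int_Diff[OF fin(1), of S] by simp
  moreover have "real (card (\<Union>P)) = real (card (\<Union>P \<inter> \<Union>S)) + real (card (\<Union>P - \<Union>S))"
    using card_Int_Diff[OF fin(2), of "\<Union>S"] by simp
  ultimately show ?thesis by (simp add: algebra_simps)
qed

section \<open>Generic representations and asymmetric balancedness\<close>

lemma card_UN_eq_sum_imp_disjoint:
  assumes fin: "finite A" "finite I" "\<And>i. i \<in> I \<Longrightarrow> finite (B i)"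
    and card: "card (A \<union> (\<Union>i\<in>I. B i)) \<ge> card A + (\<Sum>i\<in>I. card (B i))"
    and i: "i \<in> I"
  shows "B i \<inter> (A \<union> (\<Union>j\<in>I - {i}. B j)) = {}"
proof (rule ccontr)
  assume "\<not> ?thesis"
  then obtain x where x: "x \<in> B i" "x \<in> A \<union> (\<Union>j\<in>I - {i}. B j)" by blast
  let ?R = "A \<union> (\<Union>j\<in>I - {i}. B j)"
  have "A \<union> (\<Union>i\<in>I. B i) = ?R \<union> (B i - {x})" using x i by blast
  then have "card (A \<union> (\<Union>i\<in>I. B i)) \<le> card ?R + card (B i - {x})" by (simp add: card_Un_le)
  also have "card ?R \<le> card A + card (\<Union>j\<in>I - {i}. B j)" by (rule card_Un_le)
  also have "card (\<Union>j\<in>I - {i}. B j) \<le> (\<Sum>j\<in>I - {i}. card (B j))" using fin by (intro card_UN_le) auto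
  also have "card (B i - {x}) < card (B i)" using x fin(3)[OF i] by (intro psubset_card_mono) auto
  also have "card A + (\<Sum>j\<in>I - {i}. card (B j)) + card (B i) = card A + (\<Sum>i\<in>I. card (B i))"
    using sum.remove[OF fin(2) i, of "\<lambda>i. card (B i)"] by simp
  finally show False using card by simp
qed

lemma fstar_rep_card:
  assumes F1: "uniform_hgraph k F1" and F2: "uniform_hgraph k F2"
    and rep: "fstar_rep F1 F2 Fs F2s e0 C"
  shows "verts Fs = verts F2s \<union> (\<Union>e\<in>edges F2s - {e0}. verts (C e) - e)"
    and "(\<Sum>e\<in>edges F2s - {e0}. card (verts (C e) - e)) = (card (edges F2) - 1) * (card (verts F1) - k)"
    and "finite (verts F2s)" "finite (edges F2s)" "card (verts F2s) = card (verts F2)"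
    and "\<And>e. e \<in> edges F2s - {e0} \<Longrightarrow> e \<subseteq> verts (C e) \<and> finite (verts (C e)) \<and> e \<subseteq> verts F2s"
proof -
  have iso2: "hgraph_iso F2 F2s" and e0: "e0 \<in> edges F2s"
    and C: "\<And>e. e \<in> edges F2s - {e0} \<Longrightarrow> hgraph_iso F1 (C e) \<and> e \<in> edges (C e)"
    and V: "verts Fs = verts F2s \<union> (\<Union>e\<in>edges F2s - {e0}. verts (C e))"
    using rep by (auto simp: fstar_rep_def)
  have u2: "uniform_hgraph k F2s" by (rule hgraph_iso_uniform[OF iso2 F2])
  have u1: "uniform_hgraph k (C e)" if "e \<in> edges F2s - {e0}" for e
    using hgraph_iso_uniform C[OF that] F1 by blast
  show fin2: "finite (verts F2s)" "finite (edges F2s)"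
    using u2 uniform_finite_edges[OF u2] by (auto simp: uniform_hgraph_def)
  show "card (verts F2s) = card (verts F2)"
    by (rule hgraph_iso_card(1)[OF iso2 uniform_edges_subset[OF F2]])
  show edge: "e \<subseteq> verts (C e) \<and> finite (verts (C e)) \<and> e \<subseteq> verts F2s" if "e \<in> edges F2s - {e0}" for e
    using u1[OF that] C[OF that] u2 that by (auto simp: uniform_hgraph_def)
  show "verts Fs = verts F2s \<union> (\<Union>e\<in>edges F2s - {e0}. verts (C e) - e)"
    unfolding V using edge by blast
  have "card (verts (C e) - e) = card (verts F1) - k" if e: "e \<in> edges F2s - {e0}" for e
  proof -
    have "card e = k" using u2 e by (auto simp: uniform_hgraph_def)
    moreover have "card (verts (C e)) = card (verts F1)"
      using C[OF e] hgraph_iso_card(1)[of F1 "C e"] uniform_edges_subset[OF F1] by blast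
    moreover have "finite e" using edge[OF e] finite_subset by blast
    ultimately show ?thesis using card_Diff_subset[of e "verts (C e)"] edge[OF e] by simp
  qed
  then have "(\<Sum>e\<in>edges F2s - {e0}. card (verts (C e) - e)) = card (edges F2s - {e0}) * (card (verts F1) - k)"
    by simp
  also have "card (edges F2s - {e0}) = card (edges F2) - 1"
    using e0 fin2 hgraph_iso_card(2)[OF iso2 uniform_edges_subset[OF F2]] by simp
  finally show "(\<Sum>e\<in>edges F2s - {e0}. card (verts (C e) - e)) = (card (edges F2) - 1) * (card (verts F1) - k)" .
qed

lemma generic_card_verts:
  assumes F1: "uniform_hgraph k F1" and F2: "uniform_hgraph k F2" and gen: "generic F1 F2 Fs"
  shows "card (verts Fs) = card (verts F2) + (card (edges F2) - 1) * (card (verts F1) - k)"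
proof -
  obtain F2s e0 C where rep: "fstar_rep F1 F2 Fs F2s e0 C"
    and g1: "\<forall>e\<in>edges F2s - {e0}. verts (C e) \<inter> verts F2s = e"
    and g2: "\<forall>e\<in>edges F2s - {e0}. \<forall>e'\<in>edges F2s - {e0}. e \<noteq> e' \<longrightarrow>
      (verts (C e) - e) \<inter> (verts (C e') - e') = {}"
    using gen unfolding generic_def by (elim exE conjE) (rule that)
  note r = fstar_rep_card[OF F1 F2 rep]
  have "card (verts Fs) = card (verts F2s) + card (\<Union>e\<in>edges F2s - {e0}. verts (C e) - e)"
    unfolding r(1)
  proof (rule card_Un_disjoint)
    show "finite (\<Union>e\<in>edges F2s - {e0}. verts (C e) - e)" using r(4,6) by blast
    show "verts F2s \<inter> (\<Union>e\<in>edges F2s - {e0}. verts (C e) - e) = {}" using g1 by blast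
  qed (rule r(3))
  also have "card (\<Union>e\<in>edges F2s - {e0}. verts (C e) - e) = (\<Sum>e\<in>edges F2s - {e0}. card (verts (C e) - e))"
    by (rule card_UN_disjoint) (use r(4,6) g2 in auto)
  finally show ?thesis using r(2,5) by simp
qed

text \<open>\<open>generic\<close> asserts that some representation is generic, but the exploration
  needs it for the one at hand. The number of vertices decides: a generic representation attains the
  upper bound common to all representations, so an overlap in any representation of the same
  hypergraph would make the count too small.\<close>

lemma generic_rep:
  assumes F1: "uniform_hgraph k F1" and F2: "uniform_hgraph k F2" and gen: "generic F1 F2 Fs"
    and rep: "fstar_rep F1 F2 Fs F2s e0 C"
  shows "\<forall>e\<in>edges F2s - {e0}. verts (C e) \<inter> verts F2s = e"
    and "\<forall>e\<in>edges F2s - {e0}. \<forall>e'\<in>edges F2s - {e0}. e \<noteq> e' \<longrightarrow>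
      (verts (C e) - e) \<inter> (verts (C e') - e') = {}"
proof -
  note r = fstar_rep_card[OF F1 F2 rep]
  have disj: "(verts (C e) - e) \<inter> (verts F2s \<union> (\<Union>j\<in>edges F2s - {e0} - {e}. verts (C j) - j)) = {}"
    if "e \<in> edges F2s - {e0}" for e
  proof (rule card_UN_eq_sum_imp_disjoint[OF r(3) _ _ _ that])
    show "card (verts F2s) + (\<Sum>e\<in>edges F2s - {e0}. card (verts (C e) - e)) \<le>
        card (verts F2s \<union> (\<Union>e\<in>edges F2s - {e0}. verts (C e) - e))"
      using generic_card_verts[OF F1 F2 gen] unfolding r(1)[symmetric] r(2,5) by simp
  qed (use r(4,6) in auto)
  show "\<forall>e\<in>edges F2s - {e0}. verts (C e) \<inter> verts F2s = e"
  proof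
    fix e assume "e \<in> edges F2s - {e0}"
    then show "verts (C e) \<inter> verts F2s = e" using disj[of e] r(6)[of e] by blast
  qed
  show "\<forall>e\<in>edges F2s - {e0}. \<forall>e'\<in>edges F2s - {e0}. e \<noteq> e' \<longrightarrow>
      (verts (C e) - e) \<inter> (verts (C e') - e') = {}"
  proof (intro ballI impI)
    fix e e' assume e: "e \<in> edges F2s - {e0}" "e' \<in> edges F2s - {e0}" "e \<noteq> e'"
    have "verts (C e') - e' \<subseteq> (\<Union>j\<in>edges F2s - {e0} - {e}. verts (C j) - j)"
      by (rule UN_upper) (use e in simp)
    then show "(verts (C e) - e) \<inter> (verts (C e') - e') = {}" using disj[OF e(1)] by blast
  qed
qed

text \<open>Asymmetric balancedness is applied to the explored part of the star, which contains the
  attachment edge \<open>e0\<close>; the ratio in it is that of new edges to new vertices.\<close>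

lemma crossing_star_density:
  assumes F1: "uniform_hgraph k F1" and F2: "uniform_hgraph k F2"
    and asym: "asymmetric_balanced k F1 F2"
    and Q: "Q \<in> copies F2" "e0 \<in> Q"
    and C: "\<And>h. h \<in> Q - {e0} \<Longrightarrow> C h \<in> copies F1" "\<And>h. h \<in> Q - {e0} \<Longrightarrow> h \<in> C h"
    and e0: "e0 \<in> S" and X: "X = Q \<union> (\<Union>h\<in>Q - {e0}. C h)" and nX: "\<not> X \<subseteq> S"
  shows "m_k2 k F1 F2 * card (\<Union>X - \<Union>S) < card (X - S) \<or>
      (m_k2 k F1 F2 * card (\<Union>X - \<Union>S) \<le> card (X - S) \<and> X \<inter> S = {e0} \<and> \<Union>X \<inter> \<Union>S = e0 \<and>
       (\<forall>h\<in>Q - {e0}. \<Union>(C h) \<inter> \<Union>Q = h) \<and>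
       (\<forall>h\<in>Q - {e0}. \<forall>h'\<in>Q - {e0}. h \<noteq> h' \<longrightarrow> (\<Union>(C h) - h) \<inter> (\<Union>(C h') - h') = {}))"
proof -
  let ?m = "m_k2 k F1 F2"
  let ?Fs = "(\<Union>X, X)" and ?F2s = "(\<Union>Q, Q)" and ?C = "\<lambda>h. (\<Union>(C h), C h)"
  have rep: "fstar_rep F1 F2 ?Fs ?F2s e0 ?C"
    unfolding fstar_rep_def
  proof (intro conjI ballI)
    show "hgraph_iso F2 ?F2s" using Q by (simp add: copies_def)
    show "verts ?Fs = verts ?F2s \<union> (\<Union>e\<in>edges ?F2s - {e0}. verts (?C e))" unfolding X by auto
  qed (use Q C X in \<open>auto simp: copies_def\<close>)
  have finQ: "finite Q"
    using Q hgraph_iso_uniform[OF _ F2] uniform_finite_edges by (fastforce simp: copies_def)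
  have finC: "finite (C h)" if "h \<in> Q - {e0}" for h
    using C(1)[OF that] hgraph_iso_uniform[OF _ F1] uniform_finite_edges by (fastforce simp: copies_def)
  have finX: "finite X" unfolding X using finQ finC by blast
  note r = fstar_rep_card[OF F1 F2 rep]
  have "finite (verts ?Fs)" unfolding r(1) using r(3,4,6) by blast
  then have finV: "finite (\<Union>X)" by simp
  have cE: "real (card X) - real (card (X \<inter> S)) = real (card (X - S))"
    using card_Int_Diff[OF finX, of S] by simp
  have cV: "real (card (\<Union>X)) - real (card (\<Union>X \<inter> \<Union>S)) = real (card (\<Union>X - \<Union>S))"
    using card_Int_Diff[OF finV, of "\<Union>S"] by simp
  show ?thesis
  proof (cases "\<Union>X \<subseteq> \<Union>S")
    \<comment> \<open>Asymmetric balancedness asks for a proper vertex subset, so it says nothing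
      here; but one new edge against no new vertex already gives the strict alternative.\<close>
    case True
    then have "card (\<Union>X - \<Union>S) = 0" by (metis Diff_eq_empty_iff card.empty)
    moreover have "card (X - S) > 0" using nX finX by (simp add: card_gt_0_iff)
    ultimately have "m_k2 k F1 F2 * card (\<Union>X - \<Union>S) < card (X - S)" by simp
    then show ?thesis ..
  next
    case False
    let ?H = "(\<Union>X \<inter> \<Union>S, X \<inter> S)"
    have att: "attachment_edge F1 F2 ?Fs e0" using rep by (auto simp: attachment_edge_def)
    have fs: "?Fs \<in> fstar F1 F2" unfolding fstar_def using rep by blast
    have e0X: "e0 \<in> X \<inter> S" using Q e0 X by blast
    have "proper_subhgraph ?H ?Fs \<and> verts ?H \<subset> verts ?Fs \<and>
        (\<exists>e0. attachment_edge F1 F2 ?Fs e0 \<and> e0 \<in> edges ?H)"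
    proof (intro conjI)
      have "subhgraph ?H ?Fs" by (auto simp: subhgraph_def)
      moreover have "X \<inter> S \<noteq> X" using nX by blast
      ultimately show "proper_subhgraph ?H ?Fs" by (simp add: proper_subhgraph_def)
      show "verts ?H \<subset> verts ?Fs" using False by auto
      show "\<exists>e0. attachment_edge F1 F2 ?Fs e0 \<and> e0 \<in> edges ?H" using att e0X by auto
    qed
    with asym fs have ratio: "(ne ?Fs - ne ?H) / (nv ?Fs - nv ?H) \<ge> ?m \<and>
          ((ne ?Fs - ne ?H) / (nv ?Fs - nv ?H) = ?m \<longrightarrow>
             (\<exists>e0. attachment_edge F1 F2 ?Fs e0 \<and> ?H = (e0, {e0})) \<and> generic F1 F2 ?Fs)"
      unfolding asymmetric_balanced_def by (metis (no_types, lifting))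
    have pos: "real (card (\<Union>X - \<Union>S)) > 0" using False finV by (simp add: card_gt_0_iff)
    have q: "(ne ?Fs - ne ?H) / (nv ?Fs - nv ?H) = real (card (X - S)) / real (card (\<Union>X - \<Union>S))"
      by (simp add: cE cV)
    show ?thesis
    proof (cases "real (card (X - S)) / real (card (\<Union>X - \<Union>S)) = ?m")
      case True
      then obtain e1 where e1: "?H = (e1, {e1})" and gen: "generic F1 F2 ?Fs" using ratio unfolding q by blast
      \<comment> \<open>Equality provides some attachment edge as the whole old part; since
        \<open>e0\<close> is old, it is that edge.\<close>
      then have "e1 = e0" using e0X by auto
      then have "X \<inter> S = {e0}" "\<Union>X \<inter> \<Union>S = e0" using e1 by auto
      moreover have "?m * card (\<Union>X - \<Union>S) \<le> card (X - S)" using True pos by (simp add: field_simps)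
      moreover note generic_rep[OF F1 F2 gen rep]
      ultimately show ?thesis by simp
    next
      case False
      then have "?m < real (card (X - S)) / real (card (\<Union>X - \<Union>S))" using ratio unfolding q by linarith
      then show ?thesis using pos by (simp add: field_simps)
    qed
  qed
qed

lemma max_density_gt_imp_dense:
  assumes E: "finite E" "finite (\<Union>E)" and m: "m > 0" and gt: "max_density (\<Union>E, E) > m"
  shows "\<exists>Y\<subseteq>E. m * card (\<Union>Y) < card Y"
proof -
  let ?G = "(\<Union>E, E)"
  let ?D = "{ne H / nv H |H. subhgraph H ?G \<and> card (verts H) \<ge> 1}"
  \<comment> \<open>Without vertices \<open>max_density\<close> has the default value 0, which
    \<open>gt\<close> and \<open>m > 0\<close> exclude.\<close>
  have V: "\<Union>E \<noteq> {}" using gt m by (auto simp: max_density_def split: if_splits)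
  have "finite {H. subhgraph H ?G}" using E by (intro finite_subhgraphs) auto
  then have "finite ((\<lambda>H. ne H / nv H) ` {H. subhgraph H ?G})" by (rule finite_imageI)
  then have finD: "finite ?D" by (rule finite_subset[rotated]) blast
  have "subhgraph ?G ?G" "card (verts ?G) \<ge> 1"
    using V E by (auto simp: subhgraph_def Suc_le_eq card_gt_0_iff)
  then have "?D \<noteq> {}" by blast
  moreover have "Max ?D > m" using gt V unfolding max_density_def fst_conv by (simp only: if_False)
  ultimately obtain H where H: "subhgraph H ?G" "card (verts H) \<ge> 1" "ne H / nv H > m"
    using Max_gr_iff[OF finD] by auto
  \<comment> \<open>Discarding the isolated vertices of \<open>H\<close> can only raise its density,
    so its edge set alone is a witness.\<close>
  have "\<Union>(edges H) \<subseteq> verts H" "finite (verts H)" using H E by (auto simp: subhgraph_def intro: finite_subset)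
  then have "card (\<Union>(edges H)) \<le> card (verts H)" by (intro card_mono)
  then have "m * card (\<Union>(edges H)) \<le> m * nv H" using m by (intro mult_left_mono) auto
  also have "\<dots> < ne H" using H(2,3) by (simp add: field_simps)
  finally show ?thesis using H(1) by (auto simp: subhgraph_def)
qed

section \<open>Between arrowing and the two-colour formulation with edge sets\<close>

theorem theorem1p8:
  fixes k r :: nat and F :: "nat \<Rightarrow> 'a hgraph"
  assumes "r \<ge> 2"
    and "\<forall>i\<in>{1..r}. uniform_hgraph k (F i)"
    and "\<forall>i\<in>{1..r}. edges (F i) \<noteq> {}"
    and "card (edges (F 2)) \<ge> 3"
    and "\<forall>i\<in>{1..<r}. m_k k (F i) \<ge> m_k k (F (i + 1))"
    and "strictly_k_balanced k (F 1)" and "strictly_k_balanced k (F 2)"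
    and "m_k k (F 2) \<ge> 1"
    and "strictly_balanced_wrt k (F 1) (F 2)"
    and "asymmetric_balanced k (F 1) (F 2)"
    and "\<forall>G :: nat hgraph. uniform_hgraph k G \<and> max_density G \<le> m_k2 k (F 1) (F 2) \<longrightarrow>
           \<not> arrows G 2 F"
  shows "\<exists>c>0. \<forall>p :: nat \<Rightarrow> real.
           (\<forall>n\<ge>1. 0 \<le> p n \<and> p n \<le> 1 \<and> p n \<le> c * real n powr (- 1 / m_k2 k (F 1) (F 2))) \<longrightarrow>
           (\<lambda>n. measure_pmf.prob (random_hgraph k n (p n)) {G. arrows G r F}) \<longlonglongrightarrow> 0"
proof -
  have F1: "uniform_hgraph k (F 1)" "edges (F 1) \<noteq> {}" and F2: "uniform_hgraph k (F 2)"
    using assms(1-3) by auto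
  have e2: "card (edges (F 2)) \<ge> 2" using assms(4) by simp
  have "m_k k (F 1) \<ge> m_k k (F (1 + 1))" using assms(1) by (intro bspec[OF assms(5)]) simp
  then have m12: "m_k k (F 1) \<ge> m_k k (F 2)" by (simp add: numeral_2_eq_2)
  have m1: "m_k k (F 1) \<ge> 1" using m12 assms(8) by simp
  have k2: "k \<ge> 2" by (rule strictly_balanced_uniformity[OF F2 assms(7,4)])
  have k1: "k \<ge> 1" using k2 by simp
  have e1: "card (edges (F 1)) \<ge> 2"
  proof (rule ccontr)
    assume "\<not> card (edges (F 1)) \<ge> 2"
    moreover have "card (edges (F 1)) \<noteq> 0" using F1 uniform_finite_edges[OF F1(1)] by simp
    ultimately have "card (edges (F 1)) = 1" by linarith
    \<comment> \<open>A single edge has density \<open>1 / k\<close> if it covers all vertices and 0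
      otherwise; both are below 1 as \<open>k \<ge> 2\<close>.\<close>
    then have "d_k k (F 1) < 1" using k2 by (simp add: d_k_def)
    then show False using m1 assms(6) by (simp add: strictly_k_balanced_def)
  qed
  have V1: "verts (F 1) = \<Union>(edges (F 1))"
    by (rule strictly_balanced_verts_eq_Union[OF F1(1) assms(6) e1 m1])
  have V2: "verts (F 2) = \<Union>(edges (F 2))"
    by (rule strictly_balanced_verts_eq_Union[OF F2 assms(7) e2 assms(8)])
  have m2: "m_k k (F 2) > 0" using assms(8) by simp
  let ?m = "m_k2 k (F 1) (F 2)"
  interpret F1: balanced_family k "card (edges (F 1))" "card (verts (F 1))" "m_k k (F 1)" "copies (F 1)"
    by (rule copies_balanced_family[OF F1(1) assms(6) k1 e1 m1])
  interpret F2: balanced_family k "card (edges (F 2))" "card (verts (F 2))" "m_k k (F 2)" "copies (F 2)"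
    by (rule copies_balanced_family[OF F2 assms(7) k1 e2 assms(8)])
  interpret copy_families k "card (edges (F 1))" "card (verts (F 1))" "m_k k (F 1)" "copies (F 1)"
    "card (edges (F 2))" "card (verts (F 2))" "m_k k (F 2)" "copies (F 2)"
    by unfold_locales (use assms(4) e1 in auto)
  interpret exploration k "card (edges (F 1))" "card (verts (F 1))" "m_k k (F 1)" "copies (F 1)"
    "card (edges (F 2))" "card (verts (F 2))" "m_k k (F 2)" "copies (F 2)" ?m
  proof
    show "?m > 0" by (rule strictly_balanced_wrt_density(1)[OF F1 m2 assms(9)])
    show "?m * card (\<Union>P - \<Union>S) < card (P - S)"
      if "P \<in> copies (F 1)" "P \<inter> S \<noteq> {}" "\<not> P \<subseteq> S" for P S
      by (rule crossing_copy_density[OF F1 m2 assms(9) that])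
  qed (rule crossing_star_density[OF F1(1) F2 assms(10)])
  have arrows_arr: "arr (edges G)" if "arrows G r F" for G :: "nat hgraph"
  proof (rule ccontr)
    assume "\<not> arr (edges G)"
    then obtain R where R: "R \<subseteq> edges G" "\<forall>P\<in>copies (F 1). \<not> P \<subseteq> R" "\<forall>Q\<in>copies (F 2). \<not> Q \<subseteq> edges G - R"
      by (rule not_arrE)
    \<comment> \<open>A red-blue colouring is read as an \<open>r\<close>-colouring. No edge gets a
      colour above 2 and every \<open>F i\<close> has an edge, so the monochromatic copy found is
      one of \<open>F 1\<close> or \<open>F 2\<close>.\<close>
    let ?col = "\<lambda>e. if e \<in> R then 1 else 2 :: nat"
    have "\<forall>e\<in>edges G. ?col e \<in> {1..r}" using assms(1) by auto
    then have "\<exists>i\<in>{1..r}. \<exists>C. subhgraph C G \<and> hgraph_iso (F i) C \<and> (\<forall>e\<in>edges C. ?col e = i)"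
      by (rule that[unfolded arrows_def, THEN spec, THEN mp])
    then obtain i C where i: "i \<in> {1..r}" and C: "subhgraph C G" "hgraph_iso (F i) C" "\<forall>e\<in>edges C. ?col e = i"
      by (elim bexE exE conjE)
    have CG: "edges C \<subseteq> edges G" using C(1) by (simp add: subhgraph_def)
    have "edges C \<noteq> {}" using C(2) i assms(3) by (auto simp: hgraph_iso_def)
    then obtain e where "e \<in> edges C" by blast
    then have "i = 1 \<or> i = 2" using C(3) by (metis (full_types))
    then show False
    proof
      assume i: "i = 1"
      have "verts C = \<Union>(edges C)" using hgraph_iso_verts_eq_Union C(2) V1 i by blast
      then have "edges C \<in> copies (F 1)" using C(2) i unfolding copies_def by (metis mem_Collect_eq prod.collapse)
      moreover have "edges C \<subseteq> R" using C(3) i by (metis numeral_eq_one_iff semiring_norm(85) subsetI)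
      ultimately show False using R by blast
    next
      assume i: "i = 2"
      have "verts C = \<Union>(edges C)" using hgraph_iso_verts_eq_Union C(2) V2 i by blast
      then have "edges C \<in> copies (F 2)" using C(2) i unfolding copies_def by (metis mem_Collect_eq prod.collapse)
      moreover have "e \<notin> R" if "e \<in> edges C" for e using C(3) i that by (metis numeral_eq_one_iff semiring_norm(85))
      then have "edges C \<subseteq> edges G - R" using CG by blast
      ultimately show False using R by blast
    qed
  qed
  have dense: "\<exists>Y\<subseteq>E. ?m * card (\<Union>Y) < card Y"
    if E: "finite E" "\<And>e. e \<in> E \<Longrightarrow> card e = k" "arr E" for E
  proof -
    have finE: "finite (\<Union>E)" using E k1 by (intro finite_Union) (auto intro!: card_ge_0_finite)
    have "uniform_hgraph k (\<Union>E, E)" using E finE by (auto simp: uniform_hgraph_def)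
    moreover have "arrows (\<Union>E, E) 2 F"
      unfolding arrows_def
    proof (intro allI impI)
      fix col :: "nat set \<Rightarrow> nat" assume col: "\<forall>e\<in>edges (\<Union>E, E). col e \<in> {1..2}"
      let ?R = "{e \<in> E. col e = 1}"
      have sub: "subhgraph (\<Union>P, P) (\<Union>E, E)" if "P \<subseteq> E" for P using that by (auto simp: subhgraph_def)
      have "?R \<subseteq> E" by blast
      then have "(\<exists>P\<in>copies (F 1). P \<subseteq> ?R) \<or> (\<exists>Q\<in>copies (F 2). Q \<subseteq> E - ?R)"
        by (rule E(3)[unfolded arr_def, THEN spec, THEN mp])
      then consider P where "P \<in> copies (F 1)" "P \<subseteq> ?R" | Q where "Q \<in> copies (F 2)" "Q \<subseteq> E - ?R"
        by (elim disjE bexE)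
      then show "\<exists>i\<in>{1..2}. \<exists>C. subhgraph C (\<Union>E, E) \<and> hgraph_iso (F i) C \<and> (\<forall>e\<in>edges C. col e = i)"
      proof cases
        case 1
        then have "subhgraph (\<Union>P, P) (\<Union>E, E) \<and> hgraph_iso (F 1) (\<Union>P, P) \<and> (\<forall>e\<in>edges (\<Union>P, P). col e = 1)"
          using sub[of P] by (auto simp: copies_def)
        then show ?thesis by (intro bexI[of _ 1]) auto
      next
        case 2
        have "col e = 2" if "e \<in> Q" for e
        proof -
          have "e \<in> E" "col e \<noteq> 1" using 2 that by auto
          then show ?thesis using col by fastforce
        qed
        then have "subhgraph (\<Union>Q, Q) (\<Union>E, E) \<and> hgraph_iso (F 2) (\<Union>Q, Q) \<and> (\<forall>e\<in>edges (\<Union>Q, Q). col e = 2)"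
          using 2 sub[of Q] by (auto simp: copies_def)
        then show ?thesis by (intro bexI[of _ 2]) auto
      qed
    qed
    \<comment> \<open>Hypothesis (iv) enters by contraposition, for the hypergraph spanned by
      \<open>E\<close>.\<close>
    ultimately have "\<not> max_density (\<Union>E, E) \<le> ?m" using assms(11) by blast
    then show ?thesis using max_density_gt_imp_dense[OF E(1) finE m_pos] by simp
  qed
  obtain c where c: "c > 0" and lim: "\<And>p :: nat \<Rightarrow> real.
      (\<forall>n\<ge>1. 0 \<le> p n \<and> p n \<le> 1 \<and> p n \<le> c * real n powr (- 1 / ?m)) \<Longrightarrow>
      (\<lambda>n. measure_pmf.prob (random_hgraph k n (p n)) {G. arr (edges G)}) \<longlonglongrightarrow> 0"
    using prob_arr_tendsto_0[OF dense] by blast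
  show ?thesis
  proof (intro exI[of _ c] conjI allI impI)
    fix p :: "nat \<Rightarrow> real"
    assume p: "\<forall>n\<ge>1. 0 \<le> p n \<and> p n \<le> 1 \<and> p n \<le> c * real n powr (- 1 / ?m)"
    show "(\<lambda>n. measure_pmf.prob (random_hgraph k n (p n)) {G. arrows G r F}) \<longlonglongrightarrow> 0"
    proof (rule tendsto_sandwich[OF _ _ tendsto_const lim[OF p]])
      show "\<forall>\<^sub>F n in sequentially. measure_pmf.prob (random_hgraph k n (p n)) {G. arrows G r F} \<le>
        measure_pmf.prob (random_hgraph k n (p n)) {G. arr (edges G)}"
        using arrows_arr by (intro always_eventually allI measure_pmf.finite_measure_mono) auto
    qed simp
  qed (rule c)
qed

end
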